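(* Let $S$ be a subcartesian space that is locally compact, second countable and connected, with structural dimension $n$. Let $m\ge 2n+1$ be an integer. Then $S$ is diffeomorphic (as a differential space) to a subset of $\mathbb{R}^m$, where the subset carries the differential structure generated by restrictions of smooth functions on $\mathbb{R}^m$.
   Context: Differential space: a topological space $S$ with a family $C^\infty(S)$ of real-valued functions such that (1) the sets $f^{-1}(I)$, with $f\in C^\infty(S)$ and $I\subseteq\mathbb{R}$ an open interval, form a subbasis of the topology of $S$; (2) if $f_1,\dots,f_r\in C^\infty(S)$ and $F\in C^\infty(\mathbb{R}^r)$ then $F(f_1,\dots,f_r)\in C^\infty(S)$; (3) if $f:S\to\mathbb{R}$ is such that every $x\in S$ has an open neighborhood $U$ and some $f_x\in C^\infty(S)$ with $f_x|U=f|U$, then $f\in C^\infty(S)$. A map $\phi:R\to S$ of differential spaces is smooth if $f\circ\phi\in C^\infty(R)$ for all $f\in C^\infty(S)$; a diffeomorphism is an invertible smooth map with smooth inverse. A subset $A$ of a differential space carries the differential structure generated by restrictions: $f:A\to\mathbb{R}$ is smooth iff every $x\in A$ has a neighborhood $V$ in $A$ and some $g\in C^\infty(S)$ with $f|V=g|V$. $\mathbb{R}^m$ carries its usual smooth functions. Subcartesian space: a Hausdorff differential space $S$ in which every point has an open neighborhood $U$ diffeomorphic to a subset of some $\mathbb{R}^k$. The structural dimension $n_x$ of $S$ at $x$ is the smallest integer such that some open neighborhood of $x$ is diffeomorphic to a subset of $\mathbb{R}^{n_x}$. The structural dimension of $S$ is the smallest integer $n$ with $n_x\le n$ for all $x\in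 S$ (in particular it is finite). *)

theory Defs
  imports "HOL-Analysis.Analysis"
begin

text \<open>
  Since the dimension has to be quantified over inside definitions, R^n is the library's
  \<^const>\<open>Euclidean_space\<close> \<open>n\<close>, whose points are the sequences \<open>x :: nat \<Rightarrow> real\<close> with \<open>x i = 0\<close>
  for \<open>i \<ge> n\<close>.  Real-valued functions on a space are total functions of which only the values
  on the carrier matter.
\<close>

text \<open>
  \<open>C_diff n k F\<close>: all partial derivatives of \<open>F\<close> of order at most \<open>k\<close> exist and are continuous
  on R^n.  For \<open>i < n\<close>, the update \<open>x(i := t)\<close> of a point of R^n is again a point of R^n.
\<close>

primrec C_diff :: "nat \<Rightarrow> nat \<Rightarrow> ((nat \<Rightarrow> real) \<Rightarrow> real) \<Rightarrow> bool" where
  "C_diff n 0 F \<longleftrightarrow> continuous_map (Euclidean_space n) euclideanreal F"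
| "C_diff n (Suc k) F \<longleftrightarrow>
     continuous_map (Euclidean_space n) euclideanreal F \<and>
     (\<forall>i<n. \<exists>G. C_diff n k G \<and>
        (\<forall>x \<in> topspace (Euclidean_space n).
           ((\<lambda>t. F (x(i := t))) has_real_derivative G x) (at (x i))))"

definition C_infinity :: "nat \<Rightarrow> ((nat \<Rightarrow> real) \<Rightarrow> real) set" where
  "C_infinity n = {F. \<forall>k. C_diff n k F}"

text \<open>
  A differential space is given by a topology \<open>S\<close> and a set \<open>C\<close> of functions.  By the
  third condition, membership in \<open>C\<close> depends only on the values on \<open>topspace S\<close>.  In the second
  condition \<open>r = 0\<close> is allowed, so that the constant functions belong to \<open>C\<close>.
\<close>

definition differential_space :: "'a topology \<Rightarrow> ('a \<Rightarrow> real) set \<Rightarrow> bool" where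
  "differential_space S C \<longleftrightarrow>
     S = topology_generated_by
           {{x \<in> topspace S. f x \<in> I} | f I. f \<in> C \<and> open I \<and> is_interval I} \<and>
     (\<forall>r F f. F \<in> C_infinity r \<and> (\<forall>i<r. f i \<in> C) \<longrightarrow>
        (\<lambda>x. F (\<lambda>i. if i < r then f i x else 0)) \<in> C) \<and>
     (\<forall>f. (\<forall>x \<in> topspace S. \<exists>U g. openin S U \<and> x \<in> U \<and> g \<in> C \<and> (\<forall>y\<in>U. g y = f y))
        \<longrightarrow> f \<in> C)"

definition smooth_map ::
    "'a topology \<Rightarrow> ('a \<Rightarrow> real) set \<Rightarrow> 'b topology \<Rightarrow> ('b \<Rightarrow> real) set \<Rightarrow> ('a \<Rightarrow> 'b) \<Rightarrow> bool" where
  "smooth_map R CR S CS \<phi> \<longleftrightarrow>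
     \<phi> \<in> topspace R \<rightarrow> topspace S \<and> (\<forall>f\<in>CS. f \<circ> \<phi> \<in> CR)"

definition diffeomorphic_spaces ::
    "'a topology \<Rightarrow> ('a \<Rightarrow> real) set \<Rightarrow> 'b topology \<Rightarrow> ('b \<Rightarrow> real) set \<Rightarrow> bool" where
  "diffeomorphic_spaces R CR S CS \<longleftrightarrow>
     (\<exists>\<phi> \<psi>. smooth_map R CR S CS \<phi> \<and> smooth_map S CS R CR \<psi> \<and>
        (\<forall>x \<in> topspace R. \<psi> (\<phi> x) = x) \<and> (\<forall>y \<in> topspace S. \<phi> (\<psi> y) = y))"

text \<open>
  The smooth functions of the differential structure on \<open>A \<subseteq> topspace S\<close> generated by
  restrictions; the accompanying topology is \<open>subtopology S A\<close>.
\<close>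

definition restricted_structure ::
    "'a topology \<Rightarrow> ('a \<Rightarrow> real) set \<Rightarrow> 'a set \<Rightarrow> ('a \<Rightarrow> real) set" where
  "restricted_structure S C A =
     {f. \<forall>x\<in>A. \<exists>V g. openin (subtopology S A) V \<and> x \<in> V \<and> g \<in> C \<and> (\<forall>y\<in>V. f y = g y)}"

definition diffeomorphic_to_subset_of_Euclidean ::
    "'a topology \<Rightarrow> ('a \<Rightarrow> real) set \<Rightarrow> nat \<Rightarrow> bool" where
  "diffeomorphic_to_subset_of_Euclidean S C k \<longleftrightarrow>
     (\<exists>A \<subseteq> topspace (Euclidean_space k).
        diffeomorphic_spaces S C
          (subtopology (Euclidean_space k) A)
          (restricted_structure (Euclidean_space k) (C_infinity k) A))"

definition locally_embeddable_at :: "'a topology \<Rightarrow> ('a \<Rightarrow> real) set \<Rightarrow> 'a \<Rightarrow> nat \<Rightarrow> bool" where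
  "locally_embeddable_at S C x k \<longleftrightarrow>
     (\<exists>U. openin S U \<and> x \<in> U \<and>
        diffeomorphic_to_subset_of_Euclidean (subtopology S U) (restricted_structure S C U) k)"

definition subcartesian_space :: "'a topology \<Rightarrow> ('a \<Rightarrow> real) set \<Rightarrow> bool" where
  "subcartesian_space S C \<longleftrightarrow>
     differential_space S C \<and> Hausdorff_space S \<and>
     (\<forall>x \<in> topspace S. \<exists>k. locally_embeddable_at S C x k)"

definition structural_dimension_at :: "'a topology \<Rightarrow> ('a \<Rightarrow> real) set \<Rightarrow> 'a \<Rightarrow> nat" where
  "structural_dimension_at S C x = (LEAST k. locally_embeddable_at S C x k)"

text \<open>
  A relation rather than a function, because the dimensions at the points may be unbounded;
  \<open>has_structural_dimension S C n\<close> includes that they are not.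
\<close>

definition has_structural_dimension :: "'a topology \<Rightarrow> ('a \<Rightarrow> real) set \<Rightarrow> nat \<Rightarrow> bool" where
  "has_structural_dimension S C n \<longleftrightarrow>
     (\<forall>x \<in> topspace S. structural_dimension_at S C x \<le> n) \<and>
     (\<forall>k. (\<forall>x \<in> topspace S. structural_dimension_at S C x \<le> k) \<longrightarrow> n \<le> k)"

end

theory Submission
  imports Defs
begin

text \<open>
  Whitney's argument, with coefficients chosen one at a time.  A locally finite partition of unity
  \<open>\<sigma> i\<close> subordinate to charts of dimension at most \<open>n\<close> gives a proper function
  \<open>R = (\<Sum>i. i * \<sigma> i)\<close> and a locally finite sequence \<open>\<Phi> k\<close> (the \<open>\<sigma> i\<close> and their
  products with chart coordinates) that separates points and tangent vectors.  The embedding is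
  \<open>F = (R, 0, \<dots>, 0) + (\<Sum>k. a k * \<Phi> k)\<close> with small vectors \<open>a k\<close> in R^m.  The vector \<open>a k\<close>
  only has to separate those pairs of points and those tangent vectors that \<open>\<Phi> k\<close> distinguishes:
  pairs that it does not distinguish keep the status they had before.  So \<open>a k\<close> has to avoid
  countably many C^1 images of open subsets of R^(2n), a null set because \<open>2 * n < m\<close>.
  Then \<open>F\<close> is injective, it is proper since it stays within bounded distance of
  \<open>(R, 0, \<dots>, 0)\<close>, and in each chart it extends to a smooth map that is an immersion at the points
  of the space; a smooth left inverse of that map recovers the chart from \<open>F\<close>.
\<close>

section \<open>Partial derivatives in countably many variables\<close>

text \<open>As S need not be compact, there is in general no finite family of charts and hence no
  embedding into one large R^N that could be projected down generically. The sum over k is only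
  locally finite, so the conditions on the coefficients have to be stated for partial sums of every
  length. A chart maps S onto an arbitrary subset of R^n, and on such a subset the derivatives of a
  function are not determined by its values. Every \<open>\<Phi> k\<close> therefore carries a
  chosen smooth extension in each chart. Immersion is a condition on these extensions and on all
  vectors of R^n, and genericity is proved on open subsets of R^(2n), not merely on pairs of points
  of S. An injective immersion could still induce a topology different from that of its image.
  Properness excludes this: it makes the inverse of F continuous on the image, so that the local
  left inverses in the charts can be used near \<open>F x\<close>. Because n varies, R^n is not a
  type; the calculus is developed for functions of sequences and rests on partial derivatives
  alone.\<close>

definition pd :: "nat \<Rightarrow> ((nat \<Rightarrow> real) \<Rightarrow> real) \<Rightarrow> (nat \<Rightarrow> real) \<Rightarrow> real" where
  "pd i F x = deriv (\<lambda>t. F (x(i := t))) (x i)"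

text \<open>Dimension-free counterpart of \<open>C_diff\<close>, on a subset of the sequence space;
  R^n enters only through truncation. Differentiability is demanded next to the condition on
  \<open>pd\<close> because \<open>deriv\<close> returns a value even where no derivative
  exists.\<close>

primrec Ck :: "nat \<Rightarrow> (nat \<Rightarrow> real) set \<Rightarrow> ((nat \<Rightarrow> real) \<Rightarrow> real) \<Rightarrow> bool" where
  "Ck 0 U F \<longleftrightarrow> continuous_on U F"
| "Ck (Suc k) U F \<longleftrightarrow> continuous_on U F \<and>
     (\<forall>i. (\<forall>x\<in>U. (\<lambda>t. F (x(i := t))) field_differentiable at (x i)) \<and> Ck k U (pd i F))"

definition smooth :: "((nat \<Rightarrow> real) \<Rightarrow> real) \<Rightarrow> bool" where
  "smooth F \<longleftrightarrow> (\<forall>k. Ck k UNIV F)"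

lemma continuous_on_upd:
  fixes f :: "'b::topological_space \<Rightarrow> nat \<Rightarrow> real"
  assumes "continuous_on A f" "continuous_on A g"
  shows "continuous_on A (\<lambda>z. (f z)(i := g z))"
proof (rule continuous_on_coordinatewise_then_product)
  fix j show "continuous_on A (\<lambda>z. ((f z)(i := g z)) j)"
    using assms by (cases "j = i") (auto intro: continuous_on_product_then_coordinatewise)
qed

lemma continuous_on_coord [continuous_intros]: "continuous_on A (\<lambda>x::nat \<Rightarrow> real. x j)"
  by (rule continuous_on_product_then_coordinatewise) (rule continuous_on_id)

lemma continuous_on_upd_pair:
  "continuous_on UNIV (\<lambda>z::(nat \<Rightarrow> real) \<times> real. (fst z)(r := snd z))"
  by (rule continuous_on_upd) (rule continuous_on_fst continuous_on_snd continuous_on_id)+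

lemma eventually_upd_in_open:
  fixes U :: "(nat \<Rightarrow> real) set"
  assumes "open U" "x \<in> U"
  shows "\<forall>\<^sub>F t in nhds (x i). x(i := t) \<in> U"
proof -
  have "continuous_on UNIV (\<lambda>t. x(i := t))"
    by (rule continuous_on_upd[OF continuous_on_const continuous_on_id])
  then have "open ((\<lambda>t. x(i := t)) -` U)" using assms(1) by (simp add: open_vimage)
  moreover have "x i \<in> (\<lambda>t. x(i := t)) -` U" using assms(2) by simp
  ultimately show ?thesis unfolding eventually_nhds by blast
qed

lemma DERIV_upd_cong:
  fixes F G :: "(nat \<Rightarrow> real) \<Rightarrow> real"
  assumes "open U" "x \<in> U" "\<And>y. y \<in> U \<Longrightarrow> F y = G y"
  shows "((\<lambda>t. F (x(i := t))) has_real_derivative D) (at (x i)) \<longleftrightarrow>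
         ((\<lambda>t. G (x(i := t))) has_real_derivative D) (at (x i))"
proof (rule DERIV_cong_ev)
  show "\<forall>\<^sub>F t in nhds (x i). F (x(i := t)) = G (x(i := t))"
    using eventually_upd_in_open[OF assms(1,2)] by (rule eventually_mono) (rule assms(3))
qed (rule refl)+

lemma pd_eqI: "((\<lambda>t. F (x(i := t))) has_real_derivative D) (at (x i)) \<Longrightarrow> pd i F x = D"
  unfolding pd_def by (rule DERIV_imp_deriv)

lemma pd_cong: "open U \<Longrightarrow> x \<in> U \<Longrightarrow> (\<And>y. y \<in> U \<Longrightarrow> F y = G y) \<Longrightarrow> pd i F x = pd i G x"
  unfolding pd_def deriv_def by (rule arg_cong[where f = Eps], rule ext, rule DERIV_upd_cong)

lemma Ck_cont: "Ck k U F \<Longrightarrow> continuous_on U F"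
  by (cases k) auto

lemma Ck_cong: "open U \<Longrightarrow> (\<And>y. y \<in> U \<Longrightarrow> F y = G y) \<Longrightarrow> Ck k U F \<longleftrightarrow> Ck k U G"
proof (induction k arbitrary: F G)
  case 0 then show ?case unfolding Ck.simps by (intro continuous_on_cong refl)
next
  case (Suc k)
  have a: "continuous_on U F \<longleftrightarrow> continuous_on U G" by (intro continuous_on_cong refl Suc.prems(2))
  have b: "(\<lambda>t. F (x(i := t))) field_differentiable at (x i) \<longleftrightarrow>
        (\<lambda>t. G (x(i := t))) field_differentiable at (x i)" if "x \<in> U" for x i
    unfolding field_differentiable_def
    by (rule arg_cong[where f = Ex], rule ext, rule DERIV_upd_cong[OF Suc.prems(1) that Suc.prems(2)])
  have c: "Ck k U (pd i F) \<longleftrightarrow> Ck k U (pd i G)" for i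
    by (rule Suc.IH[OF Suc.prems(1)]) (rule pd_cong[OF Suc.prems(1)], use Suc.prems in auto)
  show ?case unfolding Ck.simps by (simp only: a b c cong: ball_cong)
qed

text \<open>Lets a proof exhibit the derivative instead of computing \<open>pd\<close>: on an open
  set \<open>pd i F\<close> may be replaced by a function that agrees with it there.\<close>

lemma Ck_SucI:
  assumes "open U" "continuous_on U F"
    and "\<And>i. \<exists>G. Ck k U G \<and> (\<forall>x\<in>U. ((\<lambda>t. F (x(i := t))) has_real_derivative G x) (at (x i)))"
  shows "Ck (Suc k) U F"
proof -
  have "(\<forall>x\<in>U. (\<lambda>t. F (x(i := t))) field_differentiable at (x i)) \<and> Ck k U (pd i F)" for i
  proof -
    obtain G where G: "Ck k U G" "\<And>x. x \<in> U \<Longrightarrow> ((\<lambda>t. F (x(i := t))) has_real_derivative G x) (at (x i))"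
      using assms(3) by blast
    have "Ck k U (pd i F)" using Ck_cong[OF assms(1), of "pd i F" G k] G pd_eqI by blast
    then show ?thesis using G(2) unfolding field_differentiable_def by blast
  qed
  then show ?thesis using assms(2) by simp
qed

lemma Ck_deriv:
  assumes "Ck (Suc k) U F" "x \<in> U"
  shows "((\<lambda>t. F (x(i := t))) has_real_derivative pd i F x) (at (x i))"
  using assms unfolding pd_def by (auto simp: field_differentiable_derivI)

lemma Ck_pd: "Ck (Suc k) U F \<Longrightarrow> Ck k U (pd i F)"
  by simp

lemma Ck_Suc_imp: "Ck (Suc k) U F \<Longrightarrow> Ck k U F"
proof (induction k arbitrary: F)
  case (Suc k) then show ?case by (metis Ck.simps(2))
qed simp

lemma Ck_subset: "Ck k U F \<Longrightarrow> V \<subseteq> U \<Longrightarrow> Ck k V F"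
proof (induction k arbitrary: F)
  case 0 then show ?case by (auto intro: continuous_on_subset)
next
  case (Suc k) then show ?case by (auto intro: continuous_on_subset)
qed

lemma continuous_on_local:
  fixes f :: "'b::t2_space \<Rightarrow> 'c::topological_space"
  assumes "\<And>x. x \<in> U \<Longrightarrow> \<exists>V. open V \<and> x \<in> V \<and> continuous_on V f"
  shows "continuous_on U f"
  unfolding continuous_on_eq_continuous_within
proof (rule ballI)
  fix x assume "x \<in> U"
  then obtain V where "open V" "x \<in> V" "continuous_on V f" using assms by blast
  then have "isCont f x" using continuous_on_eq_continuous_at by blast
  then show "continuous (at x within U) f" by (rule continuous_at_imp_continuous_at_within)
qed

text \<open>Serves to glue a cut-off function to zero in \<open>smooth_globalize\<close>.\<close>

lemma Ck_local:
  assumes "\<And>x. x \<in> U \<Longrightarrow> \<exists>V. open V \<and> x \<in> V \<and> Ck k V F"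
  shows "Ck k U F"
  using assms
proof (induction k arbitrary: F)
  case 0
  then show ?case unfolding Ck.simps by (rule continuous_on_local)
next
  case (Suc k)
  have c: "continuous_on U F"
  proof (rule continuous_on_local)
    fix x assume "x \<in> U"
    then obtain V where "open V" "x \<in> V" "Ck (Suc k) V F" using Suc.prems by blast
    then show "\<exists>V. open V \<and> x \<in> V \<and> continuous_on V F" using Ck_cont by blast
  qed
  have d: "(\<lambda>t. F (x(i := t))) field_differentiable at (x i)" if "x \<in> U" for x i
    using Suc.prems[OF that] unfolding Ck.simps by blast
  have e: "Ck k U (pd i F)" for i
  proof (rule Suc.IH)
    fix x assume "x \<in> U"
    then obtain V where "open V" "x \<in> V" "Ck (Suc k) V F" using Suc.prems by blast
    then show "\<exists>V. open V \<and> x \<in> V \<and> Ck k V (pd i F)" using Ck_pd by blast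
  qed
  show ?case unfolding Ck.simps using c d e by blast
qed

section \<open>Closure properties of C^k functions\<close>

lemma Ck_const: "Ck k U (\<lambda>_. c)"
proof (induction k arbitrary: c)
  case (Suc k)
  have "pd i (\<lambda>_. c) = (\<lambda>_. 0)" for i by (auto simp: pd_def)
  then show ?case using Suc by auto
qed simp

lemma DERIV_coord_upd: "((\<lambda>t. (x(i := t)) j) has_real_derivative (if i = j then 1 else 0)) (at (x i))"
  by (cases "i = j") auto

lemma Ck_coord: "open U \<Longrightarrow> Ck k U (\<lambda>x. x j)"
proof (cases k)
  case 0 then show ?thesis by (simp add: continuous_on_coord)
next
  case (Suc k')
  assume "open U"
  moreover have "\<exists>G. Ck k' U G \<and> (\<forall>x\<in>U. ((\<lambda>t. (x(i := t)) j) has_real_derivative G x) (at (x i)))" for i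
    by (rule exI[of _ "\<lambda>_. if i = j then 1 else 0"], intro conjI ballI) (rule Ck_const DERIV_coord_upd)+
  ultimately show ?thesis unfolding Suc by (intro Ck_SucI continuous_on_coord)
qed

lemma Ck_add: "open U \<Longrightarrow> Ck k U F \<Longrightarrow> Ck k U G \<Longrightarrow> Ck k U (\<lambda>x. F x + G x)"
proof (induction k arbitrary: F G)
  case 0 then show ?case by (simp add: continuous_on_add)
next
  case (Suc k)
  show ?case
  proof (rule Ck_SucI[OF Suc.prems(1)])
    show "continuous_on U (\<lambda>x. F x + G x)"
      using Suc.prems by (intro continuous_on_add Ck_cont)
    show "\<exists>H. Ck k U H \<and> (\<forall>x\<in>U. ((\<lambda>t. F (x(i := t)) + G (x(i := t))) has_real_derivative H x) (at (x i)))" for i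
      using Suc.prems
      by (intro exI[of _ "\<lambda>x. pd i F x + pd i G x"] conjI ballI DERIV_add Ck_deriv Suc.IH Ck_pd)
  qed
qed

lemma Ck_mult: "open U \<Longrightarrow> Ck k U F \<Longrightarrow> Ck k U G \<Longrightarrow> Ck k U (\<lambda>x. F x * G x)"
proof (induction k arbitrary: F G)
  case 0 then show ?case by (simp add: continuous_on_mult)
next
  case (Suc k)
  show ?case
  proof (rule Ck_SucI[OF Suc.prems(1)])
    show "continuous_on U (\<lambda>x. F x * G x)"
      using Suc.prems by (intro continuous_on_mult Ck_cont)
    fix i
    have "((\<lambda>t. F (x(i := t)) * G (x(i := t))) has_real_derivative pd i F x * G x + F x * pd i G x) (at (x i))"
      if "x \<in> U" for x
      using DERIV_mult[OF Ck_deriv[OF Suc.prems(2) that] Ck_deriv[OF Suc.prems(3) that], of i]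
      by (simp add: algebra_simps del: fun_upd_apply)
    moreover have "Ck k U (\<lambda>x. pd i F x * G x + F x * pd i G x)"
      using Suc.prems by (intro Ck_add Suc.IH) (auto intro: Ck_Suc_imp Ck_pd simp del: Ck.simps)
    ultimately
    show "\<exists>H. Ck k U H \<and> (\<forall>x\<in>U. ((\<lambda>t. F (x(i := t)) * G (x(i := t))) has_real_derivative H x) (at (x i)))"
      by blast
  qed
qed

lemma Ck_sum: "open U \<Longrightarrow> (\<And>i. i \<in> I \<Longrightarrow> Ck k U (F i)) \<Longrightarrow> Ck k U (\<lambda>x. \<Sum>i\<in>I. F i x)"
  by (induction I rule: infinite_finite_induct) (auto simp: Ck_const intro: Ck_add)

lemma Ck_inverse: "open U \<Longrightarrow> Ck k U F \<Longrightarrow> (\<And>x. x \<in> U \<Longrightarrow> F x \<noteq> 0) \<Longrightarrow> Ck k U (\<lambda>x. inverse (F x))"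
proof (induction k)
  case 0 then show ?case by (simp add: continuous_on_inverse)
next
  case (Suc k)
  show ?case
  proof (rule Ck_SucI[OF Suc.prems(1)])
    show "continuous_on U (\<lambda>x. inverse (F x))"
      using Suc.prems by (intro continuous_on_inverse ballI Ck_cont)
    fix i
    have "((\<lambda>t. inverse (F (x(i := t)))) has_real_derivative
            (- 1) * (pd i F x * (inverse (F x) * inverse (F x)))) (at (x i))"
      if "x \<in> U" for x
      using DERIV_inverse_fun[OF Ck_deriv[OF Suc.prems(2) that]] Suc.prems(3)[OF that]
      by (simp add: algebra_simps del: fun_upd_apply)
    moreover have "Ck k U (\<lambda>x. (- 1) * (pd i F x * (inverse (F x) * inverse (F x))))"
      using Suc.prems by (intro Ck_mult Ck_const Ck_pd Suc.IH Ck_Suc_imp[OF Suc.prems(2)])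
    ultimately
    show "\<exists>H. Ck k U H \<and> (\<forall>x\<in>U. ((\<lambda>t. inverse (F (x(i := t)))) has_real_derivative H x) (at (x i)))"
      by blast
  qed
qed

section \<open>Increments in one coordinate and the chain rule\<close>

text \<open>By the mean value theorem, with a slope function \<open>s\<close> that converges to the partial derivative.\<close>

lemma partial_increment:
  fixes y :: "'b \<Rightarrow> nat \<Rightarrow> real" and u :: "'b \<Rightarrow> real"
  assumes U: "open U" "x \<in> U" "Ck 1 U F"
    and y: "(y \<longlongrightarrow> x) T" and u: "(u \<longlongrightarrow> x r) T"
  obtains s where "(s \<longlongrightarrow> pd r F x) T"
    "\<forall>\<^sub>F t in T. F ((y t)(r := u t)) - F (y t) = s t * (u t - y t r)"
proof -
  \<comment> \<open>The value \<open>pd r F x\<close> where the increment is zero keeps the equation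
    true there and does not disturb the limit.\<close>
  define s where "s t = (if u t = y t r then pd r F x
      else (F ((y t)(r := u t)) - F (y t)) / (u t - y t r))" for t
  have "F ((y t)(r := u t)) - F (y t) = s t * (u t - y t r)" for t
    unfolding s_def by (auto simp flip: fun_upd_def)
  moreover have "(s \<longlongrightarrow> pd r F x) T"
  proof (rule tendstoI)
    fix e :: real assume "e > 0"
    define V where "V = U \<inter> pd r F -` ball (pd r F x) e"
    have "continuous_on U (pd r F)" using U(3) Ck_cont Ck_pd by (metis One_nat_def)
    then have V: "open V" "x \<in> V" unfolding V_def using U(1,2) \<open>e > 0\<close> continuous_open_preimage[of U "pd r F"] by auto
    \<comment> \<open>A product neighbourhood is needed because the mean value point moves
      coordinate r independently of the base point \<open>y t\<close>.\<close>
    from continuous_on_upd_pair[of r] have "open ((\<lambda>z::(nat \<Rightarrow> real) \<times> real. (fst z)(r := snd z)) -` V)"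
      using V(1) by (simp add: open_vimage)
    moreover have "(x, x r) \<in> (\<lambda>z::(nat \<Rightarrow> real) \<times> real. (fst z)(r := snd z)) -` V" using V(2) by simp
    ultimately obtain A B where AB: "open A" "open B" "x \<in> A" "x r \<in> B"
      "A \<times> B \<subseteq> (\<lambda>z::(nat \<Rightarrow> real) \<times> real. (fst z)(r := snd z)) -` V"
      by (rule open_prod_elim) auto
    obtain d where d: "d > 0" "ball (x r) d \<subseteq> B" using AB(2,4) open_contains_ball by blast
    have yr: "((\<lambda>t. y t r) \<longlongrightarrow> x r) T"
    proof -
      have "isCont (\<lambda>z::nat \<Rightarrow> real. z r) x"
        by (rule continuous_on_interior[of UNIV]) (auto intro!: continuous_intros)
      from isCont_tendsto_compose[OF this y] show ?thesis .
    qed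
    have e1: "\<forall>\<^sub>F t in T. y t \<in> A" using topological_tendstoD[OF y AB(1,3)] .
    have e2: "\<forall>\<^sub>F t in T. dist (y t r) (x r) < d" using tendstoD[OF yr d(1)] .
    have e3: "\<forall>\<^sub>F t in T. dist (u t) (x r) < d" using tendstoD[OF u d(1)] .
    show "\<forall>\<^sub>F t in T. dist (s t) (pd r F x) < e"
      using e1 e2 e3
    proof eventually_elim
      case (elim t)
      have in_V: "(y t)(r := \<xi>) \<in> V" if "dist \<xi> (x r) < d" for \<xi>
      proof -
        have "(y t, \<xi>) \<in> A \<times> B" using d(2) elim(1) that by (auto simp: dist_commute)
        with AB(5) show ?thesis by auto
      qed
      have der: "((\<lambda>t'. F ((y t)(r := t'))) has_real_derivative pd r F ((y t)(r := \<xi>))) (at \<xi>)"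
        if "dist \<xi> (x r) < d" for \<xi>
        using Ck_deriv[of 0 U F "(y t)(r := \<xi>)" r] U(3) in_V[OF that] by (simp add: V_def)
      show ?case
      proof (cases "u t = y t r")
        case True then show ?thesis by (simp add: s_def \<open>e > 0\<close>)
      next
        case False
        \<comment> \<open>The quotient does not depend on the order of the endpoints, while
          \<open>MVT2\<close> wants them increasing.\<close>
        define a where "a = min (u t) (y t r)"
        define b where "b = max (u t) (y t r)"
        have ab: "a < b" using False by (auto simp: a_def b_def)
        have ball: "dist \<xi> (x r) < d" if "a \<le> \<xi>" "\<xi> \<le> b" for \<xi>
          using that elim(2,3) unfolding a_def b_def dist_real_def by (auto simp: min_def max_def split: if_splits)
        obtain \<xi> where \<xi>: "a < \<xi>" "\<xi> < b"
          "F ((y t)(r := b)) - F ((y t)(r := a)) = (b - a) * pd r F ((y t)(r := \<xi>))"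
          using MVT2[OF ab, of "\<lambda>t'. F ((y t)(r := t'))" "\<lambda>\<xi>. pd r F ((y t)(r := \<xi>))"] der ball by blast
        have "s t = pd r F ((y t)(r := \<xi>))"
          using \<xi>(3) False unfolding s_def a_def b_def
          by (auto simp: min_def max_def field_simps split: if_splits)
        then show ?thesis using in_V[OF ball, of \<xi>] \<xi>(1,2) by (simp add: V_def dist_commute)
      qed
    qed
  qed
  ultimately show ?thesis using that by auto
qed

lemma tendsto_funI:
  fixes f :: "'b \<Rightarrow> 'i \<Rightarrow> 'c::topological_space"
  assumes "\<And>i. ((\<lambda>t. f t i) \<longlongrightarrow> l i) T"
  shows "(f \<longlongrightarrow> l) T"
  using assms
  by (simp add: limitin_componentwise flip: limitin_canonical_iff euclidean_product_topology)

lemma tendsto_upd: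
  fixes c :: "'b \<Rightarrow> nat \<Rightarrow> real"
  assumes "(c \<longlongrightarrow> x) T" "(u \<longlongrightarrow> v) T"
  shows "((\<lambda>t. (c t)(r := u t)) \<longlongrightarrow> x(r := v)) T"
proof -
  have "isCont (\<lambda>z::(nat \<Rightarrow> real) \<times> real. (fst z)(r := snd z)) (x, v)"
    by (rule continuous_on_interior[of UNIV]) (auto simp: continuous_on_upd_pair simp del: fun_upd_apply)
  from isCont_tendsto_compose[OF this tendsto_Pair[OF assms]] show ?thesis by simp
qed


text \<open>Induction on the number R of moving coordinates. Freezing the last one at its initial
  value gives a curve with one moving coordinate less; what remains is an increment in a single
  coordinate, which \<open>partial_increment\<close> controls.\<close>

lemma chain_rule_curve:
  fixes c :: "real \<Rightarrow> nat \<Rightarrow> real"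
  assumes U: "open U" "c t0 \<in> U" "Ck 1 U F"
    and c: "(c \<longlongrightarrow> c t0) (at t0)"
    and c': "\<And>i. i < R \<Longrightarrow> ((\<lambda>t. c t i) has_real_derivative c' i) (at t0)"
    and const: "\<And>i t. i \<ge> R \<Longrightarrow> c t i = c t0 i"
  shows "((\<lambda>t. F (c t)) has_real_derivative (\<Sum>i<R. pd i F (c t0) * c' i)) (at t0)"
  using U(2) c c' const
proof (induction R arbitrary: c)
  case 0
  have "c t = c t0" for t by (rule ext) (rule 0(4)[OF le0])
  then have "(\<lambda>t. F (c t)) = (\<lambda>t. F (c t0))"
    by (metis (no_types))
  then show ?case by (simp only: DERIV_const lessThan_0 sum.empty)
next
  case (Suc R)
  define b where "b t = (c t)(R := c t0 R)" for t
  have b0: "b t0 = c t0" by (simp add: b_def)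
  have bl: "(b \<longlongrightarrow> c t0) (at t0)"
    using tendsto_upd[OF Suc.prems(2) tendsto_const, of R "c t0 R"] by (simp add: b_def[abs_def])
  have "((\<lambda>t. F (b t)) has_real_derivative (\<Sum>i<R. pd i F (b t0) * c' i)) (at t0)"
  proof (rule Suc.IH)
    show "((\<lambda>t. b t i) has_real_derivative c' i) (at t0)" if "i < R" for i
      using Suc.prems(3)[of i] that by (simp add: b_def)
    show "b t i = b t0 i" if "i \<ge> R" for i t
      using Suc.prems(4)[of i t] that unfolding b_def by (cases "i = R") (simp_all only: fun_upd_apply if_True if_False Suc_leI le_neq_implies_less refl)
  qed (use Suc.prems(1) bl in \<open>simp_all only: b0\<close>)
  moreover have "((\<lambda>t. F (c t) - F (b t)) has_real_derivative pd R F (c t0) * c' R) (at t0)"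
  proof -
    have uR: "((\<lambda>t. c t R) \<longlongrightarrow> c t0 R) (at t0)"
      using DERIV_isCont[OF Suc.prems(3)[of R]] by (simp add: isCont_def)
    obtain s where s: "(s \<longlongrightarrow> pd R F (c t0)) (at t0)"
      "\<forall>\<^sub>F t in at t0. F ((b t)(R := c t R)) - F (b t) = s t * (c t R - b t R)"
      using partial_increment[OF U(1) Suc.prems(1) U(3) bl uR] by blast
    have bc: "(b t)(R := c t R) = c t" for t by (auto simp: b_def)
    have "((\<lambda>t. s t * ((c t R - c t0 R) / (t - t0))) \<longlongrightarrow> pd R F (c t0) * c' R) (at t0)"
      using Suc.prems(3)[of R] by (intro tendsto_mult s(1)) (simp add: has_field_derivative_iff)
    moreover have "\<forall>\<^sub>F t in at t0. s t * ((c t R - c t0 R) / (t - t0)) =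
        ((F (c t) - F (b t)) - (F (c t0) - F (b t0))) / (t - t0)"
      using s(2) by eventually_elim (auto simp: bc b0, simp add: b_def)
    ultimately show ?thesis unfolding has_field_derivative_iff by (rule Lim_transform_eventually)
  qed
  ultimately have "((\<lambda>t. F (b t) + (F (c t) - F (b t))) has_real_derivative
      (\<Sum>i<R. pd i F (b t0) * c' i) + pd R F (c t0) * c' R) (at t0)" by (rule DERIV_add)
  then show ?case by (simp add: b0)
qed

text \<open>The hypothesis on \<open>R\<close> makes the sum in the chain rule finite.\<close>

lemma pd_compose:
  assumes U: "open U" and V: "open V" and F: "Ck 1 V F" and G: "\<And>i. Ck 1 U (G i)"
    and GV: "\<And>x. x \<in> U \<Longrightarrow> (\<lambda>i. G i x) \<in> V"
    and R: "\<And>i x t. i \<ge> R \<Longrightarrow> G i (x(j := t)) = G i x"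
    and x: "x \<in> U"
  shows "((\<lambda>t. F (\<lambda>i. G i (x(j := t)))) has_real_derivative
           (\<Sum>i<R. pd i F (\<lambda>i. G i x) * pd j (G i) x)) (at (x j))"
proof -
  let ?c = "\<lambda>t i. G i (x(j := t))"
  have x0: "x(j := x j) = x" by simp
  have der: "((\<lambda>t. ?c t i) has_real_derivative pd j (G i) x) (at (x j))" for i
    using Ck_deriv[of 0 U "G i" x j] G x by (simp del: fun_upd_apply)
  have lim: "(?c \<longlongrightarrow> ?c (x j)) (at (x j))"
  proof (rule tendsto_funI)
    fix i show "((\<lambda>t. ?c t i) \<longlongrightarrow> ?c (x j) i) (at (x j))"
      using DERIV_isCont[OF der[of i]] by (simp add: isCont_def)
  qed
  have "((\<lambda>t. F (?c t)) has_real_derivative (\<Sum>i<R. pd i F (?c (x j)) * pd j (G i) x)) (at (x j))"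
    by (rule chain_rule_curve[OF V _ F lim der]) (use GV[OF x] R in \<open>simp_all del: fun_upd_apply\<close>)
  then show ?thesis by simp
qed

lemma continuous_on_compose_coord:
  fixes G :: "nat \<Rightarrow> (nat \<Rightarrow> real) \<Rightarrow> real"
  assumes "continuous_on V F" "\<And>i. continuous_on U (G i)" "\<And>x. x \<in> U \<Longrightarrow> (\<lambda>i. G i x) \<in> V"
  shows "continuous_on U (\<lambda>x. F (\<lambda>i. G i x))"
proof (rule continuous_on_compose2[OF assms(1)])
  show "continuous_on U (\<lambda>x i. G i x)"
    by (rule continuous_on_coordinatewise_then_product) (rule assms(2))
qed (rule image_subsetI, rule assms(3))

text \<open>The bound R may depend on j, so infinitely many components may vary, as for a map that
  changes one coordinate and keeps all others. Each partial derivative is still a finite sum of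
  products, to which the induction hypothesis applies.\<close>

lemma Ck_compose:
  assumes U: "open U" and V: "open V" and F: "Ck k V F" and G: "\<And>i. Ck k U (G i)"
    and GV: "\<And>x. x \<in> U \<Longrightarrow> (\<lambda>i. G i x) \<in> V"
    and R: "\<And>j. \<exists>R. \<forall>i\<ge>R. \<forall>x t. G i (x(j := t)) = G i x"
  shows "Ck k U (\<lambda>x. F (\<lambda>i. G i x))"
  using F G
proof (induction k arbitrary: F)
  case 0
  then show ?case unfolding Ck.simps by (rule continuous_on_compose_coord[OF _ _ GV])
next
  case (Suc k)
  have G': "Ck k U (G i)" for i using Suc.prems(2) by (rule Ck_Suc_imp)
  have one: "Ck 1 V F" "Ck 1 U (G i)" for i
    using Suc.prems unfolding One_nat_def Ck.simps by (blast intro: Ck_cont)+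
  show ?case
  proof (rule Ck_SucI[OF U])
    show "continuous_on U (\<lambda>x. F (\<lambda>i. G i x))"
      by (rule continuous_on_compose_coord[OF Suc.prems[THEN Ck_cont] GV])
    fix j
    obtain R where "\<forall>i\<ge>R. \<forall>x t. G i (x(j := t)) = G i x" using R by blast
    then have "((\<lambda>t. F (\<lambda>i. G i (x(j := t)))) has_real_derivative
           (\<Sum>i<R. pd i F (\<lambda>i. G i x) * pd j (G i) x)) (at (x j))" if "x \<in> U" for x
      by (intro pd_compose[OF U V one GV _ that]) blast+
    moreover have "Ck k U (\<lambda>x. pd i F (\<lambda>i. G i x))" for i
      by (rule Suc.IH[OF Ck_pd[OF Suc.prems(1)] G'])
    then have "Ck k U (\<lambda>x. \<Sum>i<R. pd i F (\<lambda>i. G i x) * pd j (G i) x)"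
      by (intro Ck_sum[OF U] Ck_mult[OF U] Ck_pd[OF Suc.prems(2)])
    ultimately show "\<exists>H. Ck k U H \<and> (\<forall>x\<in>U. ((\<lambda>t. F (\<lambda>i. G i (x(j := t)))) has_real_derivative H x) (at (x j)))"
      by (intro exI[of _ "\<lambda>x. \<Sum>i<R. pd i F (\<lambda>i. G i x) * pd j (G i) x"] conjI ballI)
  qed
qed

section \<open>Smooth functions of sequences\<close>

lemma smooth_Ck: "smooth F \<Longrightarrow> Ck k UNIV F"
  by (simp add: smooth_def)

lemma smooth_cont: "smooth F \<Longrightarrow> continuous_on U F"
  using Ck_cont[OF smooth_Ck[of F 0]] continuous_on_subset by blast

lemma smooth_const: "smooth (\<lambda>_. c)"
  unfolding smooth_def by (intro allI Ck_const)

lemma smooth_coord: "smooth (\<lambda>x. x j)"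
  unfolding smooth_def by (intro allI Ck_coord open_UNIV)

lemma smooth_add: "smooth F \<Longrightarrow> smooth G \<Longrightarrow> smooth (\<lambda>x. F x + G x)"
  unfolding smooth_def by (intro allI Ck_add open_UNIV) simp_all

lemma smooth_mult: "smooth F \<Longrightarrow> smooth G \<Longrightarrow> smooth (\<lambda>x. F x * G x)"
  unfolding smooth_def by (intro allI Ck_mult open_UNIV) simp_all

lemma smooth_diff: "smooth F \<Longrightarrow> smooth G \<Longrightarrow> smooth (\<lambda>x. F x - G x)"
  using smooth_add[OF _ smooth_mult[OF smooth_const[of "- 1"]], of F G] by simp

lemma smooth_sum: "(\<And>i. i \<in> I \<Longrightarrow> smooth (F i)) \<Longrightarrow> smooth (\<lambda>x. \<Sum>i\<in>I. F i x)"
  unfolding smooth_def by (intro allI Ck_sum open_UNIV) simp_all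

lemma smooth_prod: "(\<And>i. i \<in> I \<Longrightarrow> smooth (F i)) \<Longrightarrow> smooth (\<lambda>x. \<Prod>i\<in>I. F i x)"
  by (induction I rule: infinite_finite_induct) (auto simp: smooth_const intro: smooth_mult)

lemma smooth_pd: "smooth F \<Longrightarrow> smooth (pd i F)"
  unfolding smooth_def using Ck_pd by blast

lemma smooth_deriv: "smooth F \<Longrightarrow> ((\<lambda>t. F (x(i := t))) has_real_derivative pd i F x) (at (x i))"
  by (rule Ck_deriv[OF smooth_Ck UNIV_I])

lemma smooth_compose:
  assumes "smooth F" "\<And>i. smooth (G i)"
    and "\<And>j. \<exists>R. \<forall>i\<ge>R. \<forall>x t. G i (x(j := t)) = G i x"
  shows "smooth (\<lambda>x. F (\<lambda>i. G i x))"
  unfolding smooth_def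
  by (intro allI Ck_compose[OF open_UNIV open_UNIV smooth_Ck smooth_Ck UNIV_I] assms)

lemma smooth_compose_finite:
  assumes "smooth F" "\<And>i. i < r \<Longrightarrow> smooth (G i)"
  shows "smooth (\<lambda>x. F (\<lambda>i. if i < r then G i x else 0))"
proof (rule smooth_compose[OF assms(1)])
  show "smooth (\<lambda>x. if i < r then G i x else 0)" for i
    using assms(2) smooth_const by (cases "i < r") simp_all
  show "\<exists>R. \<forall>i\<ge>R. \<forall>x t. (if i < r then G i (x(j := t)) else 0) = (if i < r then G i x else 0)" for j
    by (rule exI[of _ r]) (simp add: not_less)
qed

section \<open>Functions on R^n viewed as functions of sequences\<close>

definition trunc :: "nat \<Rightarrow> (nat \<Rightarrow> real) \<Rightarrow> nat \<Rightarrow> real" where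
  "trunc n x = (\<lambda>i. if i < n then x i else 0)"

lemma trunc_in: "trunc n x \<in> topspace (Euclidean_space n)"
  by (simp add: trunc_def topspace_Euclidean_space)

lemma trunc_id: "x \<in> topspace (Euclidean_space n) \<Longrightarrow> trunc n x = x"
  by (auto simp: trunc_def topspace_Euclidean_space fun_eq_iff)

lemma trunc_upd: "trunc n (x(i := t)) = (if i < n then (trunc n x)(i := t) else trunc n x)"
  by (auto simp: trunc_def fun_eq_iff)

lemma trunc_trunc: "trunc n (trunc n x) = trunc n x"
  by (simp add: trunc_def fun_eq_iff)

lemma continuous_on_trunc: "continuous_on UNIV (trunc n)"
proof (rule continuous_on_coordinatewise_then_product)
  show "continuous_on UNIV (\<lambda>x. trunc n x i)" for i
    by (cases "i < n") (simp_all add: trunc_def continuous_on_coord)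
qed

lemma continuous_map_Euclidean_trunc:
  "continuous_map (Euclidean_space n) euclideanreal F \<longleftrightarrow> continuous_on UNIV (\<lambda>x. F (trunc n x))"
proof
  assume "continuous_map (Euclidean_space n) euclideanreal F"
  then have "continuous_on (topspace (Euclidean_space n)) F"
    by (simp add: continuous_map_Euclidean_space_iff)
  then show "continuous_on UNIV (\<lambda>x. F (trunc n x))"
    by (rule continuous_on_compose2[OF _ continuous_on_trunc]) (use trunc_in in blast)
next
  assume "continuous_on UNIV (\<lambda>x. F (trunc n x))"
  then have "continuous_on (topspace (Euclidean_space n)) (\<lambda>x. F (trunc n x))"
    by (rule continuous_on_subset) simp
  then have "continuous_on (topspace (Euclidean_space n)) F"
    by (rule continuous_on_eq) (simp add: trunc_id)
  then show "continuous_map (Euclidean_space n) euclideanreal F"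
    by (simp add: continuous_map_Euclidean_space_iff)
qed

text \<open>Composing with the projection \<open>trunc n\<close> gives F a meaning off R^n.
  Derivatives in directions i \<ge> n then vanish, and those in directions i < n are the ones of F
  at the truncated point.\<close>

lemma C_diff_iff_Ck: "C_diff n k F \<longleftrightarrow> Ck k UNIV (\<lambda>x. F (trunc n x))"
proof (induction k arbitrary: F)
  case 0
  show ?case by (simp add: continuous_map_Euclidean_trunc)
next
  case (Suc k)
  show ?case
  proof
    assume L: "C_diff n (Suc k) F"
    show "Ck (Suc k) UNIV (\<lambda>x. F (trunc n x))"
    proof (rule Ck_SucI[OF open_UNIV])
      show "continuous_on UNIV (\<lambda>x. F (trunc n x))"
        using L by (simp add: continuous_map_Euclidean_trunc)
      fix i
      show "\<exists>G. Ck k UNIV G \<and> (\<forall>x\<in>UNIV. ((\<lambda>t. F (trunc n (x(i := t)))) has_real_derivative G x) (at (x i)))"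
      proof (cases "i < n")
        case True
        then obtain G where G: "C_diff n k G" "\<And>x. x \<in> topspace (Euclidean_space n) \<Longrightarrow>
            ((\<lambda>t. F (x(i := t))) has_real_derivative G x) (at (x i))"
          using L by auto
        have "((\<lambda>t. F (trunc n (x(i := t)))) has_real_derivative G (trunc n x)) (at (x i))" for x
        proof -
          have "trunc n x i = x i" using True by (simp add: trunc_def)
          then show ?thesis using G(2)[OF trunc_in[of n x]] True by (simp add: trunc_upd del: fun_upd_apply)
        qed
        moreover have "Ck k UNIV (\<lambda>x. G (trunc n x))" using G(1) Suc.IH by simp
        ultimately show ?thesis by (intro exI[of _ "\<lambda>x. G (trunc n x)"] conjI ballI)
      next
        case False
        then show ?thesis
          by (intro exI[of _ "\<lambda>_. 0"] conjI ballI Ck_const) (simp add: trunc_upd del: fun_upd_apply)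
      qed
    qed
  next
    let ?F = "\<lambda>x. F (trunc n x)"
    assume R: "Ck (Suc k) UNIV ?F"
    have "\<exists>G. C_diff n k G \<and> (\<forall>x \<in> topspace (Euclidean_space n).
           ((\<lambda>t. F (x(i := t))) has_real_derivative G x) (at (x i)))" if "i < n" for i
    proof (intro exI conjI ballI)
      have "pd i ?F (trunc n x) = pd i ?F x" for x
      proof -
        have "trunc n x i = x i" using that by (simp add: trunc_def)
        then show ?thesis unfolding pd_def by (simp add: trunc_upd trunc_trunc that del: fun_upd_apply)
      qed
      then show "C_diff n k (pd i ?F)" unfolding Suc.IH using Ck_pd[OF R, of i] by simp
      fix x assume "x \<in> topspace (Euclidean_space n)"
      then have "trunc n x = x" by (rule trunc_id)
      then show "((\<lambda>t. F (x(i := t))) has_real_derivative pd i ?F x) (at (x i))"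
        using Ck_deriv[OF R UNIV_I, of x i] that by (simp add: trunc_upd del: fun_upd_apply)
    qed
    moreover have "continuous_on UNIV ?F" by (rule Ck_cont[OF R])
    ultimately show "C_diff n (Suc k) F" by (simp add: continuous_map_Euclidean_trunc del: fun_upd_apply)
  qed
qed

lemma C_infinity_iff_smooth: "F \<in> C_infinity n \<longleftrightarrow> smooth (\<lambda>x. F (trunc n x))"
  by (simp add: C_infinity_def smooth_def C_diff_iff_Ck)

lemma smooth_in_C_infinity:
  assumes "smooth F" shows "F \<in> C_infinity n"
  unfolding C_infinity_iff_smooth trunc_def by (intro smooth_compose_finite assms smooth_coord)

section \<open>Bump functions\<close>

text \<open>The denominators \<open>t ^ k\<close> make this family, up to linear combinations,
  closed under differentiation, so smoothness is one induction for all k together.\<close>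

definition flat :: "nat \<Rightarrow> real \<Rightarrow> real" where
  "flat k t = (if t > 0 then exp (- 1 / t) / t ^ k else 0)"

lemma flat_at_right_0: "(flat k \<longlongrightarrow> 0) (at_right 0)"
proof -
  have "((\<lambda>t. inverse t ^ k / exp (inverse t)) \<longlongrightarrow> 0) (at_right (0::real))"
    by (rule filterlim_compose[OF tendsto_power_div_exp_0 filterlim_inverse_at_top_right])
  moreover have "\<forall>\<^sub>F t in at_right (0::real). inverse t ^ k / exp (inverse t) = flat k t"
    using eventually_at_right_less[of 0]
    by eventually_elim (simp add: flat_def exp_minus field_simps)
  ultimately show ?thesis by (rule Lim_transform_eventually)
qed

lemma flat_DERIV: "(flat k has_real_derivative flat (k + 2) t - real k * flat (k + 1) t) (at t)"
proof -
  consider "t > 0" | "t < 0" | "t = 0" by linarith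
  then show ?thesis
  proof cases
    case 1
    have "((\<lambda>t. exp (- 1 / t) / t ^ k) has_real_derivative flat (k + 2) t - real k * flat (k + 1) t) (at t)"
    proof -
      have a: "((\<lambda>t. exp (- 1 / t)) has_real_derivative exp (- 1 / t) * (1 / t\<^sup>2)) (at t)"
        using 1 by (auto intro!: derivative_eq_intros simp: power2_eq_square)
      have "((\<lambda>t. t ^ k) has_real_derivative real k * t ^ (k - 1)) (at t)"
        by (auto intro!: derivative_eq_intros)
      moreover have "real k * t ^ (k - 1) = real k * t ^ k / t" using 1 by (cases k) auto
      ultimately have b: "((\<lambda>t. t ^ k) has_real_derivative real k * t ^ k / t) (at t)" by (simp only:)
      have "((\<lambda>t. exp (- 1 / t) / t ^ k) has_real_derivative
          (exp (- 1 / t) * (1 / t\<^sup>2) * t ^ k - exp (- 1 / t) * (real k * t ^ k / t)) / (t ^ k * t ^ k)) (at t)"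
        using 1 by (intro DERIV_divide[OF a b]) simp
      moreover have "(exp (- 1 / t) * (1 / t\<^sup>2) * t ^ k - exp (- 1 / t) * (real k * t ^ k / t)) / (t ^ k * t ^ k)
          = flat (k + 2) t - real k * flat (k + 1) t"
        using 1 by (simp add: flat_def divide_simps power_add power2_eq_square) (simp add: algebra_simps)
      ultimately show ?thesis by (simp only:)
    qed
    moreover have "\<forall>\<^sub>F s in nhds t. exp (- 1 / s) / s ^ k = flat k s"
      using eventually_nhds_in_open[of "{0<..}" t] 1 by (auto elim!: eventually_mono simp: flat_def)
    ultimately show ?thesis by (simp only: DERIV_cong_ev[OF refl _ refl])
  next
    case 2
    have "\<forall>\<^sub>F s in nhds t. 0 = flat k s"
      using eventually_nhds_in_open[of "{..<0}" t] 2 by (auto elim!: eventually_mono simp: flat_def)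
    moreover have "((\<lambda>_. 0) has_real_derivative flat (k + 2) t - real k * flat (k + 1) t) (at t)"
      using 2 by (simp add: flat_def)
    ultimately show ?thesis by (simp only: DERIV_cong_ev[OF refl _ refl])
  next
    case 3
    have "((\<lambda>s. (flat k s - flat k 0) / (s - 0)) \<longlongrightarrow> 0) (at 0)"
      unfolding filterlim_at_split
    proof
      show "((\<lambda>s. (flat k s - flat k 0) / (s - 0)) \<longlongrightarrow> 0) (at_left 0)"
        by (rule Lim_transform_eventually[OF tendsto_const])
           (simp add: flat_def eventually_at_filter)
      \<comment> \<open>Dividing by s raises the exponent: to the right of 0 the difference quotient
        is \<open>flat (Suc k) s\<close>.\<close>
      show "((\<lambda>s. (flat k s - flat k 0) / (s - 0)) \<longlongrightarrow> 0) (at_right 0)"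
      proof (rule Lim_transform_eventually[OF flat_at_right_0[of "Suc k"]])
        show "\<forall>\<^sub>F s in at_right 0. flat (Suc k) s = (flat k s - flat k 0) / (s - 0)"
          using eventually_at_right_less[of 0] by eventually_elim (simp add: flat_def field_simps)
      qed
    qed
    then show ?thesis using 3 by (simp add: has_field_derivative_iff flat_def)
  qed
qed

lemma flat_cont: "continuous_on UNIV (flat k)"
  using flat_DERIV DERIV_isCont continuous_at_imp_continuous_on by blast

lemma Ck_flat: "open U \<Longrightarrow> Ck k U F \<Longrightarrow> Ck k U (\<lambda>x. flat j (F x))"
proof (induction k arbitrary: j)
  case 0
  then show ?case unfolding Ck.simps by (rule_tac continuous_on_compose2[OF flat_cont]) simp_all
next
  case (Suc k)
  show ?case
  proof (rule Ck_SucI[OF Suc.prems(1)])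
    show "continuous_on U (\<lambda>x. flat j (F x))"
      by (rule continuous_on_compose2[OF flat_cont Ck_cont[OF Suc.prems(2)]]) simp
    fix i
    let ?G = "\<lambda>x. (flat (j + 2) (F x) + (- real j) * flat (j + 1) (F x)) * pd i F x"
    have "((\<lambda>t. flat j (F (x(i := t)))) has_real_derivative ?G x) (at (x i))" if "x \<in> U" for x
      using DERIV_chain2[OF _ Ck_deriv[OF Suc.prems(2) that], of "flat j" _ i] flat_DERIV[of j "F x"]
      by (simp del: fun_upd_apply)
    moreover have "Ck k U ?G"
      using Suc.IH[OF Suc.prems(1) Ck_Suc_imp[OF Suc.prems(2)]]
      by (intro Ck_mult[OF Suc.prems(1)] Ck_add[OF Suc.prems(1)] Ck_const Ck_pd[OF Suc.prems(2)])
    ultimately show "\<exists>G. Ck k U G \<and> (\<forall>x\<in>U. ((\<lambda>t. flat j (F (x(i := t)))) has_real_derivative G x) (at (x i)))"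
      by (intro exI[of _ ?G] conjI ballI)
  qed
qed

text \<open>Smooth cut-off that falls from 1 to 0 on the interval [1,2]. As \<open>2 - t\<close> and
  \<open>t - 1\<close> add up to 1, one of them is positive and the denominator cannot
  vanish.\<close>

definition step :: "real \<Rightarrow> real" where
  "step t = flat 0 (2 - t) * inverse (flat 0 (2 - t) + flat 0 (t - 1))"

lemma step_denom: "flat 0 (2 - t) + flat 0 (t - 1) > 0"
  by (cases "t < 2") (auto simp: flat_def intro: add_pos_nonneg)

lemma smooth_step:
  assumes "smooth F" shows "smooth (\<lambda>x. step (F x))"
proof -
  have fl: "smooth (\<lambda>x. flat j (G x))" if "smooth G" for j G
    using that unfolding smooth_def by (intro allI Ck_flat open_UNIV) simp
  have a: "smooth (\<lambda>x. flat 0 (2 - F x))" "smooth (\<lambda>x. flat 0 (F x - 1))"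
    by (rule fl, intro smooth_diff smooth_const assms)+
  have "smooth (\<lambda>x. inverse (flat 0 (2 - F x) + flat 0 (F x - 1)))"
    unfolding smooth_def
  proof (intro allI Ck_inverse open_UNIV)
    show "Ck k UNIV (\<lambda>x. flat 0 (2 - F x) + flat 0 (F x - 1))" for k
      using smooth_add[OF a] by (rule smooth_Ck)
    show "flat 0 (2 - F x) + flat 0 (F x - 1) \<noteq> 0" for x using step_denom[of "F x"] by simp
  qed
  from smooth_mult[OF a(1) this] show ?thesis by (simp add: step_def)
qed

lemma step_eq_1: "t \<le> 1 \<Longrightarrow> step t = 1"
  using step_denom[of t] by (simp add: step_def flat_def)

lemma step_eq_0: "t \<ge> 2 \<Longrightarrow> step t = 0"
  by (simp add: step_def flat_def)

lemma step_nonneg: "step t \<ge> 0"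
  using step_denom[of t] by (auto simp: step_def flat_def)

lemma step_le_1: "step t \<le> 1"
  using step_denom[of t] by (simp add: step_def flat_def field_simps)

text \<open>A basic neighbourhood of the product topology restricts only finitely many coordinates,
  so a finite product of one-variable cut-offs suffices.\<close>

lemma smooth_bump:
  fixes p :: "nat \<Rightarrow> real"
  assumes "open V" "p \<in> V"
  obtains \<beta> where "smooth \<beta>" "\<beta> p = 1" "\<And>x. x \<notin> V \<Longrightarrow> \<beta> x = 0"
proof -
  have "openin (product_topology (\<lambda>_. euclideanreal) UNIV) V"
    using assms(1) by (simp add: open_fun_def)
  then obtain U where U: "finite {i. U i \<noteq> UNIV}" "\<And>i. open (U i)" "p \<in> Pi\<^sub>E UNIV U" "Pi\<^sub>E UNIV U \<subseteq> V"
    using assms(2) unfolding openin_product_topology_alt by auto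
  have "\<exists>r>0. ball (p i) r \<subseteq> U i" for i
    using U(2,3) by (auto simp: PiE_iff open_contains_ball)
  then obtain r where r: "\<And>i. r i > 0" "\<And>i. ball (p i) (r i) \<subseteq> U i" by metis
  define J where "J = {i. U i \<noteq> UNIV}"
  \<comment> \<open>The factor \<open>2 / (r i)\<^sup>2\<close> lets the argument reach 2, where
    \<open>step\<close> becomes 0, at distance \<open>r i\<close> from \<open>p i\<close>.\<close>
  define \<beta> where "\<beta> x = (\<Prod>i\<in>J. step (2 / (r i)\<^sup>2 * ((x i - p i) * (x i - p i))))" for x
  have "smooth \<beta>" unfolding \<beta>_def[abs_def]
    by (intro smooth_prod smooth_step smooth_mult smooth_diff smooth_const smooth_coord)
  moreover have "\<beta> p = 1" by (simp add: \<beta>_def step_eq_1)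
  moreover have "\<beta> x = 0" if xV: "x \<notin> V" for x
  proof -
    obtain i where i: "x i \<notin> U i" using U(4) xV by (auto simp: PiE_iff)
    have "\<bar>x i - p i\<bar> \<ge> r i"
    proof (rule ccontr)
      assume "\<not> ?thesis"
      then have "x i \<in> ball (p i) (r i)" by (simp add: dist_real_def abs_minus_commute)
      with i r(2) show False by blast
    qed
    then have "(r i)\<^sup>2 \<le> (x i - p i)\<^sup>2" using r(1)[of i] by (metis abs_le_square_iff abs_of_pos)
    then have "2 / (r i)\<^sup>2 * ((x i - p i) * (x i - p i)) \<ge> 2"
      using r(1)[of i] by (simp add: field_simps power2_eq_square)
    then have "step (2 / (r i)\<^sup>2 * ((x i - p i) * (x i - p i))) = 0" by (rule step_eq_0)
    moreover have "i \<in> J" using i by (auto simp: J_def)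
    ultimately show ?thesis unfolding \<beta>_def using U(1) by (intro prod_zero) (auto simp: J_def)
  qed
  ultimately show ?thesis using that by blast
qed

text \<open>\<open>\<beta>\<close> is only known to vanish on the complement of N, which is closed.
  \<open>\<kappa>\<close> vanishes on the open set around it where \<open>\<beta>\<close> is below
  1/3, and equals 1 where \<open>\<beta>\<close> exceeds 2/3; hence \<open>\<kappa> * h\<close>
  extends by zero and agrees with h near q.\<close>

lemma smooth_globalize:
  assumes N: "open N" "q \<in> N" and h: "\<And>k. Ck k N h"
  obtains h' V where "smooth h'" "open V" "q \<in> V" "V \<subseteq> N" "\<And>x. x \<in> V \<Longrightarrow> h' x = h x"
proof -
  obtain \<beta> where b: "smooth \<beta>" "\<beta> q = 1" "\<And>x. x \<notin> N \<Longrightarrow> \<beta> x = 0" using smooth_bump[OF N] by blast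
  define \<kappa> where "\<kappa> x = 1 - step (3 * \<beta> x)" for x
  have k: "smooth \<kappa>" unfolding \<kappa>_def[abs_def] by (intro smooth_diff smooth_const smooth_step smooth_mult b)
  define h' where "h' x = (if x \<in> N then \<kappa> x * h x else 0)" for x
  have cb: "continuous_on UNIV \<beta>" using b(1) by (rule smooth_cont)
  have "smooth h'" unfolding smooth_def
  proof (intro allI Ck_local)
    fix k x
    show "\<exists>V. open V \<and> x \<in> V \<and> Ck k V h'"
    proof (cases "x \<in> N")
      case True
      have "Ck k N (\<lambda>x. \<kappa> x * h x)"
        by (rule Ck_mult[OF N(1) Ck_subset[OF smooth_Ck[OF k] subset_UNIV] h])
      then have "Ck k N h'" using Ck_cong[OF N(1), of h' "\<lambda>x. \<kappa> x * h x" k] by (simp add: h'_def)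
      with True N show ?thesis by blast
    next
      case False
      define V where "V = {x. \<beta> x < 1/3}"
      have "open V" unfolding V_def by (intro open_Collect_less cb continuous_on_const)
      moreover have "h' y = 0" if "y \<in> V" for y
        using that by (simp add: V_def h'_def \<kappa>_def step_eq_1)
      then have "Ck k V h'" using Ck_cong[OF \<open>open V\<close>, of h' "\<lambda>_. 0" k] Ck_const by simp
      moreover have "x \<in> V" using b(3)[OF False] by (simp add: V_def)
      ultimately show ?thesis by blast
    qed
  qed
  moreover define V where "V = {x. 2/3 < \<beta> x}"
  have "open V" unfolding V_def by (intro open_Collect_less cb continuous_on_const)
  moreover have "q \<in> V" using b by (simp add: V_def)
  moreover have VN: "V \<subseteq> N" using b(3) by (force simp: V_def)
  moreover have "h' x = h x" if "x \<in> V" for x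
    using that VN by (auto simp: h'_def \<kappa>_def V_def step_eq_0)
  ultimately show ?thesis using that by blast
qed

section \<open>Smooth left inverses of immersions\<close>

lemma Ck_compose_upd:
  assumes "open U" "Ck k UNIV F" "Ck k U u"
  shows "Ck k U (\<lambda>y. F (y(i := u y)))"
proof -
  have "Ck k U (\<lambda>x. F (\<lambda>l. (if l = i then u else (\<lambda>x. x l)) x))"
  proof (rule Ck_compose[OF assms(1) open_UNIV assms(2)])
    show "Ck k U (if l = i then u else (\<lambda>x. x l))" for l
      using assms(3) Ck_coord[OF assms(1)] by simp
    show "\<exists>R. \<forall>l\<ge>R. \<forall>x t. (if l = i then u else (\<lambda>x. x l)) (x(j := t)) = (if l = i then u else (\<lambda>x. x l)) x" for j
      by (rule exI[of _ "Suc (max i j)"]) auto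
  qed simp
  moreover have "(\<lambda>l. (if l = i then u else (\<lambda>x. x l)) x) = x(i := u x)" for x by auto
  ultimately show ?thesis by (simp del: fun_upd_apply)
qed

lemma smooth_compose_upd: "smooth F \<Longrightarrow> smooth u \<Longrightarrow> smooth (\<lambda>y. F (y(i := u y)))"
  unfolding smooth_def using Ck_compose_upd[OF open_UNIV] by blast

lemma continuous_on_coord_upd: "continuous_on U u \<Longrightarrow> continuous_on U (\<lambda>y::nat \<Rightarrow> real. y(i := u y))"
  by (rule continuous_on_upd[OF continuous_on_id])

lemma open_Collect_upd:
  assumes "open A" "continuous_on UNIV u"
  shows "open {y::nat \<Rightarrow> real. y(i := u y) \<in> A}"
  using open_vimage[OF assms(1) continuous_on_coord_upd[OF assms(2)]] by (simp only: vimage_def)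

text \<open>
  The map \<open>x \<mapsto> x(i := g x)\<close> exchanges the coordinate \<open>x i\<close> for the function \<open>g\<close>; its local
  inverse is \<open>y \<mapsto> y(i := h y)\<close>.
\<close>

lemma exchange_coordinate_pos:
  assumes g: "smooth g" and p: "pd i g p > 0"
  obtains h V where "smooth h" "open V" "p \<in> V" "\<And>x. x \<in> V \<Longrightarrow> h (x(i := g x)) = x i"
proof -
  define W where "W = {x. 0 < pd i g x}"
  have "open W" unfolding W_def by (intro open_Collect_less continuous_on_const smooth_cont smooth_pd g)
  have "open ((\<lambda>z::(nat \<Rightarrow> real) \<times> real. (fst z)(i := snd z)) -` W)"
    using continuous_on_upd_pair[of i] \<open>open W\<close> by (simp add: open_vimage)
  moreover have "(p, p i) \<in> (\<lambda>z::(nat \<Rightarrow> real) \<times> real. (fst z)(i := snd z)) -` W" using p by (simp add: W_def)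
  ultimately obtain A B where AB: "open A" "open B" "p \<in> A" "p i \<in> B"
      "A \<times> B \<subseteq> (\<lambda>z::(nat \<Rightarrow> real) \<times> real. (fst z)(i := snd z)) -` W"
    by (rule open_prod_elim) auto
  obtain d where d: "d > 0" "cball (p i) d \<subseteq> B" using AB(2,4) open_contains_cball by blast
  define a where "a = p i - d"
  define b where "b = p i + d"
  have ab: "a < p i" "p i < b" "a < b" using d(1) by (auto simp: a_def b_def)
  have in_W: "y(i := t) \<in> W" if "y(i := p i) \<in> A" "a \<le> t" "t \<le> b" for y t
  proof -
    have "(y(i := p i), t) \<in> A \<times> B" using that d(2) by (auto simp: a_def b_def dist_real_def subset_iff)
    with AB(5) show ?thesis by auto
  qed
  have g_der: "((\<lambda>t. g (y(i := t))) has_real_derivative pd i g (y(i := t))) (at t)" for y t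
    using smooth_deriv[OF g, of "y(i := t)" i] by simp
  have g_mono: "g (y(i := s)) < g (y(i := t))" if "y(i := p i) \<in> A" "a \<le> s" "s < t" "t \<le> b" for y s t
  proof (rule DERIV_pos_imp_increasing[OF that(3)])
    fix x assume "s \<le> x" "x \<le> t"
    then have "y(i := x) \<in> W" using in_W that by simp
    then show "\<exists>D. ((\<lambda>t. g (y(i := t))) has_real_derivative D) (at x) \<and> 0 < D"
      using g_der[of y x] unfolding W_def by blast
  qed
  have g_cont_upd: "continuous_on UNIV (\<lambda>y. g (y(i := c)))" for c
    by (rule continuous_on_compose2[OF smooth_cont[OF g, of UNIV] continuous_on_coord_upd[OF continuous_on_const]]) simp
  \<comment> \<open>Here \<open>y i\<close> is the value that g has to attain on the line in
    direction i through y. The strict inequalities at the ends a and b make N open and yield a root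
    by the intermediate value theorem; the condition on A makes g increasing between a and
    b.\<close>
  define N where "N = {y. y(i := p i) \<in> A} \<inter> ({y. g (y(i := a)) < y i} \<inter> {y. y i < g (y(i := b))})"
  have "open {y. y(i := p i) \<in> A}" by (rule open_Collect_upd[OF AB(1) continuous_on_const])
  then have oN: "open N" unfolding N_def
    by (intro open_Int open_Collect_less g_cont_upd continuous_on_coord)
  have qN: "p(i := g p) \<in> N"
    using g_mono[of p a "p i"] g_mono[of p "p i" b] AB(3) ab by (simp add: N_def)
  define h where "h y = (THE t. a < t \<and> t < b \<and> g (y(i := t)) = y i)" for y
  have h: "a < h y \<and> h y < b \<and> g (y(i := h y)) = y i" if y: "y \<in> N" for y
    unfolding h_def
  proof (rule theI')
    have yA: "y(i := p i) \<in> A" and ya: "g (y(i := a)) < y i" and yb: "y i < g (y(i := b))"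
      using y by (auto simp: N_def)
    obtain t where t: "a \<le> t" "t \<le> b" "g (y(i := t)) = y i"
      using IVT[of "\<lambda>t. g (y(i := t))" a "y i" b] ya yb ab(3) g_der DERIV_isCont by fastforce
    show "\<exists>!t. a < t \<and> t < b \<and> g (y(i := t)) = y i"
    proof (rule ex1I[of _ t])
      show "a < t \<and> t < b \<and> g (y(i := t)) = y i" using t ya yb by (metis order_less_irrefl order_le_less)
      fix s assume "a < s \<and> s < b \<and> g (y(i := s)) = y i"
      then show "s = t" using g_mono[OF yA, of s t] g_mono[OF yA, of t s] t by (cases s t rule: linorder_cases) auto
    qed
  qed
  have h_unique: "h y = t" if "y \<in> N" "a \<le> t" "t \<le> b" "g (y(i := t)) = y i" for y t
    using h[OF that(1)] g_mono[of y t "h y"] g_mono[of y "h y" t] that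
    by (cases "h y" t rule: linorder_cases) (auto simp: N_def)
  have h_cont: "isCont h y" if y: "y \<in> N" for y
    unfolding isCont_def
  proof (rule order_tendstoI)
    have yA: "y(i := p i) \<in> A" using y by (simp add: N_def)
    have evN: "\<forall>\<^sub>F x in at y. x \<in> N" using oN y by (rule eventually_at_in_open')
    {
      fix l assume "l < h y"
      obtain t where t: "max l a < t" "t < h y" using dense[of "max l a" "h y"] \<open>l < h y\<close> h[OF y] by auto
      \<comment> \<open>By monotonicity, \<open>g (x(i := t)) < x i\<close> forces
        \<open>t < h x\<close>, and this is an open condition on x.\<close>
      define M where "M = {x. g (x(i := t)) < x i}"
      have "open M" unfolding M_def by (intro open_Collect_less g_cont_upd continuous_on_coord)
      moreover have "y \<in> M" using g_mono[OF yA, of t "h y"] h[OF y] t by (simp add: M_def)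
      ultimately have "\<forall>\<^sub>F x in at y. x \<in> M" by (rule eventually_at_in_open')
      with evN show "\<forall>\<^sub>F x in at y. l < h x"
      proof eventually_elim
        case (elim x)
        then have "\<not> h x \<le> t" using g_mono[of x "h x" t] h[of x] h[OF y] t
          by (cases "h x = t") (auto simp: M_def N_def)
        then show ?case using t by simp
      qed
    }
    {
      fix l assume "h y < l"
      obtain t where t: "h y < t" "t < min l b" using dense[of "h y" "min l b"] \<open>h y < l\<close> h[OF y] by auto
      define M where "M = {x. x i < g (x(i := t))}"
      have "open M" unfolding M_def by (intro open_Collect_less g_cont_upd continuous_on_coord)
      moreover have "y \<in> M" using g_mono[OF yA, of "h y" t] h[OF y] t by (simp add: M_def)
      ultimately have "\<forall>\<^sub>F x in at y. x \<in> M" by (rule eventually_at_in_open')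
      with evN show "\<forall>\<^sub>F x in at y. h x < l"
      proof eventually_elim
        case (elim x)
        then have "\<not> t \<le> h x" using g_mono[of x t "h x"] h[of x] h[OF y] t
          by (cases "h x = t") (auto simp: M_def N_def)
        then show ?case using t by simp
      qed
    }
  qed
  have zpos: "pd i g (y(i := h y)) > 0" if y: "y \<in> N" for y
  proof -
    have "y(i := h y) \<in> W" by (rule in_W) (use y h[OF y] in \<open>auto simp: N_def\<close>)
    then show ?thesis by (simp add: W_def)
  qed
  have h_der: "((\<lambda>t. h (y(j := t))) has_real_derivative
      (if j = i then 1 else - pd j g (y(i := h y))) / pd i g (y(i := h y))) (at (y j))" if y: "y \<in> N" for y j
  proof -
    define z where "z = y(i := h y)"
    define c where "c t = y(j := t)" for t
    define D where "D = (if j = i then 1 else - pd j g z)"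
    \<comment> \<open>By the equation that defines h, \<open>E t\<close> is the increment of g when
      coordinate i moves from \<open>h y\<close> to \<open>h (c t)\<close>, so it is the slope
      \<open>s t\<close> times the increment of h. The derivative of h is thus that of E divided by
      the limit of s.\<close>
    define E where "E t = c t i - g ((c t)(i := h y))" for t
    have c0: "c (y j) = y" by (simp add: c_def)
    have c_lim: "(c \<longlongrightarrow> y) (at (y j))"
      using tendsto_upd[OF tendsto_const tendsto_ident_at, of y j "y j" UNIV] by (simp add: c_def[abs_def])
    have u_lim: "((\<lambda>t. h (c t)) \<longlongrightarrow> h y) (at (y j))"
      by (rule isCont_tendsto_compose[OF h_cont[OF y] c_lim])
    have b_lim: "((\<lambda>t. (c t)(i := h y)) \<longlongrightarrow> z) (at (y j))"
      unfolding z_def by (rule tendsto_upd[OF c_lim tendsto_const])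
    have u_lim': "((\<lambda>t. h (c t)) \<longlongrightarrow> z i) (at (y j))" using u_lim by (simp add: z_def)
    obtain s where s: "(s \<longlongrightarrow> pd i g z) (at (y j))"
      "\<forall>\<^sub>F t in at (y j). g (((c t)(i := h y))(i := h (c t))) - g ((c t)(i := h y)) = s t * (h (c t) - ((c t)(i := h y)) i)"
      using partial_increment[OF open_UNIV UNIV_I smooth_Ck[OF g] b_lim u_lim'] by blast
    have z0: "pd i g z \<noteq> 0" using zpos[OF y] by (simp add: z_def)
    have E0: "E (y j) = 0" using h[OF y] by (simp add: E_def c0)
    have "(E has_real_derivative D) (at (y j))"
    proof (cases "j = i")
      case True
      have "E = (\<lambda>t. t - g z)" by (auto simp: E_def c_def True z_def)
      then show ?thesis using True by (auto simp: D_def intro!: derivative_eq_intros)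
    next
      case False
      have "E = (\<lambda>t. y i - g (z(j := t)))"
        using False by (auto simp: E_def c_def z_def fun_upd_twist)
      moreover have "((\<lambda>t. y i - g (z(j := t))) has_real_derivative 0 - pd j g z) (at (z j))"
        by (rule DERIV_diff[OF DERIV_const smooth_deriv[OF g]])
      ultimately show ?thesis using False by (simp add: D_def z_def)
    qed
    then have "((\<lambda>t. (E t - E (y j)) / (t - y j) / s t) \<longlongrightarrow> D / pd i g z) (at (y j))"
      by (intro tendsto_divide s(1) z0) (simp add: has_field_derivative_iff)
    moreover have "\<forall>\<^sub>F t in at (y j). (E t - E (y j)) / (t - y j) / s t = (h (c t) - h (c (y j))) / (t - y j)"
      using s(2) topological_tendstoD[OF c_lim oN y] tendsto_imp_eventually_ne[OF s(1) z0]
    proof eventually_elim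
      case (elim t)
      then have "E t = s t * (h (c t) - h y)" using h[of "c t"] by (simp add: E_def)
      then show ?case using elim(3) by (simp add: E0 c0)
    qed
    ultimately have "((\<lambda>t. h (c t)) has_real_derivative D / pd i g z) (at (y j))"
      unfolding has_field_derivative_iff by (rule Lim_transform_eventually)
    then show ?thesis unfolding c_def D_def z_def .
  qed
  have h_conton: "continuous_on N h" using h_cont continuous_at_imp_continuous_on by blast
  \<comment> \<open>Bootstrapping: the derivatives of h are smooth expressions in the point and
    \<open>h y\<close>, so each order of differentiability yields the next.\<close>
  have h_Ck: "Ck k N h" for k
  proof (induction k)
    case 0
    show ?case using h_conton by simp
  next
    case (Suc k)
    have pdg: "Ck k N (\<lambda>y. pd j g (y(i := h y)))" for j
      by (rule Ck_compose_upd[OF oN smooth_Ck[OF smooth_pd[OF g]] Suc.IH])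
    show ?case
    proof (rule Ck_SucI[OF oN h_conton])
      fix j
      let ?G = "\<lambda>y. (if j = i then 1 else - 1 * pd j g (y(i := h y))) * inverse (pd i g (y(i := h y)))"
      have "Ck k N (\<lambda>y. if j = i then 1 else - 1 * pd j g (y(i := h y)))"
      proof (cases "j = i")
        case True then show ?thesis by (simp add: Ck_const)
      next
        case False
        then show ?thesis unfolding if_not_P[OF False] by (intro Ck_mult[OF oN Ck_const pdg])
      qed
      moreover have "Ck k N (\<lambda>y. inverse (pd i g (y(i := h y))))"
        by (rule Ck_inverse[OF oN pdg]) (use zpos in force)
      ultimately have "Ck k N ?G" by (rule Ck_mult[OF oN])
      moreover have "((\<lambda>t. h (y(j := t))) has_real_derivative ?G y) (at (y j))" if "y \<in> N" for y
        using h_der[OF that, of j] by (simp only: divide_inverse mult_minus1)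
      ultimately show "\<exists>G. Ck k N G \<and> (\<forall>y\<in>N. ((\<lambda>t. h (y(j := t))) has_real_derivative G y) (at (y j)))"
        by (intro exI[of _ ?G] conjI ballI)
    qed
  qed
  obtain h' V where h': "smooth h'" "open V" "p(i := g p) \<in> V" "V \<subseteq> N" "\<And>y. y \<in> V \<Longrightarrow> h' y = h y"
    using smooth_globalize[OF oN qN h_Ck] by blast
  \<comment> \<open>At \<open>x(i := g x)\<close> the number \<open>x i\<close> solves the equation
    that defines h; the bounds a and b make it the solution that h selects.\<close>
  define V' where "V' = {x. x(i := g x) \<in> V} \<inter> {x. a < x i \<and> x i < b}"
  have "open {x. x(i := g x) \<in> V}" by (rule open_Collect_upd[OF h'(2) smooth_cont[OF g]])
  moreover have "open {x::nat \<Rightarrow> real. a < x i \<and> x i < b}"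
    by (intro open_Collect_conj open_Collect_less continuous_on_const continuous_on_coord)
  ultimately have "open V'" unfolding V'_def by blast
  moreover have "p \<in> V'" using h'(3) ab by (simp add: V'_def)
  moreover have "h' (x(i := g x)) = x i" if "x \<in> V'" for x
  proof -
    have "x(i := g x) \<in> V" "a < x i" "x i < b" using that by (auto simp: V'_def)
    then show ?thesis using h'(5) h_unique[of "x(i := g x)" "x i"] h'(4) by auto
  qed
  ultimately show ?thesis using h'(1) that by blast
qed

text \<open>If the derivative is negative, the positive case is applied to -g, and the inverse flips
  the sign of coordinate i before it is used.\<close>

lemma exchange_coordinate:
  assumes g: "smooth g" and p: "pd i g p \<noteq> 0"
  obtains h V where "smooth h" "open V" "p \<in> V" "\<And>x. x \<in> V \<Longrightarrow> h (x(i := g x)) = x i"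
proof (cases "pd i g p > 0")
  case True
  then show ?thesis using exchange_coordinate_pos[OF g] that by blast
next
  case False
  have g': "smooth (\<lambda>x. 0 - g x)" by (intro smooth_diff smooth_const g)
  have "pd i (\<lambda>x. 0 - g x) p = 0 - pd i g p"
    by (rule pd_eqI[OF DERIV_diff[OF DERIV_const smooth_deriv[OF g]]])
  then have "pd i (\<lambda>x. 0 - g x) p > 0" using False p by simp
  from exchange_coordinate_pos[OF g' this]
  obtain h V where h: "smooth h" "open V" "p \<in> V" "\<And>x. x \<in> V \<Longrightarrow> h (x(i := 0 - g x)) = x i" by blast
  have "smooth (\<lambda>y. h (y(i := 0 - y i)))"
    by (rule smooth_compose_upd[OF h(1) smooth_diff[OF smooth_const smooth_coord]])
  with h(2-4) that[of "\<lambda>y. h (y(i := 0 - y i))" V] show ?thesis by simp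
qed

text \<open>
  The coordinates \<open>x 0, \<dots>, x (n - 1)\<close> are exchanged one at a time for components of \<open>F\<close>; injectivity
  of the derivative provides a component for each exchange.
\<close>

definition exchanged ::
    "(nat \<Rightarrow> (nat \<Rightarrow> real) \<Rightarrow> real) \<Rightarrow> nat \<Rightarrow> nat \<Rightarrow> (nat \<Rightarrow> real) \<Rightarrow> nat \<Rightarrow>
      (nat \<Rightarrow> nat) \<Rightarrow> (nat \<Rightarrow> (nat \<Rightarrow> real) \<Rightarrow> real) \<Rightarrow> (nat \<Rightarrow> real) set \<Rightarrow> (nat \<Rightarrow> real) set \<Rightarrow> bool" where
  "exchanged F m n p d c h U V \<longleftrightarrow>
    open U \<and> p \<in> U \<and> (\<forall>l. smooth (h l)) \<and> (\<forall>l\<ge>n. h l = (\<lambda>y. y l)) \<and> (\<forall>i<d. c i < m) \<and>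
    (\<forall>x\<in>U. \<forall>l. h l (\<lambda>i. if i < d then F (c i) x else x i) = x l) \<and>
    open V \<and> (\<lambda>i. if i < d then F (c i) p else p i) \<in> V \<and> (\<forall>y\<in>V. \<forall>l\<ge>d. h l y = y l)"

text \<open>The last clause of \<open>exchanged\<close> is the invariant that keeps the induction
  going: near the image q of p, \<open>h\<close> does not change the coordinates from d on. So the
  vector with entries \<open>pd d (h l) q\<close> has entry 1 at d and is nonzero, and injectivity
  gives an r such that \<open>F r\<close>, written in the current coordinates, has nonzero
  derivative in direction d.\<close>

lemma immersion_exchange:
  fixes F :: "nat \<Rightarrow> (nat \<Rightarrow> real) \<Rightarrow> real"
  assumes F: "\<And>r. smooth (F r)"
    and inj: "\<And>v. (\<And>r. r < m \<Longrightarrow> (\<Sum>l<n. pd l (F r) p * v l) = 0) \<Longrightarrow> (\<forall>l<n. v l = 0)"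
    and d: "d \<le> n"
  shows "\<exists>c h U V. exchanged F m n p d c h U V"
  using d
proof (induction d)
  case 0
  show ?case
    by (intro exI[of _ "\<lambda>_. 0"] exI[of _ "\<lambda>l (y::nat \<Rightarrow> real). y l"] exI[of _ UNIV])
      (simp add: exchanged_def smooth_coord)
next
  case (Suc d)
  then have "d \<le> n" by simp
  from Suc.IH[OF this] obtain c h U V where "exchanged F m n p d c h U V" by blast
  then have IH: "open U" "p \<in> U" "\<And>l. smooth (h l)" "\<And>l. l \<ge> n \<Longrightarrow> h l = (\<lambda>y. y l)"
    "\<And>i. i < d \<Longrightarrow> c i < m" "\<And>x l. x \<in> U \<Longrightarrow> h l (\<lambda>i. if i < d then F (c i) x else x i) = x l"
    "open V" "(\<lambda>i. if i < d then F (c i) p else p i) \<in> V" "\<And>y l. y \<in> V \<Longrightarrow> l \<ge> d \<Longrightarrow> h l y = y l"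
    unfolding exchanged_def by blast+
  define T where "T x = (\<lambda>i. if i < d then F (c i) x else x i)" for x
  define q where "q = T p"
  have T_cont: "continuous_on UNIV T"
  proof (rule continuous_on_coordinatewise_then_product)
    show "continuous_on UNIV (\<lambda>x. T x i)" for i
      by (cases "i < d") (simp_all add: T_def smooth_cont[OF F] continuous_on_coord)
  qed
  have hT: "(\<lambda>l. h l (T x)) = x" if "x \<in> U" for x using IH(6)[OF that] by (simp add: T_def)
  have fin: "\<exists>R. \<forall>i\<ge>R. \<forall>x t. h i (x(j := t)) = h i x" for j
  proof (intro exI[of _ "Suc (max n j)"] allI impI)
    fix i x t assume "Suc (max n j) \<le> i"
    then have "n \<le> i" "i \<noteq> j" by auto
    then show "h i (x(j := t)) = h i x" using IH(4)[of i] by simp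
  qed
  define g where "g r y = F r (\<lambda>l. h l y)" for r y
  have g: "smooth (g r)" for r
    unfolding g_def[abs_def] by (rule smooth_compose[OF F IH(3) fin])
  have dn: "d < n" using Suc.prems by simp
  have g_pd: "pd d (g r) q = (\<Sum>l<n. pd l (F r) p * pd d (h l) q)" for r
  proof -
    have "((\<lambda>t. F r (\<lambda>l. h l (q(d := t)))) has_real_derivative
        (\<Sum>l<n. pd l (F r) (\<lambda>l. h l q) * pd d (h l) q)) (at (q d))"
      by (rule pd_compose[OF open_UNIV open_UNIV smooth_Ck[OF F] smooth_Ck[OF IH(3)]])
        (use dn in \<open>auto simp: IH(4)\<close>)
    then show ?thesis using hT[OF IH(2)] by (intro pd_eqI) (simp add: g_def q_def del: fun_upd_apply)
  qed
  have "pd d (h d) q = 1"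
  proof -
    have "pd d (h d) q = pd d (\<lambda>y. y d) q"
      by (rule pd_cong[OF IH(7)]) (use IH(8,9) in \<open>auto simp: q_def T_def\<close>)
    also have "\<dots> = 1" using DERIV_coord_upd[of q d d] by (intro pd_eqI) simp
    finally show ?thesis .
  qed
  then have "\<exists>r<m. (\<Sum>l<n. pd l (F r) p * pd d (h l) q) \<noteq> 0"
    using inj[of "\<lambda>l. pd d (h l) q"] dn by fastforce
  then obtain r where r: "r < m" "pd d (g r) q \<noteq> 0" by (auto simp: g_pd)
  from exchange_coordinate[OF g r(2)]
  obtain h' W where h': "smooth h'" "open W" "q \<in> W" "\<And>y. y \<in> W \<Longrightarrow> h' (y(d := g r y)) = y d" by blast
  define c' where "c' = c(d := r)"
  have T': "(\<lambda>i. if i < Suc d then F (c' i) x else x i) = (T x)(d := F r x)" for x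
    by (auto simp: c'_def T_def less_Suc_eq fun_eq_iff)
  define U' where "U' = U \<inter> T -` W"
  have step: "((T x)(d := F r x))(d := h' ((T x)(d := F r x))) = T x" if "x \<in> U'" for x
  proof -
    have x: "x \<in> U" "T x \<in> W" using that by (auto simp: U'_def)
    have "g r (T x) = F r x" using hT[OF x(1)] by (simp add: g_def)
    then show ?thesis using h'(4)[OF x(2)] by simp
  qed
  define V' where "V' = (\<lambda>y. y(d := h' y)) -` V"
  have "open U'" unfolding U'_def using IH(1) open_vimage[OF h'(2) T_cont] by blast
  moreover have pU': "p \<in> U'" using IH(2) h'(3) by (simp add: U'_def q_def)
  moreover have "smooth (\<lambda>y. h l (y(d := h' y)))" for l by (rule smooth_compose_upd[OF IH(3) h'(1)])
  moreover have "(\<lambda>y. h l (y(d := h' y))) = (\<lambda>y. y l)" if "l \<ge> n" for l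
    using that dn IH(4)[OF that] by auto
  moreover have "c' i < m" if "i < Suc d" for i using that IH(5) r(1) by (auto simp: c'_def less_Suc_eq)
  moreover have "h l (((T x)(d := F r x))(d := h' ((T x)(d := F r x)))) = x l" if "x \<in> U'" for x l
    using step[OF that] IH(6)[of x l] that by (simp add: U'_def T_def)
  moreover have "open V'" unfolding V'_def
    unfolding vimage_def by (rule open_Collect_upd[OF IH(7) smooth_cont[OF h'(1)]])
  moreover have "(T p)(d := F r p) \<in> V'" using step[OF pU'] IH(8) by (simp add: V'_def T_def del: fun_upd_upd)
  moreover have "h l (y(d := h' y)) = y l" if "y \<in> V'" "l \<ge> Suc d" for y l
    using that IH(9)[of "y(d := h' y)" l] by (simp add: V'_def)
  ultimately have "exchanged F m n p (Suc d) c' (\<lambda>l y. h l (y(d := h' y))) U' V'"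
    unfolding exchanged_def T' by blast
  then show ?case by blast
qed

text \<open>After n exchanges the inverse needs only the n selected components of F, so it is smooth
  on the whole target space and not just on the image. A point of R^n has zero coordinates from n
  on, which matches the padding in \<open>H\<close>.\<close>

lemma immersion_left_inverse:
  fixes F :: "nat \<Rightarrow> (nat \<Rightarrow> real) \<Rightarrow> real"
  assumes F: "\<And>r. smooth (F r)"
    and inj: "\<And>v. (\<And>r. r < m \<Longrightarrow> (\<Sum>l<n. pd l (F r) p * v l) = 0) \<Longrightarrow> (\<forall>l<n. v l = 0)"
  obtains H U where "\<And>l. smooth (H l)" "open U" "p \<in> U"
    "\<And>x l. x \<in> U \<Longrightarrow> x \<in> topspace (Euclidean_space n) \<Longrightarrow> H l (\<lambda>r. if r < m then F r x else 0) = x l"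
proof -
  have "\<exists>c h U V. exchanged F m n p n c h U V" by (rule immersion_exchange[OF F _ order_refl], rule inj)
  then obtain c h U V where "exchanged F m n p n c h U V" by blast
  then have h: "open U" "p \<in> U" "\<And>l. smooth (h l)" "\<And>i. i < n \<Longrightarrow> c i < m"
      "\<And>x l. x \<in> U \<Longrightarrow> h l (\<lambda>i. if i < n then F (c i) x else x i) = x l" unfolding exchanged_def by blast+
  define H where "H l z = h l (\<lambda>i. if i < n then z (c i) else 0)" for l z
  have "smooth (H l)" for l unfolding H_def[abs_def] by (intro smooth_compose_finite h(3) smooth_coord)
  moreover have "H l (\<lambda>r. if r < m then F r x else 0) = x l" if "x \<in> U" "x \<in> topspace (Euclidean_space n)" for x l
  proof -
    have "(\<lambda>i. if i < n then if c i < m then F (c i) x else 0 else 0) = (\<lambda>i. if i < n then F (c i) x else x i)"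
      using h(4) that(2) by (auto simp: topspace_Euclidean_space)
    then show ?thesis using h(5)[OF that(1)] by (simp add: H_def)
  qed
  ultimately show ?thesis using h(1,2) that by blast
qed

section \<open>Null images and generic coefficients\<close>

lemma cell_diff:
  fixes u v w :: real
  assumes "0 < w" "0 < K" "0 \<le> u" "0 \<le> v" "nat \<lfloor>u * K / w\<rfloor> = nat \<lfloor>v * K / w\<rfloor>"
  shows "\<bar>u - v\<bar> \<le> w / K"
proof -
  have "0 \<le> \<lfloor>u * K / w\<rfloor>" "0 \<le> \<lfloor>v * K / w\<rfloor>" using assms by (simp_all add: zero_le_floor)
  then have "\<lfloor>u * K / w\<rfloor> = \<lfloor>v * K / w\<rfloor>" using assms(5) by (simp only: eq_nat_nat_iff)
  then have "\<bar>u * K / w - v * K / w\<bar> \<le> 1" by linarith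
  moreover have "u * K / w - v * K / w = (u - v) * (K / w)" by (simp add: diff_divide_distrib left_diff_distrib)
  ultimately have "\<bar>u - v\<bar> * (K / w) \<le> 1" using assms(1,2) by (simp add: abs_mult)
  then show ?thesis using assms(1,2) by (simp add: field_simps)
qed

text \<open>
  Cutting the box into \<open>(k + 2) ^ d\<close> cells covers the image by as many cubes of side \<open>O(1 / k)\<close>, of
  total volume \<open>O(k ^ d / k ^ m)\<close>.
\<close>

lemma Lipschitz_image_null:
  fixes Q :: "(nat \<Rightarrow> real) \<Rightarrow> nat \<Rightarrow> real"
  assumes dm: "d < m" and L: "L \<ge> 0" and w: "w > 0"
    and B: "\<And>z j. z \<in> B \<Longrightarrow> j < d \<Longrightarrow> c j \<le> z j \<and> z j \<le> c j + w"
    and Lip: "\<And>z z' r. z \<in> B \<Longrightarrow> z' \<in> B \<Longrightarrow> r < m \<Longrightarrow> \<bar>Q z r - Q z' r\<bar> \<le> L * (\<Sum>j<d. \<bar>z j - z' j\<bar>)"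
  shows "\<exists>N\<in>null_sets (PiM {..<m} (\<lambda>_. lborel)). \<forall>z\<in>B. restrict (Q z) {..<m} \<in> N"
proof -
  interpret product_sigma_finite "\<lambda>_::nat. lborel :: real measure" ..
  let ?P = "PiM {..<m} (\<lambda>_. lborel :: real measure)"
  \<comment> \<open>Points of one cell differ by at most \<open>w / real (Suc k)\<close> in each of
    d coordinates, so their images differ by at most \<open>M / real (Suc k)\<close> in each
    component.\<close>
  define M where "M = L * (real d * w)"
  have M0: "M \<ge> 0" using L w by (simp add: M_def)
  \<comment> \<open>A point on the upper face \<open>z j = c j + w\<close> gets the index
    \<open>Suc k\<close>, hence the k + 2 values allowed in \<open>I\<close>.\<close>
  define cell where "cell k z = (\<lambda>j\<in>{..<d}. nat \<lfloor>(z j - c j) * real (Suc k) / w\<rfloor>)" for k and z :: "nat \<Rightarrow> real"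
  define I where "I k = (\<Pi>\<^sub>E j\<in>{..<d}. {..Suc k})" for k
  \<comment> \<open>An empty cell gets an arbitrary representative; its box merely enlarges the
    cover.\<close>
  define rep where "rep k \<kappa> = (SOME z. z \<in> B \<and> cell k z = \<kappa>)" for k \<kappa>
  define box where "box k \<kappa> = (\<Pi>\<^sub>E r\<in>{..<m}. {Q (rep k \<kappa>) r - M / real (Suc k) .. Q (rep k \<kappa>) r + M / real (Suc k)})" for k \<kappa>
  define N where "N = (\<Inter>k. \<Union>\<kappa>\<in>I k. box k \<kappa>)"
  have fin_I: "finite (I k)" for k unfolding I_def by (intro finite_PiE) auto
  have card_I: "card (I k) = (k + 2) ^ d" for k
    unfolding I_def by (simp add: card_PiE)
  have box_sets: "box k \<kappa> \<in> sets ?P" for k \<kappa>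
    unfolding box_def by (intro sets_PiM_I_finite) auto
  have U_sets: "(\<Union>\<kappa>\<in>I k. box k \<kappa>) \<in> sets ?P" for k
    using fin_I box_sets by (intro sets.finite_UN) auto
  have N_sets: "N \<in> sets ?P"
    unfolding N_def using U_sets by (intro sets.countable_INT) auto
  have box_em: "emeasure ?P (box k \<kappa>) = ennreal ((2 * M / real (Suc k)) ^ m)" for k \<kappa>
  proof -
    have "emeasure ?P (box k \<kappa>) = (\<Prod>r<m. emeasure lborel {Q (rep k \<kappa>) r - M / real (Suc k) .. Q (rep k \<kappa>) r + M / real (Suc k)})"
      unfolding box_def by (intro emeasure_PiM) auto
    also have "\<dots> = (\<Prod>r<m. ennreal (2 * M / real (Suc k)))"
      using M0 by (intro prod.cong refl) (simp add: emeasure_lborel_Icc)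
    also have "\<dots> = ennreal ((2 * M / real (Suc k)) ^ m)"
      using M0 by (simp add: ennreal_power)
    finally show ?thesis .
  qed
  \<comment> \<open>The factor \<open>2 ^ d\<close> comes from k + 2 \<le> 2 (k + 1) in the number
    of cells, and \<open>(2 * M) ^ m\<close> from the volume of a box.\<close>
  define C where "C = 2 ^ d * (2 * M) ^ m"
  have C0: "C \<ge> 0" using M0 by (simp add: C_def)
  have "emeasure ?P N \<le> ennreal (C / real (Suc k))" for k
  proof -
    have "emeasure ?P N \<le> emeasure ?P (\<Union>\<kappa>\<in>I k. box k \<kappa>)"
      by (rule emeasure_mono[OF _ U_sets]) (auto simp: N_def)
    also have "\<dots> \<le> (\<Sum>\<kappa>\<in>I k. emeasure ?P (box k \<kappa>))"
      using fin_I box_sets by (intro emeasure_subadditive_finite) auto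
    also have "\<dots> = ennreal (real ((k + 2) ^ d) * (2 * M / real (Suc k)) ^ m)"
      using M0 by (simp add: box_em card_I ennreal_mult' ennreal_of_nat_eq_real_of_nat)
    also have "\<dots> \<le> ennreal (C / real (Suc k))"
    proof (rule ennreal_leI)
      have "real ((k + 2) ^ d) \<le> (2 * real (Suc k)) ^ d"
        unfolding of_nat_power by (intro power_mono) auto
      also have "\<dots> = 2 ^ d * real (Suc k) ^ d" by (rule power_mult_distrib)
      finally have "real ((k + 2) ^ d) * (2 * M / real (Suc k)) ^ m \<le> (2 ^ d * real (Suc k) ^ d) * (2 * M / real (Suc k)) ^ m"
        using M0 by (intro mult_right_mono) auto
      also have "\<dots> = C * (real (Suc k) ^ d / real (Suc k) ^ m)"
        by (simp add: C_def power_divide)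
      \<comment> \<open>Here d < m leaves at least one factor \<open>Suc k\<close> in the
        denominator.\<close>
      also have "\<dots> \<le> C * (1 / real (Suc k))"
      proof (rule mult_left_mono[OF _ C0])
        have "real (Suc k) ^ d * real (Suc k) = real (Suc k) ^ Suc d" by simp
        also have "\<dots> \<le> real (Suc k) ^ m" using dm by (intro power_increasing) auto
        finally show "real (Suc k) ^ d / real (Suc k) ^ m \<le> 1 / real (Suc k)"
          by (simp add: divide_simps del: of_nat_Suc)
      qed
      finally show "real ((k + 2) ^ d) * (2 * M / real (Suc k)) ^ m \<le> C / real (Suc k)" by simp
    qed
    finally show ?thesis .
  qed
  moreover have "(\<lambda>k. ennreal (C / real (Suc k))) \<longlonglongrightarrow> ennreal 0"
    by (intro tendsto_ennrealI LIMSEQ_Suc lim_const_over_n)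
  ultimately have "emeasure ?P N \<le> ennreal 0"
    by (intro LIMSEQ_le_const) auto
  then have "N \<in> null_sets ?P" using N_sets by (auto simp: null_sets_def)
  moreover have "restrict (Q z) {..<m} \<in> N" if z: "z \<in> B" for z
    unfolding N_def
  proof (rule INT_I)
    fix k
    let ?\<kappa> = "cell k z"
    have "?\<kappa> \<in> I k"
      unfolding I_def cell_def
    proof (rule restrict_PiE_iff[THEN iffD2], intro ballI)
      fix j assume "j \<in> {..<d}"
      then have "(z j - c j) / w \<le> 1" "0 \<le> z j - c j" using B[OF z, of j] w by (simp_all add: field_simps)
      then have "(z j - c j) * real (Suc k) / w \<le> real (Suc k)" 
        using mult_right_mono[of "(z j - c j) / w" 1 "real (Suc k)"] by simp
      then show "nat \<lfloor>(z j - c j) * real (Suc k) / w\<rfloor> \<in> {..Suc k}" by (simp add: nat_le_iff floor_le_iff)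
    qed
    have rep: "rep k ?\<kappa> \<in> B \<and> cell k (rep k ?\<kappa>) = ?\<kappa>"
      unfolding rep_def by (rule someI[of "\<lambda>y. y \<in> B \<and> cell k y = ?\<kappa>" z]) (simp add: z)
    have "\<bar>Q z r - Q (rep k ?\<kappa>) r\<bar> \<le> M / real (Suc k)" if r: "r < m" for r
    proof -
      have "\<bar>z j - rep k ?\<kappa> j\<bar> \<le> w / real (Suc k)" if j: "j < d" for j
      proof -
        have "cell k z j = cell k (rep k ?\<kappa>) j" using rep by simp
        then show ?thesis
          using cell_diff[of w "real (Suc k)" "z j - c j" "rep k ?\<kappa> j - c j"] w B[OF z j] B[OF rep[THEN conjunct1] j] j
          by (simp add: cell_def)
      qed
      then have "(\<Sum>j<d. \<bar>z j - rep k ?\<kappa> j\<bar>) \<le> real d * (w / real (Suc k))"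
        using sum_bounded_above[of "{..<d}" "\<lambda>j. \<bar>z j - rep k ?\<kappa> j\<bar>" "w / real (Suc k)"] by simp
      then have "L * (\<Sum>j<d. \<bar>z j - rep k ?\<kappa> j\<bar>) \<le> M / real (Suc k)"
        using mult_left_mono[OF _ L] unfolding M_def by (metis times_divide_eq_right)
      then show ?thesis using Lip[OF z rep[THEN conjunct1] r] by linarith
    qed
    then have "restrict (Q z) {..<m} \<in> box k ?\<kappa>" unfolding box_def by (auto simp: abs_le_iff field_simps)
    with \<open>?\<kappa> \<in> I k\<close> show "restrict (Q z) {..<m} \<in> (\<Union>\<kappa>\<in>I k. box k \<kappa>)" by blast
  qed
  ultimately show ?thesis by blast
qed

section \<open>From Lipschitz images to C^1 images\<close>

lemma open_contains_cube:
  assumes "open V" "z0 \<in> V" "z0 \<in> topspace (Euclidean_space d)"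
  shows "\<exists>\<delta>>0. \<forall>z\<in>topspace (Euclidean_space d). (\<forall>j<d. \<bar>z j - z0 j\<bar> < \<delta>) \<longrightarrow> z \<in> V"
proof -
  have "openin (product_topology (\<lambda>_. euclideanreal) UNIV) V"
    using assms(1) by (simp add: open_fun_def)
  then obtain U where "finite {i. U i \<noteq> UNIV}" and U: "\<And>i. open (U i)" "z0 \<in> Pi\<^sub>E UNIV U" "Pi\<^sub>E UNIV U \<subseteq> V"
    using assms(2) unfolding openin_product_topology_alt by auto
  have "\<exists>r>0. ball (z0 i) r \<subseteq> U i" for i
    using U(1,2) by (auto simp: PiE_iff open_contains_ball)
  then obtain r where r: "\<And>i. r i > 0" "\<And>i. ball (z0 i) (r i) \<subseteq> U i" by metis
  \<comment> \<open>The 1 keeps the minimum defined for d = 0. Coordinates from d on need no radius,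
    since both points are zero there.\<close>
  define \<delta> where "\<delta> = Min (insert 1 (r ` {..<d}))"
  have "\<delta> > 0" using r(1) by (simp add: \<delta>_def)
  moreover have "z \<in> V" if z: "z \<in> topspace (Euclidean_space d)" "\<And>j. j < d \<Longrightarrow> \<bar>z j - z0 j\<bar> < \<delta>" for z
  proof -
    have "z i \<in> U i" for i
    proof (cases "i < d")
      case True
      then have "\<delta> \<le> r i" by (simp add: \<delta>_def)
      then have "z i \<in> ball (z0 i) (r i)" using z(2)[OF True] by (simp add: dist_real_def abs_minus_commute)
      then show ?thesis using r(2) by blast
    next
      case False
      then have "z i = z0 i" using z(1) assms(3) by (simp add: topspace_Euclidean_space)
      then show ?thesis using U(2) by (auto simp: PiE_iff)
    qed
    then have "z \<in> Pi\<^sub>E UNIV U" by (simp add: PiE_iff)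
    then show ?thesis using U(3) by blast
  qed
  ultimately show ?thesis by blast
qed

lemma partial_bound:
  assumes der: "\<And>t. min a b \<le> t \<Longrightarrow> t \<le> max a b \<Longrightarrow> (f has_real_derivative f' t) (at t)"
    and K: "\<And>t. min a b \<le> t \<Longrightarrow> t \<le> max a b \<Longrightarrow> \<bar>f' t\<bar> \<le> K"
  shows "\<bar>f b - f a\<bar> \<le> K * \<bar>b - a\<bar>"
proof (cases a b rule: linorder_cases)
  case less
  then obtain t where t: "a < t" "t < b" "f b - f a = (b - a) * f' t"
    using MVT2[OF less, of f f'] der by auto
  then show ?thesis using K[of t] less by (simp add: abs_mult mult.commute mult_right_mono)
next
  case greater
  then obtain t where t: "b < t" "t < a" "f a - f b = (a - b) * f' t"
    using MVT2[OF greater, of f f'] der by auto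
  then have "\<bar>f b - f a\<bar> = (a - b) * \<bar>f' t\<bar>" using greater by (simp add: abs_minus_commute[of "f b"] abs_mult)
  then show ?thesis using K[of t] greater t by (simp add: mult.commute mult_right_mono)
qed simp

lemma Ck_deriv_upd:
  assumes "Ck (Suc k) U F" "y(i := t) \<in> U"
  shows "((\<lambda>s. F (y(i := s))) has_real_derivative pd i F (y(i := t))) (at t)"
  using Ck_deriv[OF assms, of i] by (simp only: fun_upd_upd fun_upd_same)

text \<open>The coordinates of z' are replaced by those of z one at a time. Every intermediate point
  stays in the cube, where all partial derivatives are bounded by K, so the mean value theorem
  bounds each replacement.\<close>

lemma C1_locally_Lipschitz:
  fixes Q :: "nat \<Rightarrow> (nat \<Rightarrow> real) \<Rightarrow> real"
  assumes U: "open U" and Q: "\<And>r. r < m \<Longrightarrow> Ck 1 U (Q r)"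
    and z0: "z0 \<in> U" "z0 \<in> topspace (Euclidean_space d)"
  shows "\<exists>\<delta>>0. \<exists>K\<ge>0. \<forall>z\<in>topspace (Euclidean_space d). \<forall>z'\<in>topspace (Euclidean_space d).
    (\<forall>j<d. \<bar>z j - z0 j\<bar> < \<delta>) \<longrightarrow> (\<forall>j<d. \<bar>z' j - z0 j\<bar> < \<delta>) \<longrightarrow>
    (\<forall>r<m. \<bar>Q r z - Q r z'\<bar> \<le> K * (\<Sum>j<d. \<bar>z j - z' j\<bar>))"
proof -
  \<comment> \<open>The summand 1 makes the bound strict at z0, so that it persists on a
    neighbourhood.\<close>
  define K where "K = 1 + (\<Sum>r<m. \<Sum>j<d. \<bar>pd j (Q r) z0\<bar>)"
  define V where "V = (\<Inter>r\<in>{..<m}. \<Inter>j\<in>{..<d}. U \<inter> pd j (Q r) -` {- K <..< K}) \<inter> U"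
  have K0: "K \<ge> 0" unfolding K_def by (intro add_nonneg_nonneg sum_nonneg) simp_all
  have Kb: "\<bar>pd j (Q r) z0\<bar> < K" if r: "r < m" and j: "j < d" for r j
  proof -
    have "\<bar>pd j (Q r) z0\<bar> \<le> (\<Sum>j<d. \<bar>pd j (Q r) z0\<bar>)"
      using j by (intro member_le_sum) simp_all
    also have "\<dots> \<le> (\<Sum>r<m. \<Sum>j<d. \<bar>pd j (Q r) z0\<bar>)"
      using r by (intro member_le_sum[where f = "\<lambda>r. \<Sum>j<d. \<bar>pd j (Q r) z0\<bar>"] sum_nonneg) simp_all
    finally show ?thesis by (simp add: K_def)
  qed
  have cont: "continuous_on U (pd j (Q r))" if "r < m" for r j
    by (rule Ck_cont[OF Ck_pd[OF Q[OF that, unfolded One_nat_def]]])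
  have "open V"
    unfolding V_def by (intro open_Int open_INT ballI continuous_open_preimage cont U) simp_all
  moreover have "z0 \<in> V"
  proof -
    have "- K < pd j (Q r) z0 \<and> pd j (Q r) z0 < K" if "r < m" "j < d" for r j using Kb[OF that] by linarith
    then show ?thesis using z0(1) by (simp add: V_def)
  qed
  ultimately obtain \<delta> where \<delta>: "\<delta> > 0"
    "\<forall>z\<in>topspace (Euclidean_space d). (\<forall>j<d. \<bar>z j - z0 j\<bar> < \<delta>) \<longrightarrow> z \<in> V"
    using open_contains_cube[of V z0 d] z0(2) by blast
  have "\<bar>Q r z - Q r z'\<bar> \<le> K * (\<Sum>j<d. \<bar>z j - z' j\<bar>)"
    if z: "z \<in> topspace (Euclidean_space d)" "z' \<in> topspace (Euclidean_space d)"
      "\<And>j. j < d \<Longrightarrow> \<bar>z j - z0 j\<bar> < \<delta>" "\<And>j. j < d \<Longrightarrow> \<bar>z' j - z0 j\<bar> < \<delta>" and r: "r < m" for z z' r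
  proof -
    define y where "y l = (\<lambda>j. if j < l then z j else z' j)" for l
    have "\<bar>Q r (y l) - Q r z'\<bar> \<le> K * (\<Sum>j<l. \<bar>z j - z' j\<bar>)" if "l \<le> d" for l
      using that
    proof (induction l)
      case 0
      then show ?case by (simp add: y_def)
    next
      case (Suc l)
      have upd: "y (Suc l) = (y l)(l := z l)" "y l = (y l)(l := z' l)"
        by (auto simp: y_def less_Suc_eq fun_eq_iff)
      have in_V: "(y l)(l := t) \<in> V" if "min (z' l) (z l) \<le> t" "t \<le> max (z' l) (z l)" for t
      proof (rule \<delta>(2)[rule_format])
        show "(y l)(l := t) \<in> topspace (Euclidean_space d)"
          using z(1,2) Suc.prems by (simp add: topspace_Euclidean_space y_def)
        show "\<bar>((y l)(l := t)) j - z0 j\<bar> < \<delta>" if "j < d" for j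
          using z(3)[OF that] z(4)[OF that] \<open>min (z' l) (z l) \<le> t\<close> \<open>t \<le> max (z' l) (z l)\<close>
          by (auto simp: y_def min_def max_def split: if_splits)
      qed
      have tU: "(y l)(l := t) \<in> U" if "min (z' l) (z l) \<le> t" "t \<le> max (z' l) (z l)" for t
        using in_V[OF that] by (simp add: V_def)
      have der: "((\<lambda>s. Q r ((y l)(l := s))) has_real_derivative pd l (Q r) ((y l)(l := t))) (at t)"
        if "min (z' l) (z l) \<le> t" "t \<le> max (z' l) (z l)" for t
        by (rule Ck_deriv_upd[OF Q[OF r, unfolded One_nat_def] tU[OF that]])
      have bnd: "\<bar>pd l (Q r) ((y l)(l := t))\<bar> \<le> K" if "min (z' l) (z l) \<le> t" "t \<le> max (z' l) (z l)" for t
      proof -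
        have "(y l)(l := t) \<in> (\<Inter>r\<in>{..<m}. \<Inter>j\<in>{..<d}. U \<inter> pd j (Q r) -` {- K <..< K})"
          using in_V[OF that] unfolding V_def by (rule IntD1)
        from INT_D[OF INT_D[OF this, of r], of l] r Suc.prems
        have "(y l)(l := t) \<in> U \<inter> pd l (Q r) -` {- K <..< K}" by simp
        then show ?thesis by auto
      qed
      have "\<bar>Q r ((y l)(l := z l)) - Q r ((y l)(l := z' l))\<bar> \<le> K * \<bar>z l - z' l\<bar>"
        by (rule partial_bound[of "z' l" "z l" "\<lambda>s. Q r ((y l)(l := s))" "\<lambda>s. pd l (Q r) ((y l)(l := s))" K, OF der bnd])
      moreover have "Q r (y l) = Q r ((y l)(l := z' l))" by (rule arg_cong[OF upd(2)])
      ultimately have "\<bar>Q r (y (Suc l)) - Q r (y l)\<bar> \<le> K * \<bar>z l - z' l\<bar>"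
        unfolding upd(1) by presburger
      then show ?case using Suc by (simp add: distrib_left)
    qed
    from this[of d] have "\<bar>Q r (y d) - Q r z'\<bar> \<le> K * (\<Sum>j<d. \<bar>z j - z' j\<bar>)" by simp
    moreover have "y d = z" using z(1,2) by (auto simp: y_def topspace_Euclidean_space fun_eq_iff)
    ultimately show ?thesis by simp
  qed
  then have "\<forall>z\<in>topspace (Euclidean_space d). \<forall>z'\<in>topspace (Euclidean_space d).
    (\<forall>j<d. \<bar>z j - z0 j\<bar> < \<delta>) \<longrightarrow> (\<forall>j<d. \<bar>z' j - z0 j\<bar> < \<delta>) \<longrightarrow>
    (\<forall>r<m. \<bar>Q r z - Q r z'\<bar> \<le> K * (\<Sum>j<d. \<bar>z j - z' j\<bar>))" by (intro ballI allI impI) simp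
  with \<delta>(1) K0 show ?thesis by blast
qed

text \<open>Around each point the functions are Lipschitz on a cube. By Lindelof countably many
  cubes cover the relevant part of U, and a countable union of null sets is null.\<close>

lemma C1_image_null:
  fixes Q :: "nat \<Rightarrow> (nat \<Rightarrow> real) \<Rightarrow> real"
  assumes dm: "d < m" and U: "open U" and Q: "\<And>r. r < m \<Longrightarrow> Ck 1 U (Q r)"
  shows "\<exists>N\<in>null_sets (PiM {..<m} (\<lambda>_. lborel)).
    \<forall>z\<in>U \<inter> topspace (Euclidean_space d). (\<lambda>r\<in>{..<m}. Q r z) \<in> N"
proof -
  let ?E = "topspace (Euclidean_space d)"
  define P where "P = PiM {..<m} (\<lambda>_. lborel :: real measure)"
  define img where "img z = (\<lambda>r\<in>{..<m}. Q r z)" for z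
  define ok where "ok V \<longleftrightarrow> (\<exists>N\<in>null_sets P. \<forall>z\<in>V \<inter> ?E. img z \<in> N)" for V
  have "\<exists>V. open V \<and> ok V \<and> z0 \<in> V" if z0: "z0 \<in> U \<inter> ?E" for z0
  proof -
    have "z0 \<in> U" "z0 \<in> ?E" using z0 by auto
    define Lip where "Lip \<delta> K \<longleftrightarrow> (\<forall>z\<in>?E. \<forall>z'\<in>?E.
        (\<forall>j<d. \<bar>z j - z0 j\<bar> < \<delta>) \<longrightarrow> (\<forall>j<d. \<bar>z' j - z0 j\<bar> < \<delta>) \<longrightarrow>
        (\<forall>r<m. \<bar>Q r z - Q r z'\<bar> \<le> K * (\<Sum>j<d. \<bar>z j - z' j\<bar>)))" for \<delta> K
    have "\<exists>\<delta>>0. \<exists>K\<ge>0. Lip \<delta> K"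
      unfolding Lip_def using \<open>z0 \<in> U\<close> \<open>z0 \<in> ?E\<close> by (intro C1_locally_Lipschitz[OF U]) (rule Q)
    then obtain \<delta> K where d: "\<delta> > 0" "K \<ge> 0" "Lip \<delta> K" by blast
    define V where "V = (\<Inter>j\<in>{..<d}. {z::nat \<Rightarrow> real. z0 j - \<delta> < z j} \<inter> {z. z j < z0 j + \<delta>})"
    have oV: "open V" unfolding V_def
      by (intro open_INT ballI open_Int open_Collect_less continuous_on_const continuous_on_coord) auto
    have zV: "z0 \<in> V" using d(1) by (simp add: V_def)
    have V1: "z0 j - \<delta> < z j \<and> z j < z0 j + \<delta>" if "z \<in> V \<inter> ?E" "j < d" for z j
      using that by (simp add: V_def)
    have V2: "\<bar>z j - z0 j\<bar> < \<delta>" if "z \<in> V \<inter> ?E" "j < d" for z j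
      using V1[OF that] by linarith
    have "\<exists>N\<in>null_sets (PiM {..<m} (\<lambda>_. lborel)). \<forall>z\<in>V \<inter> ?E. restrict (\<lambda>r. Q r z) {..<m} \<in> N"
    proof (rule Lipschitz_image_null[where Q = "\<lambda>z r. Q r z" and c = "\<lambda>j. z0 j - \<delta>" and w = "2 * \<delta>" and L = K])
      show "z0 j - \<delta> \<le> z j \<and> z j \<le> z0 j - \<delta> + 2 * \<delta>" if "z \<in> V \<inter> ?E" "j < d" for z j
        using V1[OF that] by linarith
      show "\<bar>Q r z - Q r z'\<bar> \<le> K * (\<Sum>j<d. \<bar>z j - z' j\<bar>)"
        if z: "z \<in> V \<inter> ?E" and z': "z' \<in> V \<inter> ?E" and r: "r < m" for z z' r
        by (rule d(3)[unfolded Lip_def, rule_format, OF IntD2[OF z] IntD2[OF z'] V2[OF z] V2[OF z'] r])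
    qed (use d dm in simp_all)
    then have "ok V" by (simp only: ok_def img_def P_def)
    with oV zV show ?thesis by blast
  qed
  then have "\<forall>z\<in>U \<inter> ?E. \<exists>V. open V \<and> ok V \<and> z \<in> V" by blast
  then obtain V where V: "\<forall>z\<in>U \<inter> ?E. open (V z) \<and> ok (V z) \<and> z \<in> V z"
    by (rule bchoice[THEN exE])
  have "\<And>W. W \<in> V ` (U \<inter> ?E) \<Longrightarrow> open W" using V by blast
  then obtain \<F> where \<F>: "\<F> \<subseteq> V ` (U \<inter> ?E)" "countable \<F>" "\<Union>\<F> = \<Union>(V ` (U \<inter> ?E))"
    by (rule Lindelof)
  have "\<forall>W\<in>\<F>. ok W" using V \<F>(1) by blast
  then have "\<forall>W\<in>\<F>. \<exists>N. N \<in> null_sets P \<and> (\<forall>z\<in>W \<inter> ?E. img z \<in> N)" unfolding ok_def by blast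
  then obtain N where N: "\<forall>W\<in>\<F>. N W \<in> null_sets P \<and> (\<forall>z\<in>W \<inter> ?E. img z \<in> N W)"
    by (rule bchoice[THEN exE])
  have "(\<Union>W\<in>\<F>. N W) \<in> null_sets P"
    using \<F>(2) by (rule null_sets_UN') (use N in blast)
  moreover have "img z \<in> (\<Union>W\<in>\<F>. N W)" if z: "z \<in> U \<inter> ?E" for z
  proof -
    have "z \<in> \<Union>\<F>" using V z \<F>(3) by blast
    then show ?thesis using N z by blast
  qed
  ultimately show ?thesis unfolding P_def img_def by blast
qed

text \<open>A countable union of null images cannot contain a cube of side e, whose volume
  \<open>e ^ m\<close> is positive; any point of the cube outside the union serves.\<close>

lemma avoid_C1_images:
  fixes U :: "'s::countable \<Rightarrow> (nat \<Rightarrow> real) set" and Q :: "'s \<Rightarrow> nat \<Rightarrow> (nat \<Rightarrow> real) \<Rightarrow> real"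
  assumes dm: "d < m" and U: "\<And>i. open (U i)" and Q: "\<And>i r. r < m \<Longrightarrow> Ck 1 (U i) (Q i r)" and e: "e > 0"
  shows "\<exists>a::nat \<Rightarrow> real. (\<forall>r. \<bar>a r\<bar> \<le> e) \<and>
    (\<forall>i. \<forall>z \<in> U i \<inter> topspace (Euclidean_space d). \<exists>r<m. Q i r z \<noteq> a r)"
proof -
  interpret product_sigma_finite "\<lambda>_::nat. lborel :: real measure" ..
  let ?E = "topspace (Euclidean_space d)"
  define P where "P = PiM {..<m} (\<lambda>_. lborel :: real measure)"
  define img where "img i z = (\<lambda>r\<in>{..<m}. Q i r z)" for i :: 's and z
  have "\<exists>N\<in>null_sets P. \<forall>z\<in>U i \<inter> ?E. img i z \<in> N" for i
    unfolding P_def img_def by (rule C1_image_null[where Q = "Q i", OF dm U]) (rule Q)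
  then have "\<forall>i. \<exists>N. N \<in> null_sets P \<and> (\<forall>z\<in>U i \<inter> ?E. img i z \<in> N)" by blast
  then obtain N where N: "\<forall>i. N i \<in> null_sets P \<and> (\<forall>z\<in>U i \<inter> ?E. img i z \<in> N i)"
    by (rule choice[THEN exE])
  have null: "(\<Union>i. N i) \<in> null_sets P" by (rule null_sets_UN) (use N in blast)
  define cube where "cube = (\<Pi>\<^sub>E r\<in>{..<m}. {0..e})"
  have cube_sets: "cube \<in> sets P" unfolding cube_def P_def by (intro sets_PiM_I_finite) auto
  have "emeasure P cube = (\<Prod>r<m. emeasure lborel {0..e})"
    unfolding cube_def P_def by (intro emeasure_PiM) auto
  also have "\<dots> = ennreal (e ^ m)" using e by (simp add: ennreal_power)
  finally have "emeasure P cube \<noteq> 0" using e by simp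
  have "\<not> cube \<subseteq> (\<Union>i. N i)"
  proof
    assume "cube \<subseteq> (\<Union>i. N i)"
    then have "cube \<in> null_sets P" using null_sets_subset[OF null cube_sets] by blast
    then show False using \<open>emeasure P cube \<noteq> 0\<close> by (simp add: null_sets_def)
  qed
  then obtain b where b: "b \<in> cube" "b \<notin> (\<Union>i. N i)" by blast
  define a where "a r = (if r < m then b r else 0)" for r
  have "\<bar>a r\<bar> \<le> e" for r
  proof (cases "r < m")
    case True
    then have "b r \<in> {0..e}" using b(1) by (simp add: cube_def PiE_iff)
    then show ?thesis using True by (simp add: a_def)
  qed (use e in \<open>simp add: a_def\<close>)
  moreover have "\<exists>r<m. Q i r z \<noteq> a r" if z: "z \<in> U i \<inter> ?E" for i z
  proof (rule ccontr)
    assume neg: "\<not> ?thesis"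
    have "img i z = b"
    proof (rule ext)
      fix r show "img i z r = b r"
        using neg b(1) by (cases "r < m") (simp_all add: img_def a_def cube_def PiE_iff extensional_def)
    qed
    then show False using N z b(2) by blast
  qed
  ultimately show ?thesis by blast
qed

text \<open>
  The coefficients are chosen one at a time.  The choice of \<open>a N\<close> is only constrained where
  \<open>L s N z \<noteq> 0\<close>; elsewhere the sum does not change.
\<close>

lemma generic_coefficients:
  fixes L :: "'s::countable \<Rightarrow> nat \<Rightarrow> (nat \<Rightarrow> real) \<Rightarrow> real" and B :: "'s \<Rightarrow> nat \<Rightarrow> (nat \<Rightarrow> real) \<Rightarrow> real"
  assumes dm: "d < m" and L: "\<And>s k. smooth (L s k)" and B: "\<And>s r. smooth (B s r)" and e: "\<And>k. e k > 0"
  shows "\<exists>a::nat \<Rightarrow> nat \<Rightarrow> real. (\<forall>k r. \<bar>a k r\<bar> \<le> e k) \<and>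
    (\<forall>N s. \<forall>z\<in>topspace (Euclidean_space d). (\<exists>k<N. L s k z \<noteq> 0) \<longrightarrow>
       (\<exists>r<m. B s r z + (\<Sum>k<N. a k r * L s k z) \<noteq> 0))"
proof -
  let ?E = "topspace (Euclidean_space d)"
  define nz where "nz N \<alpha> v s z \<longleftrightarrow> (\<exists>r<m. B s r z + (\<Sum>k<N. \<alpha> k r * L s k z) + v r * L s N z \<noteq> 0)"
    for N :: nat and \<alpha> :: "nat \<Rightarrow> nat \<Rightarrow> real" and v :: "nat \<Rightarrow> real" and s z
  define good where "good N \<alpha> v \<longleftrightarrow> (\<forall>r. \<bar>v r\<bar> \<le> e N) \<and> (\<forall>s. \<forall>z\<in>?E. L s N z \<noteq> 0 \<longrightarrow> nz N \<alpha> v s z)"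
    for N \<alpha> v
  have ex_good: "\<exists>v. good N \<alpha> v" for N and \<alpha> :: "nat \<Rightarrow> nat \<Rightarrow> real"
  proof -
    define U where "U s = {z. L s N z \<noteq> 0}" for s
    \<comment> \<open>Where \<open>L s N z\<close> is nonzero, exactly one choice of the first m
      components of v makes all of the sums vanish, namely \<open>Q s r z\<close>. The vectors to be
      avoided are thus the values of these maps.\<close>
    define Q where "Q s r z = - 1 * (B s r z + (\<Sum>k<N. \<alpha> k r * L s k z)) * inverse (L s N z)" for s r z
    have oU: "open (U s)" for s
      unfolding U_def by (rule open_Collect_neq[OF smooth_cont[OF L] continuous_on_const])
    have Q1: "Ck 1 (U s) (Q s r)" for s r
    proof -
      have "smooth (\<lambda>z. \<alpha> k r * L s k z)" for k by (rule smooth_mult[OF smooth_const L])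
      then have "smooth (\<lambda>z. - 1 * (B s r z + (\<Sum>k<N. \<alpha> k r * L s k z)))"
        by (rule smooth_mult[OF smooth_const smooth_add[OF B smooth_sum]])
      then have "Ck 1 (U s) (\<lambda>z. - 1 * (B s r z + (\<Sum>k<N. \<alpha> k r * L s k z)))"
        by (rule Ck_subset[OF smooth_Ck subset_UNIV])
      moreover have "Ck 1 (U s) (\<lambda>z. inverse (L s N z))"
        by (rule Ck_inverse[OF oU Ck_subset[OF smooth_Ck[OF L] subset_UNIV]]) (simp add: U_def)
      ultimately show ?thesis unfolding Q_def[abs_def] by (rule Ck_mult[OF oU])
    qed
    have "\<exists>v. (\<forall>r. \<bar>v r\<bar> \<le> e N) \<and> (\<forall>s. \<forall>z\<in>U s \<inter> ?E. \<exists>r<m. Q s r z \<noteq> v r)"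
      by (rule avoid_C1_images[where U = U and Q = Q, OF dm oU Q1 e])
    then obtain v where v: "\<forall>r. \<bar>v r\<bar> \<le> e N" "\<forall>s. \<forall>z\<in>U s \<inter> ?E. \<exists>r<m. Q s r z \<noteq> v r" by blast
    have "nz N \<alpha> v s z" if z: "z \<in> ?E" and L0: "L s N z \<noteq> 0" for s z
    proof -
      have "z \<in> U s \<inter> ?E" using z L0 by (simp add: U_def)
      then obtain r where r: "r < m" "Q s r z \<noteq> v r" using v(2) by blast
      have "B s r z + (\<Sum>k<N. \<alpha> k r * L s k z) + v r * L s N z \<noteq> 0"
      proof
        assume "B s r z + (\<Sum>k<N. \<alpha> k r * L s k z) + v r * L s N z = 0"
        then have "- 1 * (B s r z + (\<Sum>k<N. \<alpha> k r * L s k z)) = v r * L s N z"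
          by (simp only: mult_minus1 neg_eq_iff_add_eq_0)
        then have "Q s r z = v r * L s N z * inverse (L s N z)" by (simp only: Q_def)
        then show False using r(2) L0 by simp
      qed
      with r(1) show ?thesis unfolding nz_def by blast
    qed
    with v(1) show ?thesis unfolding good_def by blast
  qed
  define v where "v N \<alpha> = (SOME v. good N \<alpha> v)" for N \<alpha>
  have v: "good N \<alpha> (v N \<alpha>)" for N \<alpha> unfolding v_def using ex_good by (rule someI_ex)
  \<comment> \<open>\<open>A N\<close> holds the coefficients below N and is 0 elsewhere. The
    recursion runs over whole families because \<open>v N\<close> depends on all earlier
    choices.\<close>
  define A where "A = rec_nat (\<lambda>_ _. 0) (\<lambda>N \<alpha>. \<alpha>(N := v N \<alpha>))"
  have A: "A (Suc N) = (A N)(N := v N (A N))" for N by (simp add: A_def)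
  define a where "a k = A (Suc k) k" for k
  have a: "a k = v k (A k)" for k by (simp add: a_def A)
  have A_eq: "A N k = a k" if "k < N" for N k
    using that
  proof (induction N)
    case (Suc N)
    then show ?case by (cases "k = N") (simp_all add: A a)
  qed simp
  have "\<bar>a k r\<bar> \<le> e k" for k r using v[of k "A k"] by (simp add: a good_def)
  moreover have "\<exists>r<m. B s r z + (\<Sum>k<N. a k r * L s k z) \<noteq> 0" if z: "z \<in> ?E" and "\<exists>k<N. L s k z \<noteq> 0" for N s z
    using that(2)
  proof (induction N)
    case (Suc N)
    show ?case
    proof (cases "L s N z = 0")
      case True
      then have "\<exists>k<N. L s k z \<noteq> 0" using Suc.prems less_Suc_eq by auto
      then show ?thesis using Suc.IH True by simp
    next
      case False
      then have "nz N (A N) (a N) s z" using v[of N "A N"] z unfolding a good_def by blast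
      moreover have "(\<Sum>k<N. A N k r * L s k z) = (\<Sum>k<N. a k r * L s k z)" for r
        by (rule sum.cong) (simp_all add: A_eq)
      ultimately show ?thesis unfolding nz_def by (simp add: add.assoc)
    qed
  qed simp
  ultimately show ?thesis by blast
qed

section \<open>Differential spaces and charts\<close>

lemma restricted_structureD:
  "f \<in> restricted_structure S C A \<Longrightarrow> x \<in> A \<Longrightarrow>
    \<exists>V g. openin (subtopology S A) V \<and> x \<in> V \<and> g \<in> C \<and> (\<forall>y\<in>V. f y = g y)"
  by (simp add: restricted_structure_def)

lemma open_imp_openin_Euclidean:
  assumes "open Q" shows "openin (Euclidean_space k) (Q \<inter> topspace (Euclidean_space k))"
proof -
  have "openin (powertop_real UNIV) Q"
    using assms by (subst euclidean_product_topology) (rule open_openin[THEN iffD1])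
  then show ?thesis
    unfolding topspace_Euclidean_space unfolding Euclidean_space_def by (rule openin_subtopology_Int)
qed

section \<open>Functions of a differential space\<close>

locale diff_space =
  fixes S :: "'a topology" and C :: "('a \<Rightarrow> real) set"
  assumes diff_space: "differential_space S C"
begin

lemma topology_eq:
  "S = topology_generated_by {{x \<in> topspace S. f x \<in> I} | f I. f \<in> C \<and> open I \<and> is_interval I}"
  using diff_space unfolding differential_space_def by (rule conjunct1)

lemma C_infinity_compose:
  assumes "F \<in> C_infinity r" "\<And>i. i < r \<Longrightarrow> f i \<in> C"
  shows "(\<lambda>x. F (\<lambda>i. if i < r then f i x else 0)) \<in> C"
  using diff_space assms unfolding differential_space_def by simp

lemma smooth_in_C:
  assumes "smooth F" "\<And>i. i < r \<Longrightarrow> f i \<in> C"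
  shows "(\<lambda>x. F (\<lambda>i. if i < r then f i x else 0)) \<in> C"
  using assms by (intro C_infinity_compose smooth_in_C_infinity)

lemma C_local:
  assumes "\<And>x. x \<in> topspace S \<Longrightarrow> \<exists>U g. openin S U \<and> x \<in> U \<and> g \<in> C \<and> (\<forall>y\<in>U. g y = f y)"
  shows "f \<in> C"
  using diff_space assms unfolding differential_space_def by simp

lemma C_const: "(\<lambda>_. c) \<in> C"
  using smooth_in_C[OF smooth_const, of 0 _ c] by simp

lemma C_unary:
  assumes "smooth (\<lambda>x. h (x 0))" "f \<in> C" shows "(\<lambda>x. h (f x)) \<in> C"
  using smooth_in_C[OF assms(1), of 1 "\<lambda>_. f"] assms(2) by simp

lemma C_add: "f \<in> C \<Longrightarrow> g \<in> C \<Longrightarrow> (\<lambda>x. f x + g x) \<in> C"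
  using smooth_in_C[OF smooth_add[OF smooth_coord[of 0] smooth_coord[of 1]], of 2 "\<lambda>i. if i = 0 then f else g"]
  by simp

lemma C_mult: "f \<in> C \<Longrightarrow> g \<in> C \<Longrightarrow> (\<lambda>x. f x * g x) \<in> C"
  using smooth_in_C[OF smooth_mult[OF smooth_coord[of 0] smooth_coord[of 1]], of 2 "\<lambda>i. if i = 0 then f else g"]
  by simp

lemma C_minus: "f \<in> C \<Longrightarrow> g \<in> C \<Longrightarrow> (\<lambda>x. f x - g x) \<in> C"
  using smooth_in_C[OF smooth_diff[OF smooth_coord[of 0] smooth_coord[of 1]], of 2 "\<lambda>i. if i = 0 then f else g"]
  by simp

lemma C_sum: "(\<And>i. i \<in> I \<Longrightarrow> f i \<in> C) \<Longrightarrow> (\<lambda>x. \<Sum>i\<in>I. f i x) \<in> C"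
  by (induction I rule: infinite_finite_induct) (simp_all add: C_const C_add)

lemma C_prod: "(\<And>i. i \<in> I \<Longrightarrow> f i \<in> C) \<Longrightarrow> (\<lambda>x. \<Prod>i\<in>I. f i x) \<in> C"
  by (induction I rule: infinite_finite_induct) (simp_all add: C_const C_mult)

lemma C_continuous:
  assumes f: "f \<in> C" shows "continuous_map S euclideanreal f"
  unfolding continuous_map
proof (intro conjI allI impI)
  fix V :: "real set" assume "openin euclidean V"
  show "openin S {x \<in> topspace S. f x \<in> V}"
  proof (subst openin_subopen, intro ballI)
    fix x assume x: "x \<in> {x \<in> topspace S. f x \<in> V}"
    then obtain e where e: "e > 0" "ball (f x) e \<subseteq> V"
      using \<open>openin euclidean V\<close> by (auto simp: open_contains_ball)
    have "openin S {y \<in> topspace S. f y \<in> ball (f x) e}"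
    proof (subst topology_eq, rule topology_generated_by_Basis, rule CollectI)
      show "\<exists>g I. {y \<in> topspace S. f y \<in> ball (f x) e} = {x \<in> topspace S. g x \<in> I} \<and> g \<in> C \<and> open I \<and> is_interval I"
        by (intro exI[of _ f] exI[of _ "ball (f x) e"] conjI refl f open_ball is_interval_ball_real)
    qed
    then show "\<exists>T. openin S T \<and> x \<in> T \<and> T \<subseteq> {x \<in> topspace S. f x \<in> V}"
      using x e by (intro exI[of _ "{y \<in> topspace S. f y \<in> ball (f x) e}"]) auto
  qed
qed simp

lemma C_open_greater: "f \<in> C \<Longrightarrow> openin S {y \<in> topspace S. c < f y}"
  using openin_continuous_map_preimage[OF C_continuous, of f "{c<..}"] by simp

lemma C_open_less: "f \<in> C \<Longrightarrow> openin S {y \<in> topspace S. f y < c}"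
  using openin_continuous_map_preimage[OF C_continuous, of f "{..<c}"] by simp

text \<open>Induction over the generation of the topology: preimages of intervals have bumps by
  composing with a cut-off, intersections by multiplying, and a union inherits the bump of the
  member that contains x.\<close>

lemma bump_exists:
  assumes "openin S V" "x \<in> V"
  shows "\<exists>\<beta>\<in>C. \<beta> x = 1 \<and> (\<forall>y \<in> topspace S - V. \<beta> y = 0)"
proof -
  have "generate_topology_on {{x \<in> topspace S. f x \<in> I} | f I. f \<in> C \<and> open I \<and> is_interval I} V"
    using assms(1) by (subst (asm) topology_eq) (rule openin_topology_generated_by)
  then show ?thesis using assms(2)
  proof (induction V)
    case (Int a b)
    then obtain \<alpha> \<beta> where "\<alpha> \<in> C" "\<alpha> x = 1" "\<forall>y \<in> topspace S - a. \<alpha> y = 0"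
      "\<beta> \<in> C" "\<beta> x = 1" "\<forall>y \<in> topspace S - b. \<beta> y = 0" by blast
    then show ?case by (intro bexI[of _ "\<lambda>y. \<alpha> y * \<beta> y"]) (auto intro: C_mult)
  next
    case (Basis s)
    then obtain f I where f: "f \<in> C" "open I" and s: "s = {x \<in> topspace S. f x \<in> I}" by blast
    have "f x \<in> I" using Basis(2) s by blast
    then obtain e where e: "e > 0" "ball (f x) e \<subseteq> I" using f(2) openE by blast
    let ?h = "\<lambda>t. step (2 / e\<^sup>2 * ((t - f x) * (t - f x)))"
    have "(\<lambda>y. ?h (f y)) \<in> C"
      by (rule C_unary[where h = ?h, OF _ f(1)],
          rule smooth_step[OF smooth_mult[OF smooth_const smooth_mult[OF smooth_diff smooth_diff]]])
        (rule smooth_coord smooth_const)+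
    moreover have "?h (f x) = 1" by (simp add: step_eq_1)
    moreover have "?h (f y) = 0" if "y \<in> topspace S - s" for y
    proof (rule step_eq_0)
      have "f y \<notin> ball (f x) e" using that e(2) s by blast
      then have "e \<le> \<bar>f y - f x\<bar>" by (simp add: dist_real_def abs_minus_commute)
      then have "e\<^sup>2 \<le> (f y - f x)\<^sup>2" using e(1) by (metis abs_le_square_iff abs_of_pos)
      then show "2 \<le> 2 / e\<^sup>2 * ((f y - f x) * (f y - f x))"
        using e(1) by (simp add: field_simps power2_eq_square)
    qed
    ultimately show ?case by (intro bexI[of _ "\<lambda>y. ?h (f y)"]) blast+
  qed blast+
qed

text \<open>Flattens a bump near both of its extreme values. The open set W will make the partition
  of unity locally finite, and the open set Z lets a product with chart coordinates be extended
  smoothly by zero.\<close>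

lemma plateau_exists:
  assumes "openin S V" "x \<in> V"
  shows "\<exists>\<rho> W Z. \<rho> \<in> C \<and> openin S W \<and> openin S Z \<and> x \<in> W \<and> (\<forall>y\<in>W. \<rho> y = 1) \<and> (\<forall>y\<in>Z. \<rho> y = 0) \<and>
    topspace S - V \<subseteq> Z \<and> (\<forall>y. 0 \<le> \<rho> y \<and> \<rho> y \<le> 1)"
proof -
  obtain \<beta> where b: "\<beta> \<in> C" "\<beta> x = 1" "\<forall>y \<in> topspace S - V. \<beta> y = 0" using bump_exists[OF assms] by blast
  let ?h = "\<lambda>t. 1 - step (3 * t)"
  have "(\<lambda>y. ?h (\<beta> y)) \<in> C"
    by (rule C_unary[where h = ?h, OF _ b(1)],
        rule smooth_diff[OF smooth_const smooth_step[OF smooth_mult[OF smooth_const smooth_coord]]])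
  moreover have "openin S {y \<in> topspace S. 2/3 < \<beta> y}" "openin S {y \<in> topspace S. \<beta> y < 1/3}"
    using b(1) by (intro C_open_greater C_open_less; assumption)+
  moreover have "x \<in> topspace S" using assms openin_subset by blast
  ultimately show ?thesis using b(2,3)
    by (intro exI[of _ "\<lambda>y. ?h (\<beta> y)"] exI[of _ "{y \<in> topspace S. 2/3 < \<beta> y}"] exI[of _ "{y \<in> topspace S. \<beta> y < 1/3}"] conjI)
      (auto simp: step_eq_0 step_eq_1 step_nonneg step_le_1)
qed

text \<open>A local embedding without its inverse and without restricted structures. Smoothness of
  the inverse has become the last clause: each function of C is locally a smooth function of the
  coordinates.\<close>

definition chart :: "nat \<Rightarrow> 'a set \<Rightarrow> ('a \<Rightarrow> nat \<Rightarrow> real) \<Rightarrow> bool" where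
  "chart n U \<phi> \<longleftrightarrow> openin S U \<and> (\<forall>x\<in>U. \<phi> x \<in> topspace (Euclidean_space n)) \<and> inj_on \<phi> U \<and>
    (\<forall>Q. open Q \<longrightarrow> openin S {y \<in> U. \<phi> y \<in> Q}) \<and>
    (\<forall>l. \<forall>x\<in>U. \<exists>W g. openin S W \<and> x \<in> W \<and> W \<subseteq> U \<and> g \<in> C \<and> (\<forall>y\<in>W. g y = \<phi> y l)) \<and>
    (\<forall>g\<in>C. \<forall>x\<in>U. \<exists>W H. openin S W \<and> x \<in> W \<and> W \<subseteq> U \<and> smooth H \<and> (\<forall>y\<in>W. g y = H (\<phi> y)))"

text \<open>A chart into R^k is already one into R^n, because in this encoding R^k is literally a
  subset of R^n. A function of \<open>C_infinity k\<close> becomes smooth on all sequences by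
  composing it with \<open>trunc k\<close>.\<close>

lemma chart_exists:
  assumes "locally_embeddable_at S C x k" "k \<le> n"
  shows "\<exists>U \<phi>. x \<in> U \<and> chart n U \<phi>"
proof -
  obtain U A \<phi> \<psi> where U: "openin S U" "x \<in> U" and A: "A \<subseteq> topspace (Euclidean_space k)"
    and sm: "smooth_map (subtopology S U) (restricted_structure S C U)
          (subtopology (Euclidean_space k) A) (restricted_structure (Euclidean_space k) (C_infinity k) A) \<phi>"
    and sm': "smooth_map (subtopology (Euclidean_space k) A) (restricted_structure (Euclidean_space k) (C_infinity k) A)
          (subtopology S U) (restricted_structure S C U) \<psi>"
    and inv: "\<forall>x \<in> topspace (subtopology S U). \<psi> (\<phi> x) = x"
    using assms(1) unfolding locally_embeddable_at_def diffeomorphic_to_subset_of_Euclidean_def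
      diffeomorphic_spaces_def by blast
  have US: "U \<subseteq> topspace S" using U(1) by (rule openin_subset)
  have tU: "topspace (subtopology S U) = U" using US by auto
  have tA: "topspace (subtopology (Euclidean_space k) A) = A" using A by auto
  have \<phi>A: "\<phi> y \<in> A" if "y \<in> U" for y
    using sm that unfolding smooth_map_def tU tA by blast
  have oU: "openin (subtopology S U) V \<longleftrightarrow> openin S V \<and> V \<subseteq> U" for V
    using openin_open_subtopology[OF U(1)] by auto
  have coord: "\<exists>W g. openin S W \<and> y \<in> W \<and> W \<subseteq> U \<and> g \<in> C \<and> (\<forall>y\<in>W. g y = \<phi> y l)" if "y \<in> U" for y l
  proof -
    have "(\<lambda>z. z l) \<in> restricted_structure (Euclidean_space k) (C_infinity k) A"
      unfolding restricted_structure_def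
    proof (intro CollectI ballI)
      fix z assume "z \<in> A"
      then show "\<exists>V g. openin (subtopology (Euclidean_space k) A) V \<and> z \<in> V \<and> g \<in> C_infinity k \<and> (\<forall>y\<in>V. y l = g y)"
        using openin_topspace[of "subtopology (Euclidean_space k) A", unfolded tA]
          smooth_in_C_infinity[OF smooth_coord[of l], of k]
        by (intro exI[of _ A] exI[of _ "\<lambda>z. z l"]) simp
    qed
    then have "(\<lambda>z. z l) \<circ> \<phi> \<in> restricted_structure S C U" using sm unfolding smooth_map_def by blast
    from restricted_structureD[OF this that]
    obtain V g where "openin (subtopology S U) V" "y \<in> V" "g \<in> C" "\<forall>z\<in>V. ((\<lambda>z. z l) \<circ> \<phi>) z = g z"
      by (elim exE conjE)
    then show ?thesis unfolding oU by (intro exI[of _ V] exI[of _ g]) simp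
  qed
  \<comment> \<open>Continuity is not part of the definition of a smooth map. It follows here
    because the coordinates of \<open>\<phi>\<close> agree locally with functions of C, which are
    continuous.\<close>
  have cont_l: "continuous_map (subtopology S U) euclideanreal (\<lambda>y. \<phi> y l)" for l
    unfolding continuous_map
  proof (intro conjI allI impI)
    fix V :: "real set" assume V: "openin euclidean V"
    show "openin (subtopology S U) {y \<in> topspace (subtopology S U). \<phi> y l \<in> V}"
    proof (subst openin_subopen, intro ballI)
      fix y assume "y \<in> {y \<in> topspace (subtopology S U). \<phi> y l \<in> V}"
      then have y: "y \<in> U" "\<phi> y l \<in> V" by (simp_all add: tU)
      obtain W g where W: "openin S W" "y \<in> W" "W \<subseteq> U" "g \<in> C" "\<forall>y\<in>W. g y = \<phi> y l"
        using coord[OF y(1), of l] by (elim exE conjE)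
      have "openin S (W \<inter> {z \<in> topspace S. g z \<in> V})"
        by (rule openin_Int[OF W(1) openin_continuous_map_preimage[OF C_continuous[OF W(4)] V]])
      moreover have "y \<in> W \<inter> {z \<in> topspace S. g z \<in> V}" using W(2,5) y US by auto
      moreover have "W \<inter> {z \<in> topspace S. g z \<in> V} \<subseteq> {y \<in> topspace (subtopology S U). \<phi> y l \<in> V}"
        using W(3,5) tU by auto
      ultimately show "\<exists>T. openin (subtopology S U) T \<and> y \<in> T \<and> T \<subseteq> {y \<in> topspace (subtopology S U). \<phi> y l \<in> V}"
        using oU W(3) by (intro exI[of _ "W \<inter> {z \<in> topspace S. g z \<in> V}"]) auto
    qed
  qed simp
  have "continuous_map (subtopology S U) (Euclidean_space k) (\<lambda>y i. if i < k then \<phi> y i else 0)"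
    unfolding continuous_map_componentwise_Euclidean_space using cont_l by blast
  then have "continuous_map (subtopology S U) (Euclidean_space k) \<phi>"
  proof (rule continuous_map_eq)
    fix y assume "y \<in> topspace (subtopology S U)"
    then have "\<phi> y \<in> topspace (Euclidean_space k)" using \<phi>A A tU by blast
    then show "(\<lambda>i. if i < k then \<phi> y i else 0) = \<phi> y" by (auto simp: topspace_Euclidean_space)
  qed
  then have cont: "continuous_map (subtopology S U) (subtopology (Euclidean_space k) A) \<phi>"
    unfolding continuous_map_in_subtopology using \<phi>A tU by blast
  have opn: "openin S {y \<in> U. \<phi> y \<in> V}" if "openin (subtopology (Euclidean_space k) A) V" for V
    using openin_continuous_map_preimage[OF cont that] unfolding tU oU by blast
  have "chart n U \<phi>"
    unfolding chart_def
  proof (intro conjI ballI allI impI)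
    show "openin S U" by fact
    show "\<phi> y \<in> topspace (Euclidean_space n)" if "y \<in> U" for y
      using \<phi>A[OF that] A assms(2) by (auto simp: topspace_Euclidean_space)
    show "inj_on \<phi> U" using inv unfolding tU by (metis inj_on_inverseI)
    show "openin S {y \<in> U. \<phi> y \<in> Q}" if "open Q" for Q
    proof -
      have "openin (Euclidean_space k) (Q \<inter> topspace (Euclidean_space k))"
        by (rule open_imp_openin_Euclidean[OF that])
      then have "openin (subtopology (Euclidean_space k) A) (Q \<inter> topspace (Euclidean_space k) \<inter> A)"
        by (rule openin_subtopology_Int)
      from opn[OF this] have "openin S {y \<in> U. \<phi> y \<in> Q \<inter> topspace (Euclidean_space k) \<inter> A}" .
      moreover have "{y \<in> U. \<phi> y \<in> Q \<inter> topspace (Euclidean_space k) \<inter> A} = {y \<in> U. \<phi> y \<in> Q}"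
        using \<phi>A A by blast
      ultimately show ?thesis by simp
    qed
    show "\<exists>W g. openin S W \<and> y \<in> W \<and> W \<subseteq> U \<and> g \<in> C \<and> (\<forall>y\<in>W. g y = \<phi> y l)" if "y \<in> U" for y l
      using coord[OF that] .
    fix g y assume g: "g \<in> C" and y: "y \<in> U"
    have "g \<in> restricted_structure S C U"
      unfolding restricted_structure_def
      by (intro CollectI ballI exI[of _ U] exI[of _ g]) (simp add: g oU U(1))
    then have "g \<circ> \<psi> \<in> restricted_structure (Euclidean_space k) (C_infinity k) A"
      using sm' unfolding smooth_map_def by blast
    from restricted_structureD[OF this \<phi>A[OF y]]
    obtain V H where V: "openin (subtopology (Euclidean_space k) A) V" "\<phi> y \<in> V" "H \<in> C_infinity k"
      "\<forall>z\<in>V. (g \<circ> \<psi>) z = H z"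
      by (elim exE conjE)
    have "g z = H (trunc k (\<phi> z))" if "z \<in> {y \<in> U. \<phi> y \<in> V}" for z
    proof -
      have "trunc k (\<phi> z) = \<phi> z" using that \<phi>A A by (intro trunc_id) blast
      moreover have "\<psi> (\<phi> z) = z" using inv that tU by blast
      ultimately show ?thesis using V(4) that by auto
    qed
    then show "\<exists>W H. openin S W \<and> y \<in> W \<and> W \<subseteq> U \<and> smooth H \<and> (\<forall>y\<in>W. g y = H (\<phi> y))"
      using opn[OF V(1)] V(2,3) y unfolding C_infinity_iff_smooth
      by (intro exI[of _ "{y \<in> U. \<phi> y \<in> V}"] exI[of _ "\<lambda>z. H (trunc k z)"] conjI) simp_all
  qed
  then show ?thesis using U(2) by blast
qed

text \<open>Prepares the choice of coefficients so small that their products with the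
  \<open>\<Phi> k\<close> have a convergent bound.\<close>

lemma compact_support_bounded:
  assumes f: "f \<in> C" and K: "compactin S K" "\<And>y. y \<in> topspace S - K \<Longrightarrow> f y = 0"
  shows "\<exists>M\<ge>0. \<forall>y\<in>topspace S. \<bar>f y\<bar> \<le> M"
proof -
  have "compactin euclideanreal (f ` K)" by (rule image_compactin[OF K(1) C_continuous[OF f]])
  then have "bounded (f ` K)" by (simp add: compact_imp_bounded)
  then obtain M where M: "\<forall>z\<in>f ` K. \<bar>z\<bar> \<le> M" unfolding bounded_iff by auto
  have "\<bar>f y\<bar> \<le> max M 0" if "y \<in> topspace S" for y
    using M K(2)[of y] that by (cases "y \<in> K") fastforce+
  then show ?thesis by (intro exI[of _ "max M 0"]) simp
qed

end

text \<open>A nonempty countable subcover can be listed by all natural numbers, with repetitions;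
  charts and adapted neighbourhoods are indexed in this way.\<close>

lemma Lindelof_sequence:
  assumes "second_countable S" "topspace S \<noteq> {}" "\<And>x. x \<in> topspace S \<Longrightarrow> openin S (W x) \<and> x \<in> W x"
  shows "\<exists>xs :: nat \<Rightarrow> 'a. (\<forall>i. xs i \<in> topspace S) \<and> topspace S = (\<Union>i. W (xs i))"
proof -
  have "Lindelof_space S" using assms(1) by (rule second_countable_imp_Lindelof_space)
  moreover have "\<Union>(W ` topspace S) = topspace S"
  proof (rule subset_antisym)
    show "\<Union>(W ` topspace S) \<subseteq> topspace S" using assms(3) by (intro UN_least openin_subset) simp
    show "topspace S \<subseteq> \<Union>(W ` topspace S)" using assms(3) by blast
  qed
  moreover have "\<And>U. U \<in> W ` topspace S \<Longrightarrow> openin S U" using assms(3) by blast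
  ultimately have "\<exists>\<V>. countable \<V> \<and> \<V> \<subseteq> W ` topspace S \<and> \<Union>\<V> = topspace S"
    by (intro Lindelof_spaceD)
  then obtain \<V> where V: "countable \<V>" "\<V> \<subseteq> W ` topspace S" "\<Union>\<V> = topspace S"
    by (elim exE conjE)
  obtain X where X: "X \<subseteq> topspace S" "countable X" "\<V> = W ` X"
    using V(1,2) by (metis countable_subset_image)
  have "X \<noteq> {}"
  proof
    assume "X = {}"
    then have "topspace S = {}" unfolding V(3)[symmetric] X(3) by (simp only: image_empty Union_empty)
    then show False using assms(2) by contradiction
  qed
  then have r: "range (from_nat_into X) = X" using X(2) by (simp add: range_from_nat_into)
  have "(\<Union>i. W (from_nat_into X i)) = \<Union>(W ` range (from_nat_into X))" by blast
  then have "topspace S = (\<Union>i. W (from_nat_into X i))" using V(3) X(3) r by simp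
  moreover have "from_nat_into X i \<in> topspace S" for i using r X(1) by blast
  ultimately show ?thesis by blast
qed

section \<open>The partition of unity and the embedding\<close>

text \<open>The sets \<open>W i\<close> cover S and bound the number of nonzero terms,
  \<open>Z i\<close> allows extension by zero outside the chart domain \<open>U i\<close>, and the
  compact sets \<open>K i\<close> give boundedness of the \<open>\<Phi> k\<close> and properness of
  \<open>R\<close>.\<close>

locale chart_sequence = diff_space S C for S :: "'a topology" and C :: "('a \<Rightarrow> real) set" +
  fixes n :: nat and U W Z K :: "nat \<Rightarrow> 'a set" and \<phi> :: "nat \<Rightarrow> 'a \<Rightarrow> nat \<Rightarrow> real" and \<rho> :: "nat \<Rightarrow> 'a \<Rightarrow> real"
  assumes U_chart: "chart n (U i) (\<phi> i)"
    and \<rho>_C: "\<rho> i \<in> C"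
    and \<rho>_bounds: "0 \<le> \<rho> i y" "\<rho> i y \<le> 1"
    and W_open: "openin S (W i)" and Z_open: "openin S (Z i)"
    and \<rho>_W: "y \<in> W i \<Longrightarrow> \<rho> i y = 1" and \<rho>_Z: "y \<in> Z i \<Longrightarrow> \<rho> i y = 0"
    and U_Z: "topspace S - U i \<subseteq> Z i"
    and K_compact: "compactin S (K i)" and \<rho>_K: "y \<in> topspace S \<Longrightarrow> y \<notin> K i \<Longrightarrow> \<rho> i y = 0"
    and W_cover: "topspace S = (\<Union>i. W i)"
begin

lemma chart_points: "y \<in> U i \<Longrightarrow> \<phi> i y \<in> topspace (Euclidean_space n)"
  and U_open: "openin S (U i)" and \<phi>_inj: "inj_on (\<phi> i) (U i)"
  and \<phi>_open: "open Q \<Longrightarrow> openin S {y \<in> U i. \<phi> i y \<in> Q}"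
  using U_chart[of i] unfolding chart_def by simp_all

lemma \<phi>_coord:
  assumes "x \<in> U i" shows "\<exists>V g. openin S V \<and> x \<in> V \<and> V \<subseteq> U i \<and> g \<in> C \<and> (\<forall>y\<in>V. g y = \<phi> i y l)"
  using U_chart[of i] assms unfolding chart_def by simp

lemma chart_factor:
  assumes "g \<in> C" "x \<in> U i"
  shows "\<exists>V H. openin S V \<and> x \<in> V \<and> V \<subseteq> U i \<and> smooth H \<and> (\<forall>y\<in>V. g y = H (\<phi> i y))"
  using U_chart[of i] assms unfolding chart_def by simp

text \<open>The factors \<open>1 - \<rho> j\<close> make this partition of unity locally finite.\<close>

definition \<sigma> :: "nat \<Rightarrow> 'a \<Rightarrow> real" where
  "\<sigma> i y = \<rho> i y * (\<Prod>j<i. 1 - \<rho> j y)"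

lemma \<sigma>_C: "\<sigma> i \<in> C"
  unfolding \<sigma>_def[abs_def] by (intro C_mult \<rho>_C C_prod C_minus C_const)

lemma \<sigma>_nonneg: "\<sigma> i y \<ge> 0"
  unfolding \<sigma>_def using \<rho>_bounds by (intro mult_nonneg_nonneg prod_nonneg) simp_all

lemma \<sigma>_zero_W: "y \<in> W j \<Longrightarrow> j < i \<Longrightarrow> \<sigma> i y = 0"
  unfolding \<sigma>_def using \<rho>_W[of y j] by (simp add: prod_zero_iff) blast

lemma \<sigma>_zero: "\<rho> i y = 0 \<Longrightarrow> \<sigma> i y = 0"
  by (simp add: \<sigma>_def)

text \<open>Telescoping: \<open>\<sigma> N\<close> is the amount by which the product of the
  \<open>1 - \<rho> j\<close> drops when the factor with index N is added.\<close>

lemma \<sigma>_sum_prod: "(\<Sum>i<N. \<sigma> i y) = 1 - (\<Prod>j<N. 1 - \<rho> j y)"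
  by (induction N) (simp_all add: \<sigma>_def algebra_simps)

lemma \<sigma>_sum: "y \<in> W j \<Longrightarrow> j < N \<Longrightarrow> (\<Sum>i<N. \<sigma> i y) = 1"
  unfolding \<sigma>_sum_prod using \<rho>_W[of y j] by (simp add: prod_zero_iff) blast

lemma \<sigma>_in_U: "y \<in> topspace S \<Longrightarrow> \<sigma> i y \<noteq> 0 \<Longrightarrow> y \<in> U i"
  using U_Z[of i] \<rho>_Z[of y i] \<sigma>_zero[of i y] by blast

lemma \<sigma>_exists:
  assumes "y \<in> topspace S" shows "\<exists>i. \<sigma> i y > 0"
proof (rule ccontr)
  assume "\<not> ?thesis"
  then have "\<sigma> i y = 0" for i using \<sigma>_nonneg[of i y] by (metis less_eq_real_def)
  moreover obtain j where "y \<in> W j" using assms W_cover by blast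
  ultimately show False using \<sigma>_sum[of y j "Suc j"] by simp
qed

text \<open>The slot l = n holds \<open>\<sigma> i\<close> itself, by which the other n slots must
  be divided to recover the coordinates. Outside \<open>U i\<close> the values of
  \<open>\<phi> i\<close> are arbitrary and are replaced by 0.\<close>

definition \<Psi> :: "nat \<Rightarrow> nat \<Rightarrow> 'a \<Rightarrow> real" where
  "\<Psi> i l y = (if l < n then (if y \<in> U i then \<sigma> i y * \<phi> i y l else 0) else \<sigma> i y)"

lemma \<Psi>_C: "\<Psi> i l \<in> C"
proof (cases "l < n")
  case True
  show ?thesis
  proof (rule C_local)
    fix x assume x: "x \<in> topspace S"
    show "\<exists>V g. openin S V \<and> x \<in> V \<and> g \<in> C \<and> (\<forall>y\<in>V. g y = \<Psi> i l y)"
    proof (cases "x \<in> U i")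
      case xU: True
      obtain V g where "openin S V" "x \<in> V" "V \<subseteq> U i" "g \<in> C" "\<forall>y\<in>V. g y = \<phi> i y l"
        using \<phi>_coord[OF xU, of l] by (elim exE conjE)
      then show ?thesis using True
        by (intro exI[of _ V] exI[of _ "\<lambda>y. \<sigma> i y * g y"]) (auto simp: \<Psi>_def intro: C_mult \<sigma>_C)
    next
      case False
      \<comment> \<open>Outside \<open>U i\<close> the open set \<open>Z i\<close> is a
        neighbourhood on which \<open>\<sigma> i\<close>, and with it the product, is zero.\<close>
      then have "x \<in> Z i" using x U_Z by blast
      moreover have "0 = \<Psi> i l y" if "y \<in> Z i" for y
        using \<sigma>_zero[OF \<rho>_Z[OF that]] by (simp add: \<Psi>_def)
      ultimately show ?thesis
        using Z_open[of i] C_const[of 0] by (intro exI[of _ "Z i"] exI[of _ "\<lambda>_. 0"]) simp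
    qed
  qed
next
  case False
  then have "\<Psi> i l = \<sigma> i" by (simp add: \<Psi>_def[abs_def])
  then show ?thesis by (simp add: \<sigma>_C)
qed

lemma \<Psi>_zero: "\<sigma> i y = 0 \<Longrightarrow> \<Psi> i l y = 0"
  by (simp add: \<Psi>_def)

text \<open>Listing the \<open>\<Psi> i l\<close> in consecutive blocks of length
  \<open>Suc n\<close> turns them into one sequence, as the successive choice of coefficients
  requires, and preserves local finiteness.\<close>

definition \<Phi> :: "nat \<Rightarrow> 'a \<Rightarrow> real" where
  "\<Phi> k = \<Psi> (k div Suc n) (k mod Suc n)"

lemma \<Phi>_C: "\<Phi> k \<in> C"
  by (simp add: \<Phi>_def \<Psi>_C)

lemma \<Phi>_index: "l \<le> n \<Longrightarrow> \<Phi> (i * Suc n + l) = \<Psi> i l"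
proof -
  assume "l \<le> n"
  then have l: "l < Suc n" by simp
  have "(i * Suc n + l) div Suc n = i" using div_mult_self3[of "Suc n" i l] l
    by (simp del: mult_Suc_right mult_Suc)
  moreover have "(i * Suc n + l) mod Suc n = l" using l by (simp del: mult_Suc_right mult_Suc)
  ultimately show ?thesis by (simp only: \<Phi>_def)
qed

lemma \<Phi>_zero: "y \<in> W j \<Longrightarrow> Suc j * Suc n \<le> k \<Longrightarrow> \<Phi> k y = 0"
proof -
  assume y: "y \<in> W j" and k: "Suc j * Suc n \<le> k"
  have "Suc j \<le> k div Suc n" using div_le_mono[OF k, of "Suc n"] by (simp only: nonzero_mult_div_cancel_right)
  then show ?thesis unfolding \<Phi>_def by (intro \<Psi>_zero \<sigma>_zero_W[OF y]) simp
qed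

lemma \<Phi>_bounded: "\<exists>M\<ge>0. \<forall>y\<in>topspace S. \<bar>\<Phi> k y\<bar> \<le> M"
proof (rule compact_support_bounded[OF \<Phi>_C K_compact[of "k div Suc n"]])
  show "\<Phi> k y = 0" if "y \<in> topspace S - K (k div Suc n)" for y
    unfolding \<Phi>_def using that by (intro \<Psi>_zero \<sigma>_zero \<rho>_K) blast+
qed

text \<open>Take i with \<open>\<sigma> i x > 0\<close>. The slot n shows that
  \<open>\<sigma> i\<close> has the same value at y, so y lies in the same chart domain; dividing
  the other slots by this value gives equal coordinates.\<close>

lemma \<Phi>_separates:
  assumes x: "x \<in> topspace S" and y: "y \<in> topspace S" and eq: "\<And>k. \<Phi> k x = \<Phi> k y"
  shows "x = y"
proof -
  obtain i where i: "\<sigma> i x > 0" using \<sigma>_exists[OF x] by blast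
  have eq': "\<Psi> i l x = \<Psi> i l y" if "l \<le> n" for l using eq[of "i * Suc n + l"] \<Phi>_index[OF that, of i] by simp
  have s: "\<sigma> i y = \<sigma> i x" using eq'[of n] by (simp add: \<Psi>_def)
  have xU: "x \<in> U i" and yU: "y \<in> U i" using \<sigma>_in_U[OF x, of i] \<sigma>_in_U[OF y, of i] i s by simp_all
  have "\<phi> i x = \<phi> i y"
  proof (rule ext)
    fix l show "\<phi> i x l = \<phi> i y l"
    proof (cases "l < n")
      case True
      then show ?thesis using eq'[of l] i s xU yU by (simp add: \<Psi>_def)
    next
      case False
      then show ?thesis using chart_points[OF xU] chart_points[OF yU] by (simp add: topspace_Euclidean_space)
    qed
  qed
  then show ?thesis using \<phi>_inj xU yU by (simp add: inj_on_def)
qed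

text \<open>Sums over the support stand in for infinite series; this turns them into sums of any
  sufficiently large fixed length.\<close>

lemma support_bounded:
  fixes N :: nat
  assumes "\<And>k. k \<ge> N \<Longrightarrow> g k = (0::real)"
  shows "(\<Sum>k | g k \<noteq> 0. g k) = (\<Sum>k<N. g k)"
proof (rule sum.mono_neutral_left)
  show "{k. g k \<noteq> 0} \<subseteq> {..<N}"
  proof
    fix k assume "k \<in> {k. g k \<noteq> 0}"
    then have "\<not> N \<le> k" using assms[of k] by blast
    then show "k \<in> {..<N}" by simp
  qed
  show "\<forall>k\<in>{..<N} - {k. g k \<noteq> 0}. g k = 0" by blast
qed (rule finite_lessThan)

text \<open>The function \<open>R\<close> is proper: it is at least \<open>N\<close> where \<open>\<sigma> 0, \<dots>, \<sigma> (N - 1)\<close> vanish.\<close>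

definition R :: "'a \<Rightarrow> real" where
  "R y = (\<Sum>i | real i * \<sigma> i y \<noteq> 0. real i * \<sigma> i y)"

lemma R_eq: "y \<in> W j \<Longrightarrow> Suc j \<le> N \<Longrightarrow> R y = (\<Sum>i<N. real i * \<sigma> i y)"
  unfolding R_def by (rule support_bounded) (simp add: \<sigma>_zero_W)

lemma R_C: "R \<in> C"
proof (rule C_local)
  fix x assume "x \<in> topspace S"
  then obtain j where "x \<in> W j" using W_cover by blast
  moreover have "(\<lambda>y. \<Sum>i<Suc j. real i * \<sigma> i y) \<in> C" by (intro C_sum C_mult C_const \<sigma>_C)
  moreover have "\<forall>y\<in>W j. (\<Sum>i<Suc j. real i * \<sigma> i y) = R y" using R_eq[of _ j "Suc j"] by simp
  ultimately show "\<exists>V g. openin S V \<and> x \<in> V \<and> g \<in> C \<and> (\<forall>y\<in>V. g y = R y)"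
    using W_open[of j] by (intro exI[of _ "W j"] exI[of _ "\<lambda>y. \<Sum>i<Suc j. real i * \<sigma> i y"] conjI)
qed

lemma R_proper:
  assumes y: "y \<in> topspace S" and "y \<notin> (\<Union>i<N. K i)"
  shows "real N \<le> R y"
proof -
  obtain j where j: "y \<in> W j" using y W_cover by blast
  \<comment> \<open>The weights \<open>\<sigma> i y\<close> add up to 1 and those with i < N vanish,
    so \<open>R y\<close> is a mean of numbers that are at least N.\<close>
  have "real N = (\<Sum>i<Suc j. real N * \<sigma> i y)" using \<sigma>_sum[OF j, of "Suc j"] by (simp flip: sum_distrib_left)
  also have "\<dots> \<le> (\<Sum>i<Suc j. real i * \<sigma> i y)"
  proof (rule sum_mono)
    fix i
    show "real N * \<sigma> i y \<le> real i * \<sigma> i y"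
    proof (cases "i < N")
      case True
      then have "\<sigma> i y = 0" using assms by (intro \<sigma>_zero \<rho>_K) blast+
      then show ?thesis by simp
    next
      case False
      then show ?thesis using \<sigma>_nonneg[of i y] by (intro mult_right_mono) simp_all
    qed
  qed
  also have "\<dots> = R y" using R_eq[OF j, of "Suc j"] by simp
  finally show ?thesis .
qed

text \<open>\<open>G\<close> and \<open>B\<close> are chosen extensions of the
  \<open>\<Phi> k\<close> and of \<open>R\<close> through one chart. The last clause concerns all
  vectors of R^n at a chart point, so it is a property of the extensions and not only of the
  functions on S.\<close>

definition adapted :: "'a set \<Rightarrow> nat \<Rightarrow> (nat \<Rightarrow> (nat \<Rightarrow> real) \<Rightarrow> real) \<Rightarrow> ((nat \<Rightarrow> real) \<Rightarrow> real) \<Rightarrow> nat \<Rightarrow> bool" where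
  "adapted V i G B N \<longleftrightarrow> openin S V \<and> V \<subseteq> U i \<and> (\<forall>k. smooth (G k)) \<and> smooth B \<and>
    (\<forall>k. \<forall>y\<in>V. \<Phi> k y = G k (\<phi> i y)) \<and> (\<forall>k\<ge>N. G k = (\<lambda>_. 0)) \<and> (\<forall>y\<in>V. R y = B (\<phi> i y)) \<and>
    (\<forall>y\<in>V. \<forall>v. (\<forall>k. (\<Sum>l<n. pd l (G k) (\<phi> i y) * v l) = 0) \<longrightarrow> (\<forall>l<n. v l = 0))"

text \<open>The extensions in block i are not arbitrary: with \<open>Hs\<close> extending
  \<open>\<sigma> i\<close> they are \<open>Hs\<close> and the products of \<open>Hs\<close> with
  the coordinates. A vector killed by the derivatives of all these is zero where \<open>Hs\<close>
  is nonzero. For the other indices below N any extension will do.\<close>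

lemma adapted_exists:
  assumes x: "x \<in> topspace S"
  shows "\<exists>V i G B N. x \<in> V \<and> adapted V i G B N"
proof -
  obtain j where j: "x \<in> W j" using x W_cover by blast
  obtain i where i: "\<sigma> i x > 0" using \<sigma>_exists[OF x] by blast
  have xU: "x \<in> U i" using \<sigma>_in_U[OF x, of i] i by simp
  \<comment> \<open>This places block i below N, so that setting \<open>G k\<close> to 0 from N on
    does not destroy it.\<close>
  have ij: "i \<le> j" using \<sigma>_zero_W[OF j, of i] i by (metis less_irrefl not_le)
  define N where "N = Suc j * Suc n"
  obtain Vs Hs where s: "openin S Vs" "x \<in> Vs" "smooth Hs" "\<forall>y\<in>Vs. \<sigma> i y = Hs (\<phi> i y)"
    using chart_factor[OF \<sigma>_C[of i] xU] by (elim exE conjE)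
  obtain VR B where B: "openin S VR" "x \<in> VR" "smooth B" "\<forall>y\<in>VR. R y = B (\<phi> i y)"
    using chart_factor[OF R_C xU] by (elim exE conjE)
  have "\<forall>k. \<exists>VH. openin S (fst VH) \<and> x \<in> fst VH \<and> smooth (snd VH) \<and> (\<forall>y\<in>fst VH. \<Phi> k y = snd VH (\<phi> i y))"
  proof
    fix k
    obtain V H where "openin S V" "x \<in> V" "smooth H" "\<forall>y\<in>V. \<Phi> k y = H (\<phi> i y)"
      using chart_factor[OF \<Phi>_C[of k] xU] by (elim exE conjE)
    then show "\<exists>VH. openin S (fst VH) \<and> x \<in> fst VH \<and> smooth (snd VH) \<and> (\<forall>y\<in>fst VH. \<Phi> k y = snd VH (\<phi> i y))"
      by (intro exI[of _ "(V, H)"]) simp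
  qed
  from choice[OF this] obtain VH where VH: "\<forall>k. openin S (fst (VH k)) \<and> x \<in> fst (VH k) \<and> smooth (snd (VH k)) \<and>
      (\<forall>y\<in>fst (VH k). \<Phi> k y = snd (VH k) (\<phi> i y))" by (rule exE)
  define G where "G k = (if k div Suc n = i then (if k mod Suc n < n then (\<lambda>z. Hs z * z (k mod Suc n)) else Hs)
      else if k < N then snd (VH k) else (\<lambda>_. 0))" for k
  define VI where "VI = topspace S \<inter> (\<Inter>k\<in>{..<N}. fst (VH k))"
  define V where "V = U i \<inter> W j \<inter> {y \<in> topspace S. 0 < \<sigma> i y} \<inter> Vs \<inter> VR \<inter> VI"
  have oV: "openin S V"
  proof -
    have "openin S VI"
      unfolding VI_def by (rule openin_Int_Inter[of "(\<lambda>k. fst (VH k)) ` {..<N}"]) (use VH in auto)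
    then show ?thesis unfolding V_def
      by (intro openin_Int U_open W_open C_open_greater \<sigma>_C s(1) B(1))
  qed
  have xV: "x \<in> V" using x xU j i s(2) B(2) VH by (simp add: V_def VI_def)
  have V: "y \<in> U i" "y \<in> W j" "0 < \<sigma> i y" "y \<in> Vs" "y \<in> VR" "\<And>k. k < N \<Longrightarrow> y \<in> fst (VH k)" if "y \<in> V" for y
    using that by (simp_all add: V_def VI_def)
  have G_smooth: "smooth (G k)" for k
    unfolding G_def using s(3) VH smooth_const smooth_mult[OF s(3) smooth_coord] by simp
  have G_zero: "G k = (\<lambda>_. 0)" if "N \<le> k" for k
  proof -
    have "Suc j \<le> k div Suc n" using div_le_mono[OF that, of "Suc n"]
      unfolding N_def by (simp only: nonzero_mult_div_cancel_right)
    then show ?thesis using ij that by (simp add: G_def)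
  qed
  have G_eq: "\<Phi> k y = G k (\<phi> i y)" if y: "y \<in> V" for k y
  proof (cases "k div Suc n = i")
    case True
    then show ?thesis using V[OF y] s(4) by (simp add: \<Phi>_def \<Psi>_def G_def)
  next
    case False
    show ?thesis
    proof (cases "k < N")
      case True
      then show ?thesis using False VH V(6)[OF y True] by (simp add: G_def)
    next
      case kN: False
      then have "\<Phi> k y = 0" using \<Phi>_zero[OF V(2)[OF y], of k] by (simp only: N_def not_less)
      then show ?thesis using False kN by (simp add: G_def)
    qed
  qed
  have imm: "\<forall>l<n. v l = 0" if y: "y \<in> V" and v: "\<And>k. (\<Sum>l<n. pd l (G k) (\<phi> i y) * v l) = 0" for y v
  proof (intro allI impI)
    fix l assume l: "l < n"
    let ?p = "\<phi> i y"
    have idx: "(i * Suc n + t) div Suc n = i \<and> (i * Suc n + t) mod Suc n = t" if "t \<le> n" for t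
    proof
      have t: "t < Suc n" using that by simp
      show "(i * Suc n + t) div Suc n = i" using div_mult_self3[of "Suc n" i t] t
        by (simp del: mult_Suc_right mult_Suc)
      show "(i * Suc n + t) mod Suc n = t" using t by (simp del: mult_Suc_right mult_Suc)
    qed
    have "G (i * Suc n + n) = Hs" using idx[of n] by (simp only: G_def) simp
    then have h0: "(\<Sum>t<n. pd t Hs ?p * v t) = 0" using v[of "i * Suc n + n"] by simp
    have "G (i * Suc n + l) = (\<lambda>z. Hs z * z l)" using idx[of l] l by (simp only: G_def) simp
    then have h1: "(\<Sum>t<n. pd t (\<lambda>z. Hs z * z l) ?p * v t) = 0" using v[of "i * Suc n + l"] by simp
    \<comment> \<open>Product rule: in direction v the derivative of \<open>Hs z * z l\<close> is
      \<open>z l\<close> times that of \<open>Hs\<close>, which is zero by \<open>h0\<close>, plus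
      \<open>Hs z * v l\<close>.\<close>
    have pdl: "pd t (\<lambda>z. Hs z * z l) ?p = ?p l * pd t Hs ?p + Hs ?p * (if t = l then 1 else 0)" for t
    proof (rule pd_eqI)
      show "((\<lambda>u. Hs (?p(t := u)) * (?p(t := u)) l) has_real_derivative
          ?p l * pd t Hs ?p + Hs ?p * (if t = l then 1 else 0)) (at (?p t))"
        using DERIV_mult[OF smooth_deriv[OF s(3), of ?p t] DERIV_coord_upd[of ?p t l]]
        by (simp only: fun_upd_triv) (simp only: mult.commute add.commute)
    qed
    have "(\<Sum>t<n. pd t (\<lambda>z. Hs z * z l) ?p * v t) =
        (\<Sum>t<n. ?p l * (pd t Hs ?p * v t) + (if t = l then Hs ?p * v t else 0))"
    proof (rule sum.cong[OF refl])
      fix t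
      show "pd t (\<lambda>z. Hs z * z l) ?p * v t = ?p l * (pd t Hs ?p * v t) + (if t = l then Hs ?p * v t else 0)"
        unfolding pdl by (cases "t = l") (simp_all add: algebra_simps)
    qed
    also have "\<dots> = ?p l * (\<Sum>t<n. pd t Hs ?p * v t) + (\<Sum>t<n. if t = l then Hs ?p * v t else 0)"
      by (simp only: sum.distrib sum_distrib_left)
    also have "\<dots> = Hs ?p * v l" using l by (simp add: h0)
    finally have "Hs ?p * v l = 0" using h1 by simp
    moreover have "Hs ?p \<noteq> 0" using V(3,4)[OF y] s(4) by auto
    ultimately show "v l = 0" by simp
  qed
  have "adapted V i G B N"
    unfolding adapted_def
  proof (intro conjI allI ballI impI)
    show "V \<subseteq> U i" using V(1) by blast
    show "R y = B (\<phi> i y)" if "y \<in> V" for y using B(4) V(5)[OF that] by blast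
    show "v l = 0" if "y \<in> V" "\<forall>k. (\<Sum>l<n. pd l (G k) (\<phi> i y) * v l) = 0" "l < n" for y v l
      using imm[OF that(1), of v] that(2,3) by blast
  qed (fact oV G_smooth B(3) G_zero | rule G_eq G_zero, assumption)+
  with xV show ?thesis by blast
qed

end

section \<open>From suitable coefficients to the embedding\<close>

lemma pd_zero: "pd l (\<lambda>_. 0) x = 0"
  by (rule pd_eqI) simp

lemma pd_linear:
  assumes "smooth B" "\<And>k. smooth (G k)"
  shows "pd l (\<lambda>z. b * B z + (\<Sum>k<N. a k * G k z)) x = b * pd l B x + (\<Sum>k<N. a k * pd l (G k) x)"
proof (rule pd_eqI)
  show "((\<lambda>t. b * B (x(l := t)) + (\<Sum>k<N. a k * G k (x(l := t)))) has_real_derivative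
      b * pd l B x + (\<Sum>k<N. a k * pd l (G k) x)) (at (x l))"
    by (rule DERIV_add[OF DERIV_cmult[OF smooth_deriv[OF assms(1)]] DERIV_sum[OF DERIV_cmult[OF smooth_deriv[OF assms(2)]]]])
qed

text \<open>The conditions on \<open>a\<close> are stated for every cut-off M because the number of
  nonzero terms depends on the points or the chart. The bounds in \<open>a_small\<close> add up to
  less than 1, which keeps \<open>f 0\<close> within distance 1 of \<open>R\<close>.\<close>

locale embedding_data = chart_sequence S C n U W Z K \<phi> \<rho>
  for S :: "'a topology" and C :: "('a \<Rightarrow> real) set" and n U W Z K \<phi> \<rho> +
  fixes V :: "nat \<Rightarrow> 'a set" and c :: "nat \<Rightarrow> nat" and G :: "nat \<Rightarrow> nat \<Rightarrow> (nat \<Rightarrow> real) \<Rightarrow> real"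
    and B :: "nat \<Rightarrow> (nat \<Rightarrow> real) \<Rightarrow> real" and N :: "nat \<Rightarrow> nat" and a :: "nat \<Rightarrow> nat \<Rightarrow> real" and m :: nat
  assumes adapted: "adapted (V s) (c s) (G s) (B s) (N s)"
    and V_cover: "topspace S = (\<Union>s. V s)"
    and m_pos: "0 < m"
    and a_small: "y \<in> topspace S \<Longrightarrow> \<bar>a k r * \<Phi> k y\<bar> \<le> (1 / 2) ^ Suc k"
    and a_injective: "y \<in> topspace S \<Longrightarrow> z \<in> topspace S \<Longrightarrow> \<exists>k<M. \<Phi> k y \<noteq> \<Phi> k z \<Longrightarrow>
      \<exists>r<m. (if r = 0 then 1 else 0) * (R y - R z) + (\<Sum>k<M. a k r * (\<Phi> k y - \<Phi> k z)) \<noteq> 0"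
    and a_immersive: "y \<in> V s \<Longrightarrow> \<exists>k<M. (\<Sum>l<n. pd l (G s k) (\<phi> (c s) y) * v l) \<noteq> 0 \<Longrightarrow>
      \<exists>r<m. (if r = 0 then 1 else 0) * (\<Sum>l<n. pd l (B s) (\<phi> (c s) y) * v l) +
        (\<Sum>k<M. a k r * (\<Sum>l<n. pd l (G s k) (\<phi> (c s) y) * v l)) \<noteq> 0"
begin

lemma V_open: "openin S (V s)" and V_subset: "V s \<subseteq> U (c s)" and G_smooth: "smooth (G s k)" and B_smooth: "smooth (B s)"
  and \<Phi>_G: "y \<in> V s \<Longrightarrow> \<Phi> k y = G s k (\<phi> (c s) y)" and G_zero: "k \<ge> N s \<Longrightarrow> G s k = (\<lambda>_. 0)"
  and R_B: "y \<in> V s \<Longrightarrow> R y = B s (\<phi> (c s) y)"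
  using adapted[of s] unfolding adapted_def by simp_all

lemma G_immersive:
  assumes "y \<in> V s" "\<And>k. (\<Sum>l<n. pd l (G s k) (\<phi> (c s) y) * v l) = 0" "l < n"
  shows "v l = 0"
  using adapted[of s] assms unfolding adapted_def by simp

definition f :: "nat \<Rightarrow> 'a \<Rightarrow> real" where
  "f r y = (if r = 0 then 1 else 0) * R y + (\<Sum>k | a k r * \<Phi> k y \<noteq> 0. a k r * \<Phi> k y)"

definition F :: "'a \<Rightarrow> nat \<Rightarrow> real" where
  "F y = (\<lambda>r. if r < m then f r y else 0)"

lemma f_eq:
  assumes "\<And>k. k \<ge> M \<Longrightarrow> \<Phi> k y = 0"
  shows "f r y = (if r = 0 then 1 else 0) * R y + (\<Sum>k<M. a k r * \<Phi> k y)"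
  unfolding f_def using support_bounded[of M "\<lambda>k. a k r * \<Phi> k y"] assms by simp

lemma \<Phi>_eventually_zero:
  assumes "y \<in> topspace S" shows "\<exists>M. \<forall>k\<ge>M. \<Phi> k y = 0"
proof -
  obtain j where "y \<in> W j" using assms W_cover by blast
  then show ?thesis using \<Phi>_zero by blast
qed

lemma f_C: "f r \<in> C"
proof (rule C_local)
  fix x assume "x \<in> topspace S"
  then obtain j where "x \<in> W j" using W_cover by blast
  let ?g = "\<lambda>y. (if r = 0 then 1 else 0) * R y + (\<Sum>k<Suc j * Suc n. a k r * \<Phi> k y)"
  have "?g \<in> C" by (intro C_add C_mult C_const R_C C_sum \<Phi>_C)
  moreover have "\<forall>y\<in>W j. ?g y = f r y"
    by (intro ballI f_eq[symmetric] \<Phi>_zero)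
  ultimately show "\<exists>V g. openin S V \<and> x \<in> V \<and> g \<in> C \<and> (\<forall>y\<in>V. g y = f r y)"
    using W_open[of j] \<open>x \<in> W j\<close> by (intro exI[of _ "W j"] exI[of _ ?g] conjI)
qed

lemma f_near_R:
  assumes y: "y \<in> topspace S" shows "\<bar>f 0 y - R y\<bar> \<le> 1"
proof -
  obtain M where M: "\<forall>k\<ge>M. \<Phi> k y = 0" using \<Phi>_eventually_zero[OF y] by blast
  have "\<bar>f 0 y - R y\<bar> = \<bar>\<Sum>k<M. a k 0 * \<Phi> k y\<bar>" using f_eq[of M y 0] M by simp
  also have "\<dots> \<le> (\<Sum>k<M. (1 / 2) ^ Suc k)"
    by (rule order_trans[OF sum_abs sum_mono]) (rule a_small[OF y])
  also have "\<dots> = 1 - (1 / 2) ^ M" by (induction M) (simp_all add: field_simps)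
  also have "\<dots> \<le> (1::real)" by simp
  finally show ?thesis .
qed

lemma F_inj: "inj_on F (topspace S)"
proof (rule inj_onI, rule ccontr)
  fix y z assume y: "y \<in> topspace S" and z: "z \<in> topspace S" and eq: "F y = F z" and ne: "y \<noteq> z"
  obtain k where k: "\<Phi> k y \<noteq> \<Phi> k z" using \<Phi>_separates[OF y z] ne by blast
  obtain M1 where M1: "\<forall>k\<ge>M1. \<Phi> k y = 0" using \<Phi>_eventually_zero[OF y] by blast
  obtain M2 where M2: "\<forall>k\<ge>M2. \<Phi> k z = 0" using \<Phi>_eventually_zero[OF z] by blast
  \<comment> \<open>M exceeds k, so that a separating term is counted, and both supports, so that
    the sums of length M compute F at y and at z.\<close>
  define M where "M = max (Suc k) (max M1 M2)"
  have "\<exists>k<M. \<Phi> k y \<noteq> \<Phi> k z" using k by (intro exI[of _ k]) (simp add: M_def)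
  from a_injective[OF y z this] obtain r where r: "r < m"
    "(if r = 0 then 1 else 0) * (R y - R z) + (\<Sum>k<M. a k r * (\<Phi> k y - \<Phi> k z)) \<noteq> 0" by blast
  have "f r y - f r z = (if r = 0 then 1 else 0) * (R y - R z) + (\<Sum>k<M. a k r * (\<Phi> k y - \<Phi> k z))"
    using f_eq[of M y r] f_eq[of M z r] M1 M2
    by (simp add: M_def right_diff_distrib sum_subtractf)
  moreover have "f r y = f r z" using fun_cong[OF eq, of r] r(1) by (simp add: F_def)
  ultimately show False using r(2) by simp
qed

lemma F_in: "F y \<in> topspace (Euclidean_space m)"
  by (simp add: F_def topspace_Euclidean_space)

lemma F_continuous: "continuous_map S euclidean F"
proof -
  have "continuous_map S euclideanreal (\<lambda>y. F y r)" for r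
    using C_continuous[OF f_C[of r]] by (cases "r < m") (simp_all add: F_def)
  then have "continuous_map S (powertop_real UNIV) F"
    by (simp add: continuous_map_componentwise_UNIV)
  then show ?thesis by (simp only: euclidean_product_topology)
qed

text \<open>This is where properness enters. If \<open>F y\<close> is close to \<open>F x\<close> in
  coordinate 0, then \<open>R y\<close> is bounded and y lies in a finite union L of the compact
  sets \<open>K j\<close>. The part of L outside T is compact, so its image is closed, and by
  injectivity it misses \<open>F x\<close>.\<close>

lemma F_open:
  assumes T: "openin S T" and x: "x \<in> T"
  shows "\<exists>Q. open Q \<and> F x \<in> Q \<and> (\<forall>y\<in>topspace S. F y \<in> Q \<longrightarrow> y \<in> T)"
proof -
  have xS: "x \<in> topspace S" using T x openin_subset by blast
  \<comment> \<open>One unit for the neighbourhood Q, and one each for the distance between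
    \<open>f 0\<close> and \<open>R\<close> at x and at y.\<close>
  obtain J where J: "R x + 3 < real J" using reals_Archimedean2 by blast
  define L where "L = (\<Union>j<J. K j)"
  have L: "compactin S L" unfolding L_def
    by (rule compactin_Union) (use K_compact in auto)
  have "compactin S (L \<inter> (topspace S - T))"
    by (rule compact_Int_closedin[OF L]) (simp add: closedin_def T Diff_Diff_Int inf.absorb2 openin_subset)
  then have "compactin euclidean (F ` (L \<inter> (topspace S - T)))"
    by (rule image_compactin[OF _ F_continuous])
  then have cl: "closed (F ` (L \<inter> (topspace S - T)))" by (simp add: compact_imp_closed)
  define Q where "Q = - (F ` (L \<inter> (topspace S - T))) \<inter> {z. z 0 < F x 0 + 1}"
  have "open Q" unfolding Q_def
    by (intro open_Int open_Compl cl open_Collect_less continuous_on_coord continuous_on_const)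
  moreover have "F x \<notin> F ` (L \<inter> (topspace S - T))"
    using F_inj xS x by (auto simp: inj_on_def)
  then have "F x \<in> Q" by (simp add: Q_def)
  moreover have "y \<in> T" if y: "y \<in> topspace S" and yQ: "F y \<in> Q" for y
  proof (rule ccontr)
    assume "y \<notin> T"
    then have "y \<notin> L" using yQ y by (auto simp: Q_def)
    then have "real J \<le> R y" using R_proper[OF y, of J] by (simp add: L_def)
    moreover have "F y 0 < F x 0 + 1" using yQ by (simp add: Q_def)
    then have "f 0 y < f 0 x + 1" using m_pos by (simp add: F_def)
    ultimately show False using f_near_R[OF y] f_near_R[OF xS] J by linarith
  qed
  ultimately show ?thesis by blast
qed

text \<open>Extension of the components of F from the chart image to all sequences. The coefficients
  are the same in every chart; only the extensions of \<open>R\<close> and \<open>\<Phi> k\<close>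
  depend on s.\<close>

definition Fs :: "nat \<Rightarrow> nat \<Rightarrow> (nat \<Rightarrow> real) \<Rightarrow> real" where
  "Fs s r z = (if r = 0 then 1 else 0) * B s z + (\<Sum>k<N s. a k r * G s k z)"

lemma Fs_smooth: "smooth (Fs s r)"
proof -
  have "smooth (\<lambda>z. a k r * G s k z)" for k by (rule smooth_mult[OF smooth_const G_smooth])
  then show ?thesis unfolding Fs_def[abs_def]
    by (rule smooth_add[OF smooth_mult[OF smooth_const B_smooth] smooth_sum])
qed

lemma F_Fs:
  assumes y: "y \<in> V s" shows "F y = (\<lambda>r. if r < m then Fs s r (\<phi> (c s) y) else 0)"
proof -
  have "\<Phi> k y = 0" if "k \<ge> N s" for k using \<Phi>_G[OF y, of k] G_zero[OF that] by simp
  then have "f r y = Fs s r (\<phi> (c s) y)" for r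
    using f_eq[of "N s" y r] by (simp add: Fs_def R_B[OF y] \<Phi>_G[OF y])
  then show ?thesis by (auto simp: F_def fun_eq_iff)
qed

text \<open>A nonzero vector is detected by the derivative of some \<open>G s k\<close>, necessarily
  with k < \<open>N s\<close>; then \<open>a_immersive\<close> provides a component of
  \<open>Fs s\<close> whose derivative detects it too.\<close>

lemma Fs_immersive:
  assumes y: "y \<in> V s" and v: "\<And>r. r < m \<Longrightarrow> (\<Sum>l<n. pd l (Fs s r) (\<phi> (c s) y) * v l) = 0"
  shows "\<forall>l<n. v l = 0"
proof (rule ccontr)
  let ?p = "\<phi> (c s) y"
  assume "\<not> ?thesis"
  then obtain l where "l < n" "v l \<noteq> 0" by blast
  then obtain k where k: "(\<Sum>l<n. pd l (G s k) ?p * v l) \<noteq> 0" using G_immersive[OF y, of v l] by blast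
  have "k < N s"
  proof (rule ccontr)
    assume "\<not> k < N s"
    then have "G s k = (\<lambda>_. 0)" using G_zero[of s k] by simp
    then show False using k by (simp add: pd_zero)
  qed
  with k have "\<exists>k<N s. (\<Sum>l<n. pd l (G s k) ?p * v l) \<noteq> 0" by blast
  from a_immersive[OF y this] obtain r where r: "r < m"
    "(if r = 0 then 1 else 0) * (\<Sum>l<n. pd l (B s) ?p * v l) + (\<Sum>k<N s. a k r * (\<Sum>l<n. pd l (G s k) ?p * v l)) \<noteq> 0"
    by blast
  have "(\<Sum>l<n. pd l (Fs s r) ?p * v l) =
      (\<Sum>l<n. ((if r = 0 then 1 else 0) * pd l (B s) ?p + (\<Sum>k<N s. a k r * pd l (G s k) ?p)) * v l)"
    unfolding Fs_def[abs_def] by (simp only: pd_linear[OF B_smooth G_smooth])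
  also have "\<dots> = (if r = 0 then 1 else 0) * (\<Sum>l<n. pd l (B s) ?p * v l) +
      (\<Sum>l<n. \<Sum>k<N s. a k r * (pd l (G s k) ?p * v l))"
    by (simp only: distrib_right sum.distrib sum_distrib_left sum_distrib_right mult.assoc)
  also have "(\<Sum>l<n. \<Sum>k<N s. a k r * (pd l (G s k) ?p * v l)) = (\<Sum>k<N s. a k r * (\<Sum>l<n. pd l (G s k) ?p * v l))"
    by (subst sum.swap) (simp only: sum_distrib_left)
  finally show False using v[OF r(1)] r(2) by simp
qed

text \<open>Near \<open>F x\<close>, the chart is recovered from \<open>F\<close> by a smooth left inverse of the immersion \<open>Fs s\<close>.\<close>

lemma C_factors_through_F:
  assumes g: "g \<in> C" and x: "x \<in> topspace S"
  shows "\<exists>Q H. open Q \<and> F x \<in> Q \<and> smooth H \<and> (\<forall>y\<in>topspace S. F y \<in> Q \<longrightarrow> g y = H (F y))"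
proof -
  obtain s where xV: "x \<in> V s" using x V_cover by blast
  have xU: "x \<in> U (c s)" using xV V_subset by blast
  obtain T H0 where T: "openin S T" "x \<in> T" "T \<subseteq> U (c s)" "smooth H0" "\<forall>y\<in>T. g y = H0 (\<phi> (c s) y)"
    using chart_factor[OF g xU] by (elim exE conjE)
  have "\<exists>H O'. (\<forall>l. smooth (H l)) \<and> open O' \<and> \<phi> (c s) x \<in> O' \<and>
    (\<forall>z\<in>O'. z \<in> topspace (Euclidean_space n) \<longrightarrow> (\<forall>l. H l (\<lambda>r. if r < m then Fs s r z else 0) = z l))"
    by (rule immersion_left_inverse[where F = "Fs s" and m = m and n = n and p = "\<phi> (c s) x", OF Fs_smooth])
      (rule Fs_immersive[OF xV], assumption, blast)
  then obtain H O' where H: "\<forall>l. smooth (H l)" "open O'" "\<phi> (c s) x \<in> O'"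
    "\<forall>z\<in>O'. z \<in> topspace (Euclidean_space n) \<longrightarrow> (\<forall>l. H l (\<lambda>r. if r < m then Fs s r z else 0) = z l)"
    by (elim exE conjE)
  \<comment> \<open>All three local facts hold on this set: g factors through the chart, F agrees
    with its extension, and the left inverse is valid. \<open>F_open\<close> translates it into a
    condition on \<open>F y\<close> alone.\<close>
  define T' where "T' = T \<inter> V s \<inter> {y \<in> U (c s). \<phi> (c s) y \<in> O'}"
  have "openin S T'" unfolding T'_def by (intro openin_Int T(1) V_open \<phi>_open H(2))
  moreover have "x \<in> T'" using T(2) xV xU H(3) by (simp add: T'_def)
  ultimately obtain Q where Q: "open Q" "F x \<in> Q" "\<forall>y\<in>topspace S. F y \<in> Q \<longrightarrow> y \<in> T'"
    using F_open by blast
  define HH where "HH z = H0 (\<lambda>l. if l < n then H l z else 0)" for z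
  have "smooth HH" unfolding HH_def[abs_def] using H(1) by (intro smooth_compose_finite T(4)) simp
  moreover have "g y = HH (F y)" if "y \<in> topspace S" "F y \<in> Q" for y
  proof -
    have y: "y \<in> T" "y \<in> V s" "y \<in> U (c s)" "\<phi> (c s) y \<in> O'" using Q(3) that by (auto simp: T'_def)
    have pE: "\<phi> (c s) y \<in> topspace (Euclidean_space n)" using chart_points[OF y(3)] .
    have "H l (F y) = \<phi> (c s) y l" for l using H(4) y(4) pE by (simp only: F_Fs[OF y(2)])
    then have "(\<lambda>l. if l < n then H l (F y) else 0) = \<phi> (c s) y"
      using pE by (auto simp: topspace_Euclidean_space)
    then show ?thesis using T(5) y(1) by (simp add: HH_def)
  qed
  ultimately show ?thesis using Q(1,2) by blast
qed

text \<open>Smoothness of F needs only that its components lie in C. Smoothness of the inverse is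
  the local factorization of functions of C through F.\<close>

lemma embeds: "diffeomorphic_to_subset_of_Euclidean S C m"
proof -
  define A where "A = F ` topspace S"
  define \<psi> where "\<psi> = inv_into (topspace S) F"
  have A: "A \<subseteq> topspace (Euclidean_space m)" using F_in by (auto simp: A_def)
  have tA: "topspace (subtopology (Euclidean_space m) A) = A" using A by auto
  have \<psi>F: "\<psi> (F y) = y" if "y \<in> topspace S" for y
    unfolding \<psi>_def by (rule inv_into_f_f[OF F_inj that])
  have "continuous_map S (powertop_real UNIV) F" using F_continuous by (simp only: euclidean_product_topology)
  then have contE: "continuous_map S (Euclidean_space m) F"
    unfolding Euclidean_space_def continuous_map_in_subtopology using F_in by (auto simp: topspace_Euclidean_space)
  then have cont: "continuous_map S (subtopology (Euclidean_space m) A) F"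
    unfolding continuous_map_in_subtopology by (auto simp: A_def)
  have "smooth_map S C (subtopology (Euclidean_space m) A) (restricted_structure (Euclidean_space m) (C_infinity m) A) F"
    unfolding smooth_map_def tA
  proof (intro conjI ballI)
    show "F \<in> topspace S \<rightarrow> A" by (simp add: A_def)
    fix h assume h: "h \<in> restricted_structure (Euclidean_space m) (C_infinity m) A"
    show "h \<circ> F \<in> C"
    proof (rule C_local)
      fix x assume x: "x \<in> topspace S"
      then have "F x \<in> A" by (simp add: A_def)
      from restricted_structureD[OF h this] obtain T H where T: "openin (subtopology (Euclidean_space m) A) T" "F x \<in> T"
        "H \<in> C_infinity m" "\<forall>z\<in>T. h z = H z" by (elim exE conjE)
      have "openin S {y \<in> topspace S. F y \<in> T}" by (rule openin_continuous_map_preimage[OF cont T(1)])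
      moreover have "(\<lambda>y. H (F y)) \<in> C"
        unfolding F_def by (rule C_infinity_compose[OF T(3) f_C])
      ultimately show "\<exists>T g. openin S T \<and> x \<in> T \<and> g \<in> C \<and> (\<forall>y\<in>T. g y = (h \<circ> F) y)"
        using x T(2,4) by (intro exI[of _ "{y \<in> topspace S. F y \<in> T}"] exI[of _ "\<lambda>y. H (F y)"]) simp
    qed
  qed
  moreover have "smooth_map (subtopology (Euclidean_space m) A) (restricted_structure (Euclidean_space m) (C_infinity m) A) S C \<psi>"
    unfolding smooth_map_def tA
  proof (intro conjI ballI)
    show "\<psi> \<in> A \<rightarrow> topspace S" using \<psi>F by (auto simp: A_def)
    fix g assume g: "g \<in> C"
    show "g \<circ> \<psi> \<in> restricted_structure (Euclidean_space m) (C_infinity m) A"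
      unfolding restricted_structure_def
    proof (intro CollectI ballI)
      fix z assume "z \<in> A"
      then obtain x where x: "x \<in> topspace S" "z = F x" by (auto simp: A_def)
      obtain Q H where Q: "open Q" "F x \<in> Q" "smooth H" "\<forall>y\<in>topspace S. F y \<in> Q \<longrightarrow> g y = H (F y)"
        using C_factors_through_F[OF g x(1)] by (elim exE conjE)
      have "openin (subtopology (Euclidean_space m) A) (Q \<inter> topspace (Euclidean_space m) \<inter> A)"
        by (rule openin_subtopology_Int[OF open_imp_openin_Euclidean[OF Q(1)]])
      moreover have "z \<in> Q \<inter> topspace (Euclidean_space m) \<inter> A" using x Q(2) F_in \<open>z \<in> A\<close> by simp
      moreover have "\<forall>w\<in>Q \<inter> topspace (Euclidean_space m) \<inter> A. (g \<circ> \<psi>) w = H w"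
        using Q(4) \<psi>F by (auto simp: A_def)
      ultimately show "\<exists>T h. openin (subtopology (Euclidean_space m) A) T \<and> z \<in> T \<and> h \<in> C_infinity m \<and> (\<forall>w\<in>T. (g \<circ> \<psi>) w = h w)"
        using smooth_in_C_infinity[OF Q(3)]
        by (intro exI[of _ "Q \<inter> topspace (Euclidean_space m) \<inter> A"] exI[of _ H] conjI)
    qed
  qed
  moreover have "\<forall>x\<in>topspace S. \<psi> (F x) = x" using \<psi>F by blast
  moreover have "\<forall>y\<in>topspace (subtopology (Euclidean_space m) A). F (\<psi> y) = y"
    unfolding tA using \<psi>F by (auto simp: A_def)
  ultimately have "diffeomorphic_spaces S C (subtopology (Euclidean_space m) A)
      (restricted_structure (Euclidean_space m) (C_infinity m) A)"
    unfolding diffeomorphic_spaces_def by blast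
  then show ?thesis unfolding diffeomorphic_to_subset_of_Euclidean_def using A by blast
qed

end

section \<open>Encoding in R^(2n) and choice of the coefficients\<close>

text \<open>
  Pairs of points and pairs of a point and a tangent vector are both encoded as points of R^(2n).
  \<open>two_point n g\<close> collects the linear functionals of \<open>g\<close> that have to be separated from zero:
  differences of values, and derivatives in tangent directions.
\<close>

definition second :: "nat \<Rightarrow> (nat \<Rightarrow> real) \<Rightarrow> nat \<Rightarrow> real" where
  "second n z = (\<lambda>l. if l < n then z (n + l) else 0)"

definition join :: "nat \<Rightarrow> (nat \<Rightarrow> real) \<Rightarrow> (nat \<Rightarrow> real) \<Rightarrow> nat \<Rightarrow> real" where
  "join n p q = (\<lambda>i. if i < n then p i else if i < 2 * n then q (i - n) else 0)"

definition two_point :: "nat \<Rightarrow> (nat \<Rightarrow> (nat \<Rightarrow> real) \<Rightarrow> real) \<Rightarrow> nat \<times> nat + nat \<Rightarrow> (nat \<Rightarrow> real) \<Rightarrow> real" where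
  "two_point n g I z = (case I of
      Inl (s, t) \<Rightarrow> g s (trunc n z) - g t (second n z)
    | Inr s \<Rightarrow> (\<Sum>l<n. pd l (g s) (trunc n z) * z (n + l)))"

lemma join_in: "join n p q \<in> topspace (Euclidean_space (2 * n))"
  by (simp add: join_def topspace_Euclidean_space)

lemma trunc_join: "p \<in> topspace (Euclidean_space n) \<Longrightarrow> trunc n (join n p q) = p"
  by (auto simp: trunc_def join_def topspace_Euclidean_space fun_eq_iff)

lemma second_join: "q \<in> topspace (Euclidean_space n) \<Longrightarrow> second n (join n p q) = q"
  by (auto simp: second_def join_def topspace_Euclidean_space fun_eq_iff)

lemma join_shift: "l < n \<Longrightarrow> join n p q (n + l) = q l"
  by (simp add: join_def)

lemma smooth_two_point:
  assumes "\<And>s. smooth (g s)" shows "smooth (two_point n g I)"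
proof (cases I)
  case (Inl st)
  obtain s t where st: "st = (s, t)" by (cases st)
  have "smooth (\<lambda>z. g s (trunc n z))" "smooth (\<lambda>z. g t (second n z))"
    unfolding trunc_def second_def by (rule smooth_compose_finite[OF assms smooth_coord])+
  then show ?thesis unfolding two_point_def[abs_def] Inl st sum.case prod.case by (rule smooth_diff)
next
  case (Inr s)
  have "smooth (\<lambda>z. pd l (g s) (trunc n z))" for l
    unfolding trunc_def by (rule smooth_compose_finite[OF smooth_pd[OF assms] smooth_coord])
  then have "smooth (\<lambda>z. pd l (g s) (trunc n z) * z (n + l))" for l
    by (rule smooth_mult[OF _ smooth_coord])
  then show ?thesis unfolding two_point_def[abs_def] Inr sum.case by (rule smooth_sum)
qed

lemma (in chart_sequence) embeds_in_Euclidean: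
  assumes sc: "second_countable S" and ne: "topspace S \<noteq> {}" and m: "m \<ge> 2 * n + 1"
  shows "diffeomorphic_to_subset_of_Euclidean S C m"
proof -
  have "\<forall>x\<in>topspace S. \<exists>T. x \<in> fst T \<and> adapted (fst T) (fst (snd T)) (fst (snd (snd T)))
      (fst (snd (snd (snd T)))) (snd (snd (snd (snd T))))"
  proof
    fix x assume "x \<in> topspace S"
    from adapted_exists[OF this] obtain V i G B N where "x \<in> V" "adapted V i G B N" by (elim exE conjE)
    then show "\<exists>T. x \<in> fst T \<and> adapted (fst T) (fst (snd T)) (fst (snd (snd T)))
      (fst (snd (snd (snd T)))) (snd (snd (snd (snd T))))"
      by (intro exI[of _ "(V, i, G, B, N)"]) simp
  qed
  from bchoice[OF this] obtain T where T: "\<forall>x\<in>topspace S. x \<in> fst (T x) \<and> adapted (fst (T x)) (fst (snd (T x)))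
      (fst (snd (snd (T x)))) (fst (snd (snd (snd (T x))))) (snd (snd (snd (snd (T x)))))" by (rule exE)
  have "openin S (fst (T x)) \<and> x \<in> fst (T x)" if "x \<in> topspace S" for x
    using T that unfolding adapted_def by blast
  then have "\<exists>xs :: nat \<Rightarrow> 'a. (\<forall>s. xs s \<in> topspace S) \<and> topspace S = (\<Union>s. fst (T (xs s)))"
    by (rule Lindelof_sequence[OF sc ne])
  then obtain xs :: "nat \<Rightarrow> 'a" where
    xs: "\<forall>s. xs s \<in> topspace S" "topspace S = (\<Union>s. fst (T (xs s)))" by (elim exE conjE)
  define V where "V s = fst (T (xs s))" for s
  define c where "c s = fst (snd (T (xs s)))" for s
  define G where "G s = fst (snd (snd (T (xs s))))" for s
  define B where "B s = fst (snd (snd (snd (T (xs s)))))" for s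
  define N where "N s = snd (snd (snd (snd (T (xs s)))))" for s
  have ad: "adapted (V s) (c s) (G s) (B s) (N s)" for s
    unfolding V_def c_def G_def B_def N_def using T xs(1) by blast
  have V_cov: "topspace S = (\<Union>s. V s)" using xs(2) by (simp only: V_def)
  have ad': "smooth (G s k)" "smooth (B s)" "y \<in> V s \<Longrightarrow> \<Phi> k y = G s k (\<phi> (c s) y)"
    "y \<in> V s \<Longrightarrow> R y = B s (\<phi> (c s) y)" "y \<in> V s \<Longrightarrow> \<phi> (c s) y \<in> topspace (Euclidean_space n)" for s k y
    using ad[of s] chart_points unfolding adapted_def by blast+
  have "\<forall>k. \<exists>M. M \<ge> 0 \<and> (\<forall>y\<in>topspace S. \<bar>\<Phi> k y\<bar> \<le> M)" using \<Phi>_bounded by blast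
  from choice[OF this] obtain M where M: "\<forall>k. M k \<ge> 0 \<and> (\<forall>y\<in>topspace S. \<bar>\<Phi> k y\<bar> \<le> M k)" by (rule exE)
  \<comment> \<open>\<open>M k\<close> bounds \<open>\<Phi> k\<close>; the summand 1 avoids division
    by zero.\<close>
  define e where "e k = (1 / 2) ^ Suc k / (1 + M k)" for k
  have e: "e k > 0" for k using M by (auto simp: e_def intro!: divide_pos_pos add_pos_nonneg)
  have d: "2 * n < m" using m by simp
  define L where "L I k = two_point n (\<lambda>s. G s k) I" for I k
  define BB where "BB I r z = (if r = 0 then 1 else 0) * two_point n B I z" for I and r :: nat and z
  have L: "smooth (L I k)" for I k unfolding L_def by (rule smooth_two_point[OF ad'(1)])
  have BB: "smooth (BB I r)" for I r
    unfolding BB_def[abs_def] by (rule smooth_mult[OF smooth_const smooth_two_point[OF ad'(2)]])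
  obtain a where a: "\<forall>k r. \<bar>a k r\<bar> \<le> e k"
    "\<forall>N I. \<forall>z\<in>topspace (Euclidean_space (2 * n)). (\<exists>k<N. L I k z \<noteq> 0) \<longrightarrow>
       (\<exists>r<m. BB I r z + (\<Sum>k<N. a k r * L I k z) \<noteq> 0)"
    \<comment> \<open>One application serves both purposes: indices \<open>Inl\<close> will give
      injectivity and indices \<open>Inr\<close> immersivity. The index type is countable, as the
      null set argument requires.\<close>
    using generic_coefficients[of "2 * n" m L BB e, OF d L BB e] by (elim exE conjE)
  interpret embedding_data S C n U W Z K \<phi> \<rho> V c G B N a m
  proof
    show "adapted (V s) (c s) (G s) (B s) (N s)" for s by (rule ad)
    show "topspace S = (\<Union>s. V s)" by (rule V_cov)
    show "0 < m" using m by simp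
    show "\<bar>a k r * \<Phi> k y\<bar> \<le> (1 / 2) ^ Suc k" if y: "y \<in> topspace S" for y k r
    proof -
      have "\<bar>a k r * \<Phi> k y\<bar> \<le> e k * M k"
        unfolding abs_mult using a(1) M y e[of k] by (intro mult_mono) simp_all
      also have "\<dots> \<le> e k * (1 + M k)" using e[of k] by (intro mult_left_mono) simp_all
      also have "\<dots> = (1 / 2) ^ Suc k"
      proof -
        have "1 + M k \<noteq> 0" using M by (metis add_nonneg_eq_0_iff zero_le_one zero_neq_one)
        then show ?thesis unfolding e_def by (rule nonzero_eq_divide_eq[THEN iffD1, OF _ refl])
      qed
      finally show ?thesis .
    qed
    show "\<exists>r<m. (if r = 0 then 1 else 0) * (R y - R z) + (\<Sum>k<M. a k r * (\<Phi> k y - \<Phi> k z)) \<noteq> 0"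
      if y: "y \<in> topspace S" and z: "z \<in> topspace S" and k: "\<exists>k<M. \<Phi> k y \<noteq> \<Phi> k z" for y z M
    proof -
      \<comment> \<open>The two points may need different charts, which is why the index is a
        pair.\<close>
      obtain s t where s: "y \<in> V s" and t: "z \<in> V t" using y z V_cov by blast
      define w where "w = join n (\<phi> (c s) y) (\<phi> (c t) z)"
      have w: "two_point n g (Inl (s, t)) w = g s (\<phi> (c s) y) - g t (\<phi> (c t) z)" for g
        by (simp add: two_point_def w_def trunc_join[OF ad'(5)[OF s]] second_join[OF ad'(5)[OF t]])
      have LL: "L (Inl (s, t)) k w = \<Phi> k y - \<Phi> k z" for k
        unfolding L_def w ad'(3)[OF s] ad'(3)[OF t] ..
      have BL: "BB (Inl (s, t)) r w = (if r = 0 then 1 else 0) * (R y - R z)" for r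
        unfolding BB_def w ad'(4)[OF s] ad'(4)[OF t] ..
      have "\<exists>k<M. L (Inl (s, t)) k w \<noteq> 0" using k unfolding LL by simp
      then have "\<exists>r<m. BB (Inl (s, t)) r w + (\<Sum>k<M. a k r * L (Inl (s, t)) k w) \<noteq> 0"
        by (rule a(2)[THEN spec, THEN spec, THEN bspec, THEN mp, rotated]) (simp only: w_def join_in)
      then show ?thesis unfolding LL BL .
    qed
    show "\<exists>r<m. (if r = 0 then 1 else 0) * (\<Sum>l<n. pd l (B s) (\<phi> (c s) y) * v l) +
        (\<Sum>k<M. a k r * (\<Sum>l<n. pd l (G s k) (\<phi> (c s) y) * v l)) \<noteq> 0"
      if s: "y \<in> V s" and k: "\<exists>k<M. (\<Sum>l<n. pd l (G s k) (\<phi> (c s) y) * v l) \<noteq> 0" for y s M v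
    proof -
      \<comment> \<open>v may be any sequence; \<open>join\<close> keeps its first n entries, the
        only ones that the derivative reads.\<close>
      define w where "w = join n (\<phi> (c s) y) v"
      have w: "two_point n g (Inr s) w = (\<Sum>l<n. pd l (g s) (\<phi> (c s) y) * v l)" for g
        unfolding two_point_def w_def sum.case trunc_join[OF ad'(5)[OF s]] by (intro sum.cong refl) (simp add: join_shift)
      have LL: "L (Inr s) k w = (\<Sum>l<n. pd l (G s k) (\<phi> (c s) y) * v l)" for k
        unfolding L_def w ..
      have BL: "BB (Inr s) r w = (if r = 0 then 1 else 0) * (\<Sum>l<n. pd l (B s) (\<phi> (c s) y) * v l)" for r
        unfolding BB_def w ..
      have "\<exists>k<M. L (Inr s) k w \<noteq> 0" using k unfolding LL .
      then have "\<exists>r<m. BB (Inr s) r w + (\<Sum>k<M. a k r * L (Inr s) k w) \<noteq> 0"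
        by (rule a(2)[THEN spec, THEN spec, THEN bspec, THEN mp, rotated]) (simp only: w_def join_in)
      then show ?thesis unfolding LL BL .
    qed
  qed
  show ?thesis by (rule embeds)
qed

context diff_space begin

text \<open>All data at a point form one tuple, so that a single application of choice selects them
  together.\<close>

definition bump_chart :: "nat \<Rightarrow> 'a \<Rightarrow> 'a set \<times> ('a \<Rightarrow> nat \<Rightarrow> real) \<times> ('a \<Rightarrow> real) \<times> 'a set \<times> 'a set \<times> 'a set \<Rightarrow> bool" where
  "bump_chart n x T \<longleftrightarrow> (case T of (U, \<phi>, \<rho>, W, Z, K) \<Rightarrow>
    chart n U \<phi> \<and> \<rho> \<in> C \<and> (\<forall>y. 0 \<le> \<rho> y \<and> \<rho> y \<le> 1) \<and> openin S W \<and> openin S Z \<and> x \<in> W \<and>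
    (\<forall>y\<in>W. \<rho> y = 1) \<and> (\<forall>y\<in>Z. \<rho> y = 0) \<and> topspace S - U \<subseteq> Z \<and> compactin S K \<and>
    (\<forall>y\<in>topspace S - K. \<rho> y = 0))"

text \<open>The plateau is built inside the chart domain intersected with an open subset of a
  compact set, so that one function is supported in both.\<close>

lemma bump_chart_exists:
  assumes lc: "locally_compact_space S" and x: "x \<in> topspace S" and k: "locally_embeddable_at S C x k" "k \<le> n"
  shows "\<exists>T. bump_chart n x T"
proof -
  obtain U \<phi> where U: "x \<in> U" "chart n U \<phi>" using chart_exists[OF k] by (elim exE conjE)
  obtain V K where V: "openin S V" "compactin S K" "x \<in> V" "V \<subseteq> K"
    using lc x unfolding locally_compact_space_def by blast
  have "openin S U" using U(2) unfolding chart_def by (rule conjunct1)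
  then have UV: "openin S (U \<inter> V)" using V(1) by (rule openin_Int)
  have xUV: "x \<in> U \<inter> V" using U(1) V(3) by simp
  obtain \<rho> W Z where r: "\<rho> \<in> C" "openin S W" "openin S Z" "x \<in> W" "\<forall>y\<in>W. \<rho> y = 1" "\<forall>y\<in>Z. \<rho> y = 0"
    "topspace S - U \<inter> V \<subseteq> Z" "\<forall>y. 0 \<le> \<rho> y \<and> \<rho> y \<le> 1"
    using plateau_exists[OF UV xUV] by (elim exE conjE)
  have "topspace S - U \<subseteq> Z" "\<forall>y\<in>topspace S - K. \<rho> y = 0" using r(6,7) V(4) by blast+
  with U(2) r V(2) have "bump_chart n x (U, \<phi>, \<rho>, W, Z, K)" by (simp add: bump_chart_def)
  then show ?thesis by (rule exI)
qed

lemma embeds_of_dimension_le: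
  assumes lc: "locally_compact_space S" and sc: "second_countable S"
    and dim: "\<And>x. x \<in> topspace S \<Longrightarrow> \<exists>k\<le>n. locally_embeddable_at S C x k" and m: "m \<ge> 2 * n + 1"
    and ne: "topspace S \<noteq> {}"
  shows "diffeomorphic_to_subset_of_Euclidean S C m"
proof -
  have "\<forall>x\<in>topspace S. \<exists>T. bump_chart n x T" using bump_chart_exists[OF lc] dim by blast
  from bchoice[OF this] obtain T where T: "\<forall>x\<in>topspace S. bump_chart n x (T x)" by (rule exE)
  define W where "W x = fst (snd (snd (snd (T x))))" for x
  have "openin S (W x) \<and> x \<in> W x" if "x \<in> topspace S" for x
    using T[THEN bspec, OF that] unfolding bump_chart_def W_def by (auto split: prod.splits)
  then have "\<exists>xs :: nat \<Rightarrow> 'a. (\<forall>i. xs i \<in> topspace S) \<and> topspace S = (\<Union>i. W (xs i))"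
    by (rule Lindelof_sequence[OF sc ne])
  then obtain xs :: "nat \<Rightarrow> 'a" where
    xs: "\<forall>i. xs i \<in> topspace S" "topspace S = (\<Union>i. W (xs i))" by (elim exE conjE)
  have bc: "bump_chart n (xs i) (T (xs i))" for i using T xs(1) by blast
  interpret chart_sequence S C n "\<lambda>i. fst (T (xs i))" "\<lambda>i. W (xs i)" "\<lambda>i. fst (snd (snd (snd (snd (T (xs i))))))"
    "\<lambda>i. snd (snd (snd (snd (snd (T (xs i))))))" "\<lambda>i. fst (snd (T (xs i)))" "\<lambda>i. fst (snd (snd (T (xs i))))"
    using bc xs(2) unfolding bump_chart_def W_def
    by unfold_locales (auto simp: split_beta)
  show ?thesis by (rule embeds_in_Euclidean[OF sc ne m])
qed

text \<open>A case of its own because no sequence of points can be chosen in an empty space; here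
  every function lies in C by locality.\<close>

lemma embeds_empty:
  assumes "topspace S = {}"
  shows "diffeomorphic_to_subset_of_Euclidean S C m"
proof -
  have C: "f \<in> C" for f by (rule C_local) (simp only: assms empty_iff)
  have "diffeomorphic_spaces S C (subtopology (Euclidean_space m) {})
      (restricted_structure (Euclidean_space m) (C_infinity m) {})"
    unfolding diffeomorphic_spaces_def smooth_map_def restricted_structure_def topspace_subtopology assms
    by (intro exI[of _ "\<lambda>_. undefined"]) (simp add: C)
  then show ?thesis unfolding diffeomorphic_to_subset_of_Euclidean_def by blast
qed

end

theorem theorem3:
  fixes S :: "'a topology" and C :: "('a \<Rightarrow> real) set" and n m :: nat
  assumes "subcartesian_space S C"
    and "locally_compact_space S"
    and "second_countable S"
    and "connected_space S"
    and "has_structural_dimension S C n"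
    and "m \<ge> 2 * n + 1"
  shows "diffeomorphic_to_subset_of_Euclidean S C m"
proof -
  have ds: "differential_space S C"
    and emb: "\<And>x. x \<in> topspace S \<Longrightarrow> \<exists>k. locally_embeddable_at S C x k"
    using assms(1) unfolding subcartesian_space_def by blast+
  interpret diff_space S C by unfold_locales (rule ds)
  show ?thesis
  proof (cases "topspace S = {}")
    case True
    then show ?thesis by (rule embeds_empty)
  next
    case False
    have "\<exists>k\<le>n. locally_embeddable_at S C x k" if x: "x \<in> topspace S" for x
    proof (intro exI conjI)
      show "structural_dimension_at S C x \<le> n"
        using assms(5) x unfolding has_structural_dimension_def by blast
      \<comment> \<open>The least dimension is attained because some dimension exists at each point
        of a subcartesian space.\<close>
      show "locally_embeddable_at S C x (structural_dimension_at S C x)"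
        unfolding structural_dimension_at_def using emb[OF x] by (rule LeastI_ex)
    qed
    then show ?thesis using False by (intro embeds_of_dimension_le[OF assms(2,3) _ assms(6)])
  qed
qed

end
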